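(* Let $\{(L(t),\mathbf A(t),\phi(t))\}_{t\ge0}$ be the unbounded QBD-RAP approximation (defined in the context) to a fluid queue whose phase process $\{\varphi(t)\}_{t\ge0}$ is a continuous-time Markov chain on the finite set $\mathcal S$ with generator $\mathbf T=[T_{ij}]_{i,j\in\mathcal S}$. Let $\Theta_0=0$ and let $\Theta_k$, $k=1,2,\dots$, be the time of the $k$th jump of the phase process $\{\phi(t)\}$. Then, for any valid initial orbit $\mathbf A(0)=\mathbf a\in\mathcal A$ and any initial phase $\phi(0)=i\in\mathcal S$: for each $k\ge1$, given $\phi(\Theta_{k-1})=j$, the time $\Theta_k-\Theta_{k-1}$ is exponentially distributed with rate $|T_{jj}|$ and, at time $\Theta_k$, the phase jumps to $j'\neq j$ with probability $T_{jj'}/|T_{jj}|$. Hence $\{\phi(t)\}_{t\ge0}$ and $\{\varphi(t)\}_{t\ge0}$ (started from the same phase) have the same probability law.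
   Context: Fluid queue data: $\mathcal S$ is a finite set, $\mathbf T$ is the generator matrix of a continuous-time Markov chain on $\mathcal S$, and $c_i\in\mathbb R\setminus\{0\}$ ($i\in\mathcal S$) are rates. Matrix exponential variable: $\Delta>0$ and $Z$ is a nonnegative random variable with mean $\Delta$, variance $\mathrm{Var}(Z)$, no atom at $0$, and a matrix exponential distribution, i.e. $\mathbb P(Z>x)=\boldsymbol\alpha e^{\mathbf Sx}\mathbf 1$ with density $\boldsymbol\alpha e^{\mathbf Sx}\mathbf s$, $x\ge0$, where $\mathbf S$ is a real $p\times p$ matrix, $\boldsymbol\alpha$ a $1\times p$ row vector, $\mathbf 1$ the $p\times1$ vector of ones and $\mathbf s=-\mathbf S\mathbf 1$; the representation is minimal ($p$ is as small as possible). Put $\varepsilon=\mathrm{Var}(Z)^{1/3}$, assumed less than $1$. The representation is chosen such that for some points $0=t_1<2\varepsilon<t_2<\dots<t_p<\Delta-\varepsilon$ one has $\boldsymbol\alpha=\mathbf e_1^{\mathsf T}$ and $\mathbf e_n^{\mathsf T}e^{\mathbf Sx}\mathbf 1=\mathbb P(Z-t_n\ge x\mid Z>t_n)$ for $x\ge0$, $n=1,\dots,p$ (these functions of $x$ being linearly independent). Define $$\mathbf D=\int_0^{\Delta-\varepsilon}e^{\mathbf Sy}\mathbf s\,\frac{\boldsymbol\alpha e^{\mathbf Sy}}{\boldsymbol\alpha e^{\mathbf Sy}\mathbf 1}\,dy+\int_{\Delta-\varepsilon}^\infty e^{\mathbf Sy}\mathbf s\,\frac{\boldsymbol\alpha e^{\mathbf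 S(\Delta-\varepsilon)}}{\boldsymbol\alpha e^{\mathbf S(\Delta-\varepsilon)}\mathbf 1}\,dy .$$ Put $\mathbf D_{i,j}=\mathbf D$ if $\operatorname{sgn}(c_i)\ne\operatorname{sgn}(c_j)$ and $\mathbf D_{i,j}=\mathbf I$ otherwise. Valid orbits: $\mathcal A$ is the convex hull of all row vectors of the form $$\frac{\boldsymbol\alpha\left(\prod_{n=1}^{N}e^{\mathbf Su_n}\mathbf D_{i_n,i_{n+1}}\right)e^{\mathbf Su_{N+1}}}{\boldsymbol\alpha\left(\prod_{n=1}^{N}e^{\mathbf Su_n}\mathbf D_{i_n,i_{n+1}}\right)e^{\mathbf Su_{N+1}}\mathbf 1},\qquad N\ge0,\ u_1,\dots,u_{N+1}\ge0,\ i_1,\dots,i_{N+1}\in\mathcal S.$$ Unbounded QBD-RAP: the piecewise-deterministic Markov process $(L(t),\mathbf A(t),\phi(t))$ with level $L(t)\in\mathbb Z$, orbit $\mathbf A(t)\in\mathcal A$ and phase $\phi(t)\in\mathcal S$ such that, while in phase $i$: between events, $L$ and $\phi$ are constant and $\frac{d}{dt}\mathbf A(t)=|c_i|\big(\mathbf A(t)\mathbf S-(\mathbf A(t)\mathbf S\mathbf 1)\,\mathbf A(t)\big)$; with intensity $|c_i|\mathbf A(t)\mathbf s$ there is a change of level, at which $L$ changes by $+1$ if $c_i>0$ and by $-1$ if $c_i<0$, the orbit is reset to $\boldsymbol\alpha$, and the phase is unchanged; and for each $j\ne i$, with intensity $T_{ij}\mathbf A(t)\mathbf D_{i,j}\mathbf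 1$ there is a change of phase from $i$ to $j$, at which the orbit jumps from $\mathbf A(t^-)$ to $\mathbf A(t^-)\mathbf D_{i,j}/(\mathbf A(t^-)\mathbf D_{i,j}\mathbf 1)$ and the level is unchanged. *)

theory Defs
  imports "HOL-Probability.Probability"
begin

section \<open>Matrix exponentials\<close>

primrec mat_prod :: "(nat \<Rightarrow> real^'n^'n) \<Rightarrow> nat \<Rightarrow> real^'n^'n" where
  "mat_prod F 0 = mat 1"
| "mat_prod F (Suc n) = mat_prod F n ** F (Suc n)"

definition mexp :: "real^'n^'n \<Rightarrow> real^'n^'n" where
  "mexp A = (\<Sum>k. (1 / fact k) *\<^sub>R mat_prod (\<lambda>_. A) k)"

text \<open>Vectors of type \<^typ>\<open>real^'p\<close> serve as rows in \<open>a v* M\<close> and as columns in \<open>M *v b\<close>.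
  The constant \<open>1\<close> of this type is the vector of ones, so \<open>a \<bullet> 1\<close> is the row sum of \<open>a\<close>.\<close>

definition outer :: "real^'p \<Rightarrow> real^'p \<Rightarrow> real^'p^'p" where
  "outer u v = (\<chi> i j. u $ i * v $ j)"

definition normalise :: "real^'p \<Rightarrow> real^'p" where
  "normalise a = (1 / (a \<bullet> 1)) *\<^sub>R a"

definition exit_vec :: "real^'p^'p \<Rightarrow> real^'p" where
  "exit_vec S = - (S *v 1)"

section \<open>The matrix exponential random variable\<close>

text \<open>Minimality quantifies over representations of every smaller order. An order that varies inside
  a formula cannot be a type, so the competing representations use arrays indexed by \<open>{..<q}\<close>.\<close>

primrec array_power :: "nat \<Rightarrow> (nat \<Rightarrow> nat \<Rightarrow> real) \<Rightarrow> nat \<Rightarrow> nat \<Rightarrow> nat \<Rightarrow> real" where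
  "array_power q R 0 i j = (if i = j then 1 else 0)"
| "array_power q R (Suc n) i j = (\<Sum>k<q. array_power q R n i k * R k j)"

definition array_me_tail ::
    "nat \<Rightarrow> (nat \<Rightarrow> real) \<Rightarrow> (nat \<Rightarrow> nat \<Rightarrow> real) \<Rightarrow> real \<Rightarrow> real" where
  "array_me_tail q b R x = (\<Sum>i<q. \<Sum>j<q. b i * (\<Sum>n. x ^ n / fact n * array_power q R n i j))"

text \<open>The index type \<open>'p\<close> is a finite chain \<open>1 < \<dots> < p\<close> whose least element \<open>Min UNIV\<close> plays
  the role of the index \<open>1\<close>.\<close>

locale me_variable = prob_space N for N :: "'z measure" +
  fixes Z :: "'z \<Rightarrow> real" and \<Delta> \<epsilon> :: real
    and \<alpha> :: "real^('p::{finite,linorder})" and S :: "real^('p::{finite,linorder})^('p::{finite,linorder})"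
    and t :: "'p::{finite,linorder} \<Rightarrow> real"
  assumes mean_pos: "0 < \<Delta>"
    and Z_measurable: "random_variable borel Z"
    and Z_nonneg: "AE \<omega> in N. 0 \<le> Z \<omega>"
    and Z_no_atom: "\<P>(\<omega> in N. Z \<omega> = 0) = 0"
    and Z_integrable: "integrable N Z" "integrable N (\<lambda>\<omega>. (Z \<omega>)\<^sup>2)"
    and Z_mean: "expectation Z = \<Delta>"
    and eps_def: "\<epsilon> = root 3 (variance Z)"
    and eps_less_1: "\<epsilon> < 1"
    and tail: "\<And>x. 0 \<le> x \<Longrightarrow> \<P>(\<omega> in N. x < Z \<omega>) = (\<alpha> v* mexp (x *\<^sub>R S)) \<bullet> 1"
    and density: "distributed N lborel Z
          (\<lambda>x. ennreal (if 0 \<le> x then (\<alpha> v* mexp (x *\<^sub>R S)) \<bullet> exit_vec S else 0))"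
    and minimal: "\<And>q b R. q < CARD('p) \<Longrightarrow>
          \<not> (\<forall>x\<ge>0. \<P>(\<omega> in N. x < Z \<omega>) = array_me_tail q b R x)"
    and t_mono: "strict_mono t"
    and t_first: "t (Min UNIV) = 0"
    and eps_pos: "0 < 2 * \<epsilon>"
    and t_lower: "\<And>n. n \<noteq> Min UNIV \<Longrightarrow> 2 * \<epsilon> < t n"
    and t_upper: "\<And>n. t n < \<Delta> - \<epsilon>"
    and initial_vector: "\<alpha> = axis (Min UNIV) 1"
    and residual_life: "\<And>n x. 0 \<le> x \<Longrightarrow>
          (mexp (x *\<^sub>R S) *v 1) $ n = \<P>(\<omega> in N. x \<le> Z \<omega> - t n \<bar> t n < Z \<omega>)"
    and residual_life_independent: "\<And>b :: real^('p::{finite,linorder}).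
          (\<And>x. 0 \<le> x \<Longrightarrow> (\<Sum>n\<in>UNIV. b $ n * (mexp (x *\<^sub>R S) *v 1) $ n) = 0) \<Longrightarrow> b = 0"

section \<open>Continuous-time Markov chains\<close>

definition generator_matrix :: "real^'s^'s \<Rightarrow> bool" where
  "generator_matrix T \<longleftrightarrow>
     (\<forall>i j. i \<noteq> j \<longrightarrow> 0 \<le> T $ i $ j) \<and> (\<forall>i. (\<Sum>j\<in>UNIV. T $ i $ j) = 0)"

text \<open>The Markov property with transition matrices \<open>e\<^sup>T\<^sup>t\<close>, multiplied out so that
  no conditioning on null events occurs.\<close>

locale ctmc = prob_space M for M :: "'v measure" +
  fixes X :: "real \<Rightarrow> 'v \<Rightarrow> 's::finite" and T :: "real^'s^'s"
  assumes generator: "generator_matrix T"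
    and X_measurable: "\<And>t. 0 \<le> t \<Longrightarrow> random_variable (count_space UNIV) (X t)"
    and transition: "\<And>(n::nat) ts js. \<lbrakk>0 \<le> ts 0; \<And>k. k \<le> n \<Longrightarrow> ts k \<le> ts (Suc k)\<rbrakk> \<Longrightarrow>
          \<P>(\<omega> in M. \<forall>k\<le>Suc n. X (ts k) \<omega> = js k) =
          \<P>(\<omega> in M. \<forall>k\<le>n. X (ts k) \<omega> = js k) *
            mexp ((ts (Suc n) - ts n) *\<^sub>R T) $ js n $ js (Suc n)"

text \<open>The law of a process with values in a discrete space, on path space with the product
  \<open>\<sigma>\<close>-algebra.\<close>

definition process_law :: "'w measure \<Rightarrow> (real \<Rightarrow> 'w \<Rightarrow> 's) \<Rightarrow> (real \<Rightarrow> 's) measure" where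
  "process_law M X =
     distr M (\<Pi>\<^sub>M t\<in>{0..}. count_space UNIV) (\<lambda>\<omega>. \<lambda>t\<in>{0..}. X t \<omega>)"

text \<open>The jump times of a right-continuous step path; \<open>\<infinity>\<close> if there are fewer jumps.\<close>

primrec jump_time :: "(real \<Rightarrow> 's) \<Rightarrow> nat \<Rightarrow> ereal" where
  "jump_time f 0 = 0"
| "jump_time f (Suc k) =
     Inf {ereal t | t. jump_time f k < ereal t \<and> f t \<noteq> f (real_of_ereal (jump_time f k))}"

definition process_jump_time :: "(real \<Rightarrow> 'w \<Rightarrow> 's) \<Rightarrow> nat \<Rightarrow> 'w \<Rightarrow> ereal" where
  "process_jump_time X k \<omega> = jump_time (\<lambda>t. X t \<omega>) k"

section \<open>The unbounded QBD-RAP\<close>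

text \<open>The parameter \<open>d\<close> stands for \<open>\<Delta> - \<epsilon>\<close>.\<close>

locale qbd_rap_data =
  fixes c :: "'s::finite \<Rightarrow> real" and T :: "real^'s^'s"
    and \<alpha> :: "real^'p::finite" and S :: "real^'p^'p" and d :: real
begin

definition D :: "real^'p^'p" where
  "D = (LBINT y:{0..d}. outer (mexp (y *\<^sub>R S) *v exit_vec S) (normalise (\<alpha> v* mexp (y *\<^sub>R S))))
     + (LBINT y:{d..}. outer (mexp (y *\<^sub>R S) *v exit_vec S) (normalise (\<alpha> v* mexp (d *\<^sub>R S))))"

definition D_phase :: "'s \<Rightarrow> 's \<Rightarrow> real^'p^'p" where
  "D_phase i j = (if sgn (c i) \<noteq> sgn (c j) then D else mat 1)"

definition valid_orbits :: "(real^'p) set" where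
  "valid_orbits = convex hull
     {normalise (\<alpha> v* (mat_prod (\<lambda>n. mexp (u n *\<^sub>R S) ** D_phase (i n) (i (Suc n))) N
                        ** mexp (u (Suc N) *\<^sub>R S))) | N u i. \<forall>n. 0 \<le> u n}"

definition orbit_field :: "'s \<Rightarrow> real^'p \<Rightarrow> real^'p" where
  "orbit_field i a = \<bar>c i\<bar> *\<^sub>R (a v* S - ((a v* S) \<bullet> 1) *\<^sub>R a)"

text \<open>The solution of the orbit equation on \<open>[0,\<infinity>)\<close>. From a valid orbit it exists and is unique.\<close>

definition orbit_flow :: "'s \<Rightarrow> real^'p \<Rightarrow> real \<Rightarrow> real^'p" where
  "orbit_flow i a = (SOME g. g 0 = a \<and>
     (\<forall>t\<ge>0. (g has_vector_derivative orbit_field i (g t)) (at t within {0..})))"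

definition flow :: "int \<times> (real^'p) \<times> 's \<Rightarrow> real \<Rightarrow> int \<times> (real^'p) \<times> 's" where
  "flow = (\<lambda>(l, a, i) t. (l, orbit_flow i a t, i))"

definition level_rate :: "int \<times> (real^'p) \<times> 's \<Rightarrow> real" where
  "level_rate = (\<lambda>(l, a, i). \<bar>c i\<bar> * (a \<bullet> exit_vec S))"

definition level_target :: "int \<times> (real^'p) \<times> 's \<Rightarrow> int \<times> (real^'p) \<times> 's" where
  "level_target = (\<lambda>(l, a, i). (if 0 < c i then l + 1 else l - 1, \<alpha>, i))"

definition phase_rate :: "'s \<Rightarrow> int \<times> (real^'p) \<times> 's \<Rightarrow> real" where
  "phase_rate j = (\<lambda>(l, a, i). T $ i $ j * ((a v* D_phase i j) \<bullet> 1))"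

definition phase_target :: "'s \<Rightarrow> int \<times> (real^'p) \<times> 's \<Rightarrow> int \<times> (real^'p) \<times> 's" where
  "phase_target j = (\<lambda>(l, a, i). (l, normalise (a v* D_phase i j), j))"

text \<open>The intensity, in state \<open>x\<close>, of the events that move the process into \<open>B\<close>.\<close>

definition event_rate ::
    "int \<times> (real^'p) \<times> 's \<Rightarrow> (int \<times> (real^'p) \<times> 's) set \<Rightarrow> real" where
  "event_rate x B = level_rate x * indicat_real B (level_target x)
     + (\<Sum>j \<in> UNIV - {snd (snd x)}. phase_rate j x * indicat_real B (phase_target j x))"

text \<open>The density, at elapsed time \<open>s\<close> from state \<open>x\<close>, of the next event moving the process
  into \<open>B\<close>.\<close>

definition event_density ::
    "int \<times> (real^'p) \<times> 's \<Rightarrow> (int \<times> (real^'p) \<times> 's) set \<Rightarrow> real \<Rightarrow> real" where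
  "event_density x B s =
     event_rate (flow x s) B * exp (- (LBINT r:{0..s}. event_rate (flow x r) UNIV))"

definition state_space :: "(int \<times> (real^'p) \<times> 's) measure" where
  "state_space = count_space UNIV \<Otimes>\<^sub>M borel \<Otimes>\<^sub>M count_space UNIV"

end

text \<open>A piecewise-deterministic Markov process in the sense of Davis: \<open>\<tau> n\<close> is the time of the
  \<open>n\<close>-th event (change of level or of phase), \<open>\<infinity>\<close> if there are fewer than \<open>n\<close> events, and the
  intensities prescribe the conditional law of the next event, given the history of the events so
  far. As the process lives on all of \<open>[0,\<infinity>)\<close>, its events do not accumulate. For
  \<open>\<tau> n = \<infinity>\<close> the state \<open>post n\<close> is a dummy (\<open>real_of_ereal \<infinity> = 0\<close>).\<close>

locale qbd_rap = qbd_rap_data c T \<alpha> S d + prob_space M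
  for c :: "'s::finite \<Rightarrow> real" and T :: "real^'s^'s"
    and \<alpha> :: "real^'p::finite" and S :: "real^'p^'p" and d :: real
    and M :: "'w measure" +
  fixes L :: "real \<Rightarrow> 'w \<Rightarrow> int" and A :: "real \<Rightarrow> 'w \<Rightarrow> real^'p" and \<phi> :: "real \<Rightarrow> 'w \<Rightarrow> 's"
    and \<tau> :: "nat \<Rightarrow> 'w \<Rightarrow> ereal"
  fixes post :: "nat \<Rightarrow> 'w \<Rightarrow> int \<times> (real^'p) \<times> 's"
    and history :: "nat \<Rightarrow> 'w measure"
  defines "post n \<omega> \<equiv> (L (real_of_ereal (\<tau> n \<omega>)) \<omega>, A (real_of_ereal (\<tau> n \<omega>)) \<omega>,
                        \<phi> (real_of_ereal (\<tau> n \<omega>)) \<omega>)"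
    and "history n \<equiv> vimage_algebra (space M) (\<lambda>\<omega>. \<lambda>k\<in>{..n}. (\<tau> k \<omega>, post k \<omega>))
                       (\<Pi>\<^sub>M k\<in>{..n}. borel \<Otimes>\<^sub>M state_space)"
  assumes process_measurable: "(\<lambda>(t, \<omega>). (L t \<omega>, A t \<omega>, \<phi> t \<omega>))
            \<in> restrict_space borel {0..} \<Otimes>\<^sub>M M \<rightarrow>\<^sub>M state_space"
    and orbit_valid: "\<And>t \<omega>. \<omega> \<in> space M \<Longrightarrow> 0 \<le> t \<Longrightarrow> A t \<omega> \<in> valid_orbits"
    and event_measurable: "\<And>n. random_variable borel (\<tau> n)"
    and event_0: "\<And>\<omega>. \<omega> \<in> space M \<Longrightarrow> \<tau> 0 \<omega> = 0"
    and event_less: "\<And>n \<omega>. \<omega> \<in> space M \<Longrightarrow> \<tau> n \<omega> < \<infinity> \<Longrightarrow> \<tau> n \<omega> < \<tau> (Suc n) \<omega>"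
    and event_infinite: "\<And>n \<omega>. \<omega> \<in> space M \<Longrightarrow> \<tau> n \<omega> = \<infinity> \<Longrightarrow> \<tau> (Suc n) \<omega> = \<infinity>"
    and events_diverge: "\<And>\<omega>. \<omega> \<in> space M \<Longrightarrow> (\<lambda>n. \<tau> n \<omega>) \<longlonglongrightarrow> \<infinity>"
    and between_events: "\<And>n t \<omega>. \<omega> \<in> space M \<Longrightarrow> \<tau> n \<omega> \<le> ereal t \<Longrightarrow> ereal t < \<tau> (Suc n) \<omega> \<Longrightarrow>
          (L t \<omega>, A t \<omega>, \<phi> t \<omega>) = flow (post n \<omega>) (t - real_of_ereal (\<tau> n \<omega>))"
    and event_law: "\<And>n t B. 0 \<le> t \<Longrightarrow> B \<in> sets state_space \<Longrightarrow>
          AE \<omega> in M. \<tau> n \<omega> < \<infinity> \<longrightarrow>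
            real_cond_exp M (history n)
              (indicat_real {\<omega>\<in>space M. \<tau> (Suc n) \<omega> \<le> \<tau> n \<omega> + ereal t \<and> post (Suc n) \<omega> \<in> B}) \<omega>
            = (LBINT s:{0..t}. event_density (post n \<omega>) B s)"

end

theory Submission
  imports Defs
begin

text \<open>
  The phase is Markovian by itself because the orbit has no influence on the changes of phase.
  A valid orbit \<open>a\<close> stands for a lifetime with density \<open>a e\<^sup>S\<^sup>y s\<close>, \<open>y \<ge> 0\<close>, and total mass \<open>a 1 = 1\<close>.
  The matrix \<open>D\<close> turns it into a mixture of the rows \<open>\<alpha> e\<^sup>S\<^sup>y / (\<alpha> e\<^sup>S\<^sup>y 1)\<close>, which again have row sum \<open>1\<close>,
  and the weights \<open>a e\<^sup>S\<^sup>y s dy\<close> of the mixture add up to \<open>a 1\<close>. So \<open>a D 1 = a 1\<close> (lemma \<open>D_row_sum\<close>), and in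
  phase \<open>i\<close> the intensity \<open>T\<^sub>i\<^sub>j A(t) D\<^sub>i\<^sub>,\<^sub>j 1\<close> of a change to phase \<open>j\<close> is \<open>T\<^sub>i\<^sub>j\<close>, whatever the orbit is. Changes of
  level do depend on the orbit, but they do not affect the phase.

  The process is given through the conditional law of each event given the earlier ones, and the
  events include the changes of level. The remaining work is to integrate these out. In phase \<open>i\<close> the
  orbit equation has the solution \<open>a e\<^sup>S\<^sup>r\<close>, \<open>r = \<bar>c\<^sub>i\<bar> t\<close>, divided by its row sum \<open>\<sigma>(t)\<close> (lemma \<open>orbit_flow_eq\<close>).
  Changes of level have the hazard rate \<open>- \<sigma>' / \<sigma>\<close>, so the next event is a change of level with
  density \<open>- e\<^sup>q\<^sup>t \<sigma>'(t)\<close>, \<open>q = T\<^sub>i\<^sub>i\<close>, and a change to phase \<open>j\<close> with density \<open>T\<^sub>i\<^sub>j e\<^sup>q\<^sup>t \<sigma>(t)\<close>. Let \<open>w\<close> and \<open>z\<close>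
  satisfy the backward equation \<open>w\<^sub>i' = T\<^sub>i\<^sub>i w\<^sub>i + \<Sum>\<^sub>j\<^sub>\<noteq>\<^sub>i T\<^sub>i\<^sub>j z\<^sub>j\<close>. Reward a change of level at time \<open>t\<close> with
  \<open>w\<^sub>i(r - t)\<close> and a change to phase \<open>j\<close> with \<open>z\<^sub>j(r - t)\<close>. The integrand of the mean reward is then the
  derivative of \<open>- e\<^sup>q\<^sup>t \<sigma>(t) w\<^sub>i(r - t)\<close> (lemma \<open>phase_density_integral\<close>): the value \<open>w\<close> is preserved in mean
  from one event to the next although the orbit is random (lemma \<open>next_event_step\<close>). As the events do
  not accumulate, these identities can be summed over all events before a deadline. Two choices of \<open>w\<close> and \<open>z\<close>
  give the two halves of the theorem.

  With \<open>w = z\<close> a column of \<open>e\<^sup>T\<^sup>\<rho>\<close>, the sum is the Markov property of the phase at a fixed time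
  (\<open>markov_at_fixed_time\<close>, \<open>phase_transition\<close>), which determines the finite-dimensional distributions and
  hence the law (\<open>ctmc_law_unique\<close>). With \<open>z\<^sub>j = 1\<close> for \<open>j = j'\<close> and \<open>0\<close> otherwise, and
  \<open>w\<^sub>i(\<rho>) = T\<^sub>i\<^sub>j\<^sub>' / \<bar>T\<^sub>i\<^sub>i\<bar> (1 - e\<^sup>q\<^sup>\<rho>)\<close> for \<open>i \<noteq> j'\<close>, it is the joint law of the waiting time for the next change of phase and of the
  phase that it leads to (\<open>first_phase_jump\<close>), started at any event, in particular at the event that is the
  \<open>k\<close>-th jump of the phase.
\<close>

section \<open>Matrix exponentials\<close>

text \<open>The sum of the moduli of the entries is a submultiplicative bound for the entries of the powers,
  so that the exponential series converges entry by entry.\<close>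

lemma abs_mat_prod_const_nth_le:
  fixes A :: "real^'n^'n"
  shows "\<bar>mat_prod (\<lambda>_. A) k $ i $ j\<bar> \<le> (\<Sum>i\<in>UNIV. \<Sum>j\<in>UNIV. \<bar>A $ i $ j\<bar>) ^ k"
proof (induction k arbitrary: i j)
  case 0
  show ?case by (simp add: mat_def)
next
  case (Suc k)
  let ?c = "\<Sum>i\<in>UNIV. \<Sum>j\<in>UNIV. \<bar>A $ i $ j\<bar>"
  have c: "0 \<le> ?c" by (intro sum_nonneg) auto
  have "\<bar>mat_prod (\<lambda>_. A) (Suc k) $ i $ j\<bar>
      \<le> (\<Sum>l\<in>UNIV. \<bar>mat_prod (\<lambda>_. A) k $ i $ l * A $ l $ j\<bar>)"
    by (simp add: matrix_matrix_mult_def sum_abs)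
  also have "\<dots> \<le> (\<Sum>l\<in>UNIV. ?c ^ k * \<bar>A $ l $ j\<bar>)"
    by (intro sum_mono) (simp add: abs_mult Suc mult_right_mono)
  also have "\<dots> = ?c ^ k * (\<Sum>l\<in>UNIV. \<bar>A $ l $ j\<bar>)"
    by (simp add: sum_distrib_left)
  also have "\<dots> \<le> ?c ^ k * ?c"
    by (intro mult_left_mono sum_mono zero_le_power c)
      (auto intro!: member_le_sum[where f="\<lambda>j. \<bar>A $ _ $ j\<bar>"])
  finally show ?case by (simp add: mult.commute)
qed

lemma mat_prod_scaleR: "mat_prod (\<lambda>_. x *\<^sub>R A) k = x ^ k *\<^sub>R mat_prod (\<lambda>_. A) k"
  by (induction k)
    (simp_all add: vec_eq_iff matrix_matrix_mult_def sum_distrib_left algebra_simps)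

lemma summable_mexp_nth: "summable (\<lambda>k. (mat_prod (\<lambda>_. A) k $ i $ j / fact k) * x ^ k)"
  for A :: "real^'n^'n"
proof (rule summable_comparison_test')
  let ?c = "\<Sum>i\<in>UNIV. \<Sum>j\<in>UNIV. \<bar>A $ i $ j\<bar>"
  show "summable (\<lambda>k. inverse (fact k) * (?c * \<bar>x\<bar>) ^ k)"
    by (rule summable_exp)
  show "norm ((mat_prod (\<lambda>_. A) k $ i $ j / fact k) * x ^ k) \<le> inverse (fact k) * (?c * \<bar>x\<bar>) ^ k"
    if "k \<ge> 0" for k
    using mult_left_mono[OF abs_mat_prod_const_nth_le[of A k i j], of "\<bar>x\<bar> ^ k"]
    by (simp add: abs_mult power_abs field_simps)
qed

text \<open>An entry of \<open>e\<^sup>x\<^sup>A\<close> is a power series in \<open>x\<close>, which makes the calculus of real power series available.\<close>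

lemma mexp_nth_sums:
  fixes A :: "real^'n^'n"
  shows "(\<lambda>k. (mat_prod (\<lambda>_. A) k $ i $ j / fact k) * x ^ k) sums (mexp (x *\<^sub>R A) $ i $ j)"
proof -
  let ?f = "\<lambda>k. (1 / fact k) *\<^sub>R mat_prod (\<lambda>_. x *\<^sub>R A) k"
  have *: "(\<lambda>k. (mat_prod (\<lambda>_. A) k $ i $ j / fact k) * x ^ k) = (\<lambda>k. ?f k $ i $ j)" for i j
    by (simp add: mat_prod_scaleR mult.commute)
  have "?f sums (\<chi> i j. \<Sum>k. ?f k $ i $ j)"
    unfolding sums_def
  proof (intro vec_tendstoI)
    fix i j
    have "(\<lambda>k. ?f k $ i $ j) sums (\<Sum>k. ?f k $ i $ j)"
      using summable_mexp_nth[of A i j x] unfolding * by (rule summable_sums)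
    then show "(\<lambda>n. (\<Sum>i<n. ?f i) $ i $ j) \<longlonglongrightarrow> (\<chi> i j. \<Sum>k. ?f k $ i $ j) $ i $ j"
      by (simp add: sums_def)
  qed
  then have "?f sums mexp (x *\<^sub>R A)"
    unfolding mexp_def by (simp add: sums_iff)
  then show ?thesis
    unfolding * by (intro sums_vec_nth)
qed

lemma mexp_zero [simp]: "mexp (0 :: real^'n^'n) = mat 1"
proof -
  have "mexp (0 *\<^sub>R 0 :: real^'n^'n) $ i $ j = mat 1 $ i $ j" for i j
    using mexp_nth_sums[of 0 i j 0]
    by (simp only: powser_sums_zero_iff) simp
  then show ?thesis by (simp add: vec_eq_iff)
qed

lemma mat_prod_const_comm: "A ** mat_prod (\<lambda>_. A) k = mat_prod (\<lambda>_. A) k ** A"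
  by (induction k) (simp_all add: matrix_mul_assoc)

text \<open>The coefficients are shifted by one so that the left-hand side is the termwise derivative of the
  series for \<open>e\<^sup>x\<^sup>A\<close>.\<close>

lemma mexp_mult_nth_sums:
  fixes A :: "real^'n^'n"
  shows "(\<lambda>k. (mat_prod (\<lambda>_. A) (Suc k) $ i $ j / fact k) * x ^ k) sums ((mexp (x *\<^sub>R A) ** A) $ i $ j)"
proof -
  have "(\<lambda>k. \<Sum>l\<in>UNIV. (mat_prod (\<lambda>_. A) k $ i $ l / fact k * x ^ k) * A $ l $ j)
      sums (\<Sum>l\<in>UNIV. mexp (x *\<^sub>R A) $ i $ l * A $ l $ j)"
    by (intro sums_sum sums_mult2 mexp_nth_sums)
  then show ?thesis
    by (simp add: matrix_matrix_mult_def sum_distrib_left sum_distrib_right sum_divide_distrib algebra_simps)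
qed

lemma mexp_comm: "A ** mexp (x *\<^sub>R A) = mexp (x *\<^sub>R A) ** A" for A :: "real^'n^'n"
proof -
  have "(A ** mexp (x *\<^sub>R A)) $ i $ j = (mexp (x *\<^sub>R A) ** A) $ i $ j" for i j
  proof -
    have "(\<lambda>k. \<Sum>l\<in>UNIV. A $ i $ l * (mat_prod (\<lambda>_. A) k $ l $ j / fact k * x ^ k))
        sums (\<Sum>l\<in>UNIV. A $ i $ l * mexp (x *\<^sub>R A) $ l $ j)"
      by (intro sums_sum sums_mult mexp_nth_sums)
    also have "(\<lambda>k. \<Sum>l\<in>UNIV. A $ i $ l * (mat_prod (\<lambda>_. A) k $ l $ j / fact k * x ^ k))
        = (\<lambda>k. (A ** mat_prod (\<lambda>_. A) k) $ i $ j / fact k * x ^ k)"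
      by (simp add: matrix_matrix_mult_def sum_distrib_left sum_distrib_right sum_divide_distrib algebra_simps)
    also have "\<dots> = (\<lambda>k. mat_prod (\<lambda>_. A) (Suc k) $ i $ j / fact k * x ^ k)"
      by (simp only: mat_prod_const_comm mat_prod.simps)
    finally have "\<dots> sums ((A ** mexp (x *\<^sub>R A)) $ i $ j)"
      by (simp add: matrix_matrix_mult_def)
    then show ?thesis using mexp_mult_nth_sums by (rule sums_unique2)
  qed
  then show ?thesis by (simp add: vec_eq_iff)
qed

lemma mexp_nth_has_derivative:
  fixes A :: "real^'n^'n"
  shows "((\<lambda>x. mexp (x *\<^sub>R A) $ i $ j) has_real_derivative (mexp (x *\<^sub>R A) ** A) $ i $ j) (at x)"
proof -
  let ?c = "\<lambda>k. mat_prod (\<lambda>_. A) k $ i $ j / fact k"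
  have "((\<lambda>x. \<Sum>k. ?c k * x ^ k) has_real_derivative (\<Sum>k. diffs ?c k * x ^ k)) (at x)"
    by (rule termdiffs_strong_converges_everywhere) (rule summable_mexp_nth)
  moreover have "diffs ?c = (\<lambda>k. mat_prod (\<lambda>_. A) (Suc k) $ i $ j / fact k)"
    by (rule ext) (simp add: diffs_def fact_Suc del: mat_prod.simps of_nat_Suc)
  ultimately show ?thesis
    by (simp only: sums_unique[OF mexp_nth_sums] sums_unique[OF mexp_mult_nth_sums])
qed

lemma matrix_mult_nth_has_derivative:
  fixes F G :: "real \<Rightarrow> real^'n^'n"
  assumes F: "\<And>i j. ((\<lambda>x. F x $ i $ j) has_real_derivative F' $ i $ j) (at x within X)"
    and G: "\<And>i j. ((\<lambda>x. G x $ i $ j) has_real_derivative G' $ i $ j) (at x within X)"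
  shows "((\<lambda>x. (F x ** G x) $ i $ j) has_real_derivative (F' ** G x + F x ** G') $ i $ j) (at x within X)"
  by (auto intro!: derivative_eq_intros F G
      simp: matrix_matrix_mult_def sum.distrib mult.commute)

text \<open>For fixed \<open>y\<close> the product \<open>e\<^bsup>(y+x)A\<^esup> e\<^bsup>-xA\<^esup>\<close> has derivative zero in \<open>x\<close>, so it equals \<open>e\<^sup>y\<^sup>A\<close>. This holds for
  all \<open>x\<close> and \<open>y\<close>; the case \<open>y = 0\<close> makes \<open>e\<^bsup>-xA\<^esup>\<close> invertible, and the functional equation follows.\<close>

lemma mexp_add:
  fixes A :: "real^'n^'n"
  shows "mexp ((x + y) *\<^sub>R A) = mexp (x *\<^sub>R A) ** mexp (y *\<^sub>R A)"
proof -
  let ?E = "\<lambda>x. mexp (x *\<^sub>R A)"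
  have const: "?E (y + x) ** ?E (- x) = ?E y" for x y
  proof -
    have "(?E (y + x) ** ?E (- x)) $ i $ j = (?E (y + 0) ** ?E (- 0)) $ i $ j" for i j
    proof (rule DERIV_isconst_all[of "\<lambda>x. (?E (y + x) ** ?E (- x)) $ i $ j"], rule allI)
      fix x
      have "((\<lambda>x. (?E (y + x) ** ?E (- x)) $ i $ j) has_real_derivative
          ((?E (y + x) ** A) ** ?E (- x) + ?E (y + x) ** (- (?E (- x) ** A))) $ i $ j) (at x)"
      proof (rule matrix_mult_nth_has_derivative)
        fix i j
        show "((\<lambda>x. ?E (y + x) $ i $ j) has_real_derivative (?E (y + x) ** A) $ i $ j) (at x)"
          using DERIV_chain2[where f="\<lambda>x. ?E x $ i $ j" and g="\<lambda>x. y + x" and x=x and s=UNIV,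
              OF mexp_nth_has_derivative DERIV_add[OF DERIV_const DERIV_ident]]
          by simp
        show "((\<lambda>x. ?E (- x) $ i $ j) has_real_derivative (- (?E (- x) ** A)) $ i $ j) (at x)"
          using DERIV_chain2[OF mexp_nth_has_derivative[of A i j "- x"] DERIV_minus[OF DERIV_ident]]
          by simp
      qed
      also have "(?E (y + x) ** A) ** ?E (- x) + ?E (y + x) ** (- (?E (- x) ** A)) = 0"
      proof -
        have neg: "B ** (- C) = - (B ** C)" for B C :: "real^'n^'n"
          by (simp add: matrix_matrix_mult_def vec_eq_iff sum_negf)
        show ?thesis
          using mexp_comm[of A "- x"] by (simp add: neg flip: matrix_mul_assoc)
      qed
      finally show "((\<lambda>x. (?E (y + x) ** ?E (- x)) $ i $ j) has_real_derivative 0) (at x)" by simp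
    qed
    then show ?thesis by (simp add: vec_eq_iff)
  qed
  have "?E (x + y) = ?E (x + y) ** (?E (- y) ** ?E (- (- y)))"
    using const[of 0 "- y"] by simp
  also have "\<dots> = ?E x ** ?E y"
    using const[of x y] by (simp add: matrix_mul_assoc)
  finally show ?thesis .
qed

lemma mexp_minus: "mexp (x *\<^sub>R A) ** mexp (- (x *\<^sub>R A)) = mat 1"
  using mexp_add[of x "- x" A] by simp

lemma mexp_bilinear_has_derivative:
  fixes A :: "real^'n^'n"
  shows "((\<lambda>x. (a v* mexp (x *\<^sub>R A)) \<bullet> b) has_real_derivative (a v* mexp (x *\<^sub>R A)) \<bullet> (A *v b)) (at x)"
proof -
  have eq: "(a v* B) \<bullet> b = (\<Sum>i\<in>UNIV. \<Sum>j\<in>UNIV. a $ i * B $ i $ j * b $ j)" for B :: "real^'n^'n" and b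
    unfolding dot_lmul_matrix by (simp add: inner_vec_def matrix_vector_mult_def sum_distrib_left mult.assoc)
  have "((\<lambda>x. (a v* mexp (x *\<^sub>R A)) \<bullet> b) has_real_derivative (a v* (mexp (x *\<^sub>R A) ** A)) \<bullet> b) (at x)"
    unfolding eq by (auto intro!: derivative_eq_intros mexp_nth_has_derivative simp: mult_ac)
  also have "(a v* (mexp (x *\<^sub>R A) ** A)) \<bullet> b = (a v* mexp (x *\<^sub>R A)) \<bullet> (A *v b)"
    by (simp add: dot_lmul_matrix matrix_vector_mul_assoc)
  finally show ?thesis .
qed

lemma mexp_bilinear_has_derivative_scaled:
  fixes A :: "real^'n^'n"
  shows "((\<lambda>x. (a v* mexp ((r * x) *\<^sub>R A)) \<bullet> b) has_real_derivative
    r * ((a v* mexp ((r * x) *\<^sub>R A)) \<bullet> (A *v b))) (at x within X)"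
  using DERIV_chain2[OF mexp_bilinear_has_derivative[of a A b "r * x"] DERIV_cmult_Id]
  by (simp add: mult.commute)

lemma mexp_bilinear_add:
  "((a v* mexp (x *\<^sub>R A)) v* mexp (y *\<^sub>R A)) = a v* mexp ((x + y) *\<^sub>R A)"
  by (simp add: vector_matrix_mul_assoc mexp_add)

lemma mexp_row_eq_0_iff: "a v* mexp (x *\<^sub>R A) = 0 \<longleftrightarrow> a = 0" for A :: "real^'n^'n"
proof
  assume "a v* mexp (x *\<^sub>R A) = 0"
  then have "a v* (mexp (x *\<^sub>R A) ** mexp (- x *\<^sub>R A)) = 0"
    by (simp flip: vector_matrix_mul_assoc)
  then show "a = 0" by (simp add: mexp_minus)
qed simp

text \<open>Continuity jointly in the row and in the time makes the event densities jointly measurable in the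
  state and the elapsed time.\<close>

lemma continuous_on_mexp_row:
  fixes A :: "real^'n^'n"
  shows "continuous_on X (\<lambda>(a, x). a v* mexp (x *\<^sub>R A))"
proof -
  have "continuous_on X (\<lambda>p. mexp (snd p *\<^sub>R A) $ i $ j)" for i j
  proof -
    have "continuous_on UNIV (\<lambda>x. mexp (x *\<^sub>R A) $ i $ j)"
      by (intro DERIV_continuous_on) (rule mexp_nth_has_derivative[THEN DERIV_subset], simp)
    then show ?thesis
      by (rule continuous_on_compose2) (auto intro: continuous_intros)
  qed
  note c = this
  show ?thesis
    unfolding vector_matrix_mult_def case_prod_beta
    by (intro continuous_on_vec_lambda continuous_on_sum continuous_on_mult c
        continuous_on_component[OF continuous_on_fst[OF continuous_on_id]])
qed

text \<open>A large multiple \<open>r\<close> of the unit matrix makes \<open>T + r I\<close> nonnegative, and \<open>e\<^sup>r\<^sup>x e\<^sup>x\<^sup>T = e\<^bsup>x(T+rI)\<^esup>\<close>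
  is a series of nonnegative terms.\<close>

lemma mexp_generator_nonneg:
  fixes T :: "real^'s^'s"
  assumes T: "\<And>i j. i \<noteq> j \<Longrightarrow> 0 \<le> T $ i $ j" and x: "0 \<le> x"
  shows "0 \<le> mexp (x *\<^sub>R T) $ i $ j"
proof -
  define r where "r = (\<Sum>i\<in>UNIV. \<bar>T $ i $ i\<bar>)"
  define B where "B = T + r *\<^sub>R mat 1"
  have r: "\<bar>T $ i $ i\<bar> \<le> r" for i
    unfolding r_def by (rule member_le_sum[where f="\<lambda>i. \<bar>T $ i $ i\<bar>"]) auto
  have B: "0 \<le> B $ i $ j" for i j
    using T[of i j] r[of i] by (auto simp: B_def mat_def)
  have BC: "B ** C = T ** C + r *\<^sub>R C" for C :: "real^'s^'s"
  proof -
    have "B $ i $ l * x = T $ i $ l * x + (if i = l then r * x else 0)" for i l x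
      by (simp add: B_def mat_def algebra_simps)
    then show ?thesis
      by (simp add: vec_eq_iff matrix_matrix_mult_def sum.distrib)
  qed
  have "0 \<le> mat_prod (\<lambda>_. B) k $ i $ j" for k i j
    by (induction k arbitrary: i j)
      (auto simp: mat_def matrix_matrix_mult_def intro!: sum_nonneg mult_nonneg_nonneg B)
  then have pos: "0 \<le> mexp (x *\<^sub>R B) $ i $ j" for i j
    using x by (intro sums_le[OF _ sums_zero mexp_nth_sums]) auto
  let ?H = "\<lambda>x. (exp (r * x) *\<^sub>R mexp (x *\<^sub>R T))"
  have "(mexp (- x *\<^sub>R B) ** ?H x) $ i $ j = (mexp (- 0 *\<^sub>R B) ** ?H 0) $ i $ j" for i j x
  proof (rule DERIV_isconst_all[of "\<lambda>x. (mexp (- x *\<^sub>R B) ** ?H x) $ i $ j"], rule allI)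
    fix x
    have "((\<lambda>x. (mexp (- x *\<^sub>R B) ** ?H x) $ i $ j) has_real_derivative
        (- (mexp (- x *\<^sub>R B) ** B) ** ?H x + mexp (- x *\<^sub>R B) ** (B ** ?H x)) $ i $ j) (at x)"
    proof (rule matrix_mult_nth_has_derivative)
      fix i j
      show "((\<lambda>x. mexp (- x *\<^sub>R B) $ i $ j) has_real_derivative (- (mexp (- x *\<^sub>R B) ** B)) $ i $ j) (at x)"
        using DERIV_chain2[OF mexp_nth_has_derivative[of B i j "- x"] DERIV_minus[OF DERIV_ident]]
        by simp
      have "B ** ?H x = exp (r * x) *\<^sub>R (mexp (x *\<^sub>R T) ** T) + (r * exp (r * x)) *\<^sub>R mexp (x *\<^sub>R T)"
        unfolding mexp_comm[symmetric] BC
        by (simp add: vec_eq_iff matrix_matrix_mult_def sum_distrib_left algebra_simps)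
      then show "((\<lambda>x. ?H x $ i $ j) has_real_derivative (B ** ?H x) $ i $ j) (at x)"
        by (auto intro!: derivative_eq_intros mexp_nth_has_derivative simp: algebra_simps)
    qed
    also have "- (mexp (- x *\<^sub>R B) ** B) ** ?H x + mexp (- x *\<^sub>R B) ** (B ** ?H x) = 0"
    proof -
      have "(- C) ** X = - (C ** X)" for C X :: "real^'s^'s"
        by (simp add: matrix_matrix_mult_def vec_eq_iff sum_negf)
      then show ?thesis by (simp only: matrix_mul_assoc) simp
    qed
    finally show "((\<lambda>x. (mexp (- x *\<^sub>R B) ** ?H x) $ i $ j) has_real_derivative 0) (at x)"
      by simp
  qed
  then have "mexp (- x *\<^sub>R B) ** ?H x = mat 1"
    by (simp add: vec_eq_iff)
  then have "mexp (x *\<^sub>R B) ** (mexp (- x *\<^sub>R B) ** ?H x) = mexp (x *\<^sub>R B)" by simp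
  then have "?H x = mexp (x *\<^sub>R B)" by (simp add: matrix_mul_assoc mexp_minus)
  then have "exp (r * x) * mexp (x *\<^sub>R T) $ i $ j = mexp (x *\<^sub>R B) $ i $ j"
    by (simp add: vec_eq_iff)
  then show ?thesis using pos[of i j] by (simp add: zero_le_mult_iff flip: \<open>exp (r * x) * _ = _\<close>)
qed

lemma has_vector_derivative_componentwise:
  fixes f :: "real \<Rightarrow> real^'n"
  assumes "\<And>b. ((\<lambda>x. f x \<bullet> b) has_real_derivative f' \<bullet> b) (at x within X)"
  shows "(f has_vector_derivative f') (at x within X)"
  using assms unfolding has_vector_derivative_def has_field_derivative_def
  by (subst has_derivative_componentwise_within) (simp add: mult_commute_abs)

lemma mexp_row_inner_measurable:
  fixes A :: "real^'n^'n"
  shows "(\<lambda>p. (fst p v* mexp ((r * snd p) *\<^sub>R A)) \<bullet> b) \<in> borel_measurable (borel \<Otimes>\<^sub>M borel)"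
proof -
  have "continuous_on UNIV (\<lambda>p :: (real^'n) \<times> real. (fst p, r * snd p))"
    by (intro continuous_intros)
  from continuous_on_compose2[OF continuous_on_mexp_row[of UNIV A] this]
  have "continuous_on UNIV (\<lambda>p. (fst p v* mexp ((r * snd p) *\<^sub>R A)) \<bullet> b)"
    by (intro continuous_on_inner) (simp_all add: continuous_on_const)
  then show ?thesis
    unfolding borel_prod by (rule borel_measurable_continuous_onI)
qed

section \<open>The law of a continuous-time Markov chain\<close>

lemma ctmc_finite_dimensional:
  fixes ts :: "nat \<Rightarrow> real"
  assumes X: "ctmc M X T" and X0: "AE \<omega> in M. X 0 \<omega> = i"
    and ts: "ts 0 = 0" "\<And>k. k < n \<Longrightarrow> ts k \<le> ts (Suc k)"
  shows "\<P>(\<omega> in M. \<forall>k\<le>n. X (ts k) \<omega> = js k) =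
    (if js 0 = i then 1 else 0) * (\<Prod>k<n. mexp ((ts (Suc k) - ts k) *\<^sub>R T) $ js k $ js (Suc k))"
  using ts(2)
proof (induction n)
  interpret ctmc M X T by fact
  case 0
  have [measurable]: "{\<omega>\<in>space M. X 0 \<omega> = i} \<in> sets M" for i
    using measurable_sets[OF X_measurable[OF order_refl], of "{i}"] by (simp add: vimage_def Int_def conj_commute)
  show ?case
  proof (cases "js 0 = i")
    case True
    then have "AE \<omega> in M. X (ts 0) \<omega> = js 0" using X0 ts by simp
    then show ?thesis using True by (simp add: prob_Collect_eq_1 ts)
  next
    case False
    then have "AE \<omega> in M. \<not> X (ts 0) \<omega> = js 0" using X0 ts by auto
    then show ?thesis using False by (simp add: prob_Collect_eq_0 ts)
  qed
next
  interpret ctmc M X T by fact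
  case (Suc n)
  have "\<P>(\<omega> in M. \<forall>k\<le>Suc n. X (ts k) \<omega> = js k) =
          \<P>(\<omega> in M. \<forall>k\<le>n. X (ts k) \<omega> = js k) * mexp ((ts (Suc n) - ts n) *\<^sub>R T) $ js n $ js (Suc n)"
    using Suc.prems ts by (intro transition) auto
  then show ?case using Suc by simp
qed

text \<open>With finitely many values per coordinate, a cylinder with a product base is a finite disjoint union of
  cylinders over points.\<close>

lemma prob_finite_product:
  fixes X :: "real \<Rightarrow> 'w \<Rightarrow> 's::finite"
  assumes "prob_space M" and X: "\<And>t. t \<in> J \<Longrightarrow> X t \<in> M \<rightarrow>\<^sub>M count_space UNIV" and J: "finite J"
  shows "\<P>(\<omega> in M. \<forall>t\<in>J. X t \<omega> \<in> A t) = (\<Sum>f\<in>Pi\<^sub>E J A. \<P>(\<omega> in M. \<forall>t\<in>J. X t \<omega> = f t))"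
proof -
  interpret prob_space M by fact
  have fin: "finite (Pi\<^sub>E J A)" using J by (intro finite_PiE) auto
  let ?S = "\<lambda>f. {\<omega>\<in>space M. \<forall>t\<in>J. X t \<omega> = f t}"
  have "?S f \<in> sets M" for f
  proof (intro sets.sets_Collect_finite_All J)
    fix t assume "t \<in> J"
    then show "{\<omega>\<in>space M. X t \<omega> = f t} \<in> sets M"
      using measurable_sets[OF X, of t "{f t}"] by (simp add: vimage_def Int_def conj_commute)
  qed
  moreover have "disjoint_family_on ?S (Pi\<^sub>E J A)"
    unfolding disjoint_family_on_def
  proof (intro ballI impI)
    fix f g assume fg: "f \<in> Pi\<^sub>E J A" "g \<in> Pi\<^sub>E J A" "f \<noteq> g"
    then obtain t where "t \<in> J" "f t \<noteq> g t" using PiE_ext[of f J A g] by blast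
    then show "?S f \<inter> ?S g = {}" by auto
  qed
  ultimately have "prob (\<Union>f\<in>Pi\<^sub>E J A. ?S f) = (\<Sum>f\<in>Pi\<^sub>E J A. prob (?S f))"
    using fin by (intro finite_measure_finite_Union) auto
  moreover have "(\<Union>f\<in>Pi\<^sub>E J A. ?S f) = {\<omega>\<in>space M. \<forall>t\<in>J. X t \<omega> \<in> A t}"
  proof (intro set_eqI iffI)
    fix \<omega> assume "\<omega> \<in> {\<omega>\<in>space M. \<forall>t\<in>J. X t \<omega> \<in> A t}"
    then show "\<omega> \<in> (\<Union>f\<in>Pi\<^sub>E J A. ?S f)"
      by (intro UN_I[of "\<lambda>t\<in>J. X t \<omega>"]) auto
  qed (auto simp: PiE_def Pi_def)
  ultimately show ?thesis by simp
qed

text \<open>The finite-dimensional distributions at times that include \<open>0\<close> are given by the initial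
  state and the transition probabilities, and cylinders form a generator of the product \<open>\<sigma>\<close>-algebra that is closed under intersections.\<close>

lemma ctmc_law_unique:
  fixes X :: "real \<Rightarrow> 'w \<Rightarrow> 's::finite" and Y :: "real \<Rightarrow> 'v \<Rightarrow> 's"
  assumes X: "ctmc M X T" "AE \<omega> in M. X 0 \<omega> = i" and Y: "ctmc N Y T" "AE \<omega> in N. Y 0 \<omega> = i"
  shows "process_law M X = process_law N Y"
proof -
  interpret X: ctmc M X T by fact
  interpret Y: ctmc N Y T by fact
  let ?P = "\<Pi>\<^sub>M t\<in>{0::real..}. count_space (UNIV :: 's set)"
  have meas: "(\<lambda>\<omega>. \<lambda>t\<in>{0..}. X t \<omega>) \<in> M \<rightarrow>\<^sub>M ?P" "(\<lambda>\<omega>. \<lambda>t\<in>{0..}. Y t \<omega>) \<in> N \<rightarrow>\<^sub>M ?P"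
    by (auto intro!: measurable_restrict X.X_measurable Y.X_measurable)
  have point: "\<P>(\<omega> in M. \<forall>t\<in>J. X t \<omega> = f t) = \<P>(\<omega> in N. \<forall>t\<in>J. Y t \<omega> = f t)"
    if J: "finite J" "J \<subseteq> {0..}" "0 \<in> J" for J f
  proof -
    define xs where "xs = sorted_list_of_set J"
    have xs: "set xs = J" "sorted xs" "distinct xs" using J by (auto simp: xs_def)
    then have "xs \<noteq> []" using J by auto
    then obtain n where n: "length xs = Suc n" by (cases xs) auto
    have J_eq: "J = (\<lambda>k. xs ! k) ` {..n}"
      using xs(1) n by (auto simp: set_conv_nth less_Suc_eq_le)
    obtain k0 where k0: "k0 \<le> n" "xs ! k0 = 0" using J(3) J_eq by auto
    have "xs ! 0 \<le> xs ! k0" using k0 n xs by (intro sorted_nth_mono) auto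
    moreover have "xs ! 0 \<in> J" using J_eq by auto
    ultimately have x0: "xs ! 0 = 0" using J k0 by force
    have mono: "xs ! k \<le> xs ! Suc k" if "k < n" for k using that n xs by (intro sorted_nth_mono) auto
    have "(\<forall>t\<in>J. Z t = f t) \<longleftrightarrow> (\<forall>k\<le>n. Z (xs ! k) = f (xs ! k))" for Z
      unfolding J_eq by auto
    then show ?thesis
      by (simp only: ctmc_finite_dimensional[OF X x0 mono] ctmc_finite_dimensional[OF Y x0 mono])
  qed
  have cyl: "\<P>(\<omega> in M. \<forall>t\<in>J. X t \<omega> \<in> A t) = \<P>(\<omega> in N. \<forall>t\<in>J. Y t \<omega> \<in> A t)"
    if J: "finite J" "J \<subseteq> {0..}" for J A
  proof -
    \<comment> \<open>The chain is known at time \<open>0\<close>, so this time is added to those of the cylinder.\<close>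
    let ?J = "insert 0 J" and ?A = "\<lambda>t. if t \<in> J then A t else UNIV"
    have *: "(\<forall>t\<in>J. Z t \<in> A t) \<longleftrightarrow> (\<forall>t\<in>?J. Z t \<in> ?A t)" for Z :: "real \<Rightarrow> 's" by auto
    have "\<P>(\<omega> in M. \<forall>t\<in>?J. X t \<omega> \<in> ?A t) = \<P>(\<omega> in N. \<forall>t\<in>?J. Y t \<omega> \<in> ?A t)"
    proof (subst (1 2) prob_finite_product)
      show "(\<Sum>f\<in>Pi\<^sub>E ?J ?A. \<P>(\<omega> in M. \<forall>t\<in>?J. X t \<omega> = f t)) = (\<Sum>f\<in>Pi\<^sub>E ?J ?A. \<P>(\<omega> in N. \<forall>t\<in>?J. Y t \<omega> = f t))"
        using J by (intro sum.cong refl point) auto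
    qed (use J X.X_measurable Y.X_measurable X.prob_space_axioms Y.prob_space_axioms in auto)
    then show ?thesis unfolding * .
  qed
  show ?thesis
    unfolding process_law_def
  proof (rule measure_eqI_PiM_infinite)
    fix A :: "real \<Rightarrow> 's set" and J assume J: "finite J" "J \<subseteq> {0::real..}" "\<And>i. i \<in> J \<Longrightarrow> A i \<in> sets (count_space UNIV)"
    let ?C = "prod_emb {0..} (\<lambda>_. count_space UNIV) J (Pi\<^sub>E J A)"
    have C: "?C \<in> sets ?P" using J by (intro sets_PiM_I) auto
    have pre: "(\<lambda>\<omega>. \<lambda>t\<in>{0..}. Z t \<omega>) -` ?C \<inter> S = {\<omega>\<in>S. \<forall>t\<in>J. Z t \<omega> \<in> A t}" for Z :: "real \<Rightarrow> 'x \<Rightarrow> 's" and S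
      using J(2) by (auto simp: prod_emb_def PiE_iff restrict_def extensional_def subset_iff)
    have "emeasure (distr M ?P (\<lambda>\<omega>. \<lambda>t\<in>{0..}. X t \<omega>)) ?C = ennreal (\<P>(\<omega> in M. \<forall>t\<in>J. X t \<omega> \<in> A t))"
      using meas C by (simp add: emeasure_distr pre X.emeasure_eq_measure)
    moreover have "emeasure (distr N ?P (\<lambda>\<omega>. \<lambda>t\<in>{0..}. Y t \<omega>)) ?C = ennreal (\<P>(\<omega> in N. \<forall>t\<in>J. Y t \<omega> \<in> A t))"
      using meas C by (simp add: emeasure_distr pre Y.emeasure_eq_measure)
    ultimately show "emeasure (distr M ?P (\<lambda>\<omega>. \<lambda>t\<in>{0..}. X t \<omega>)) ?C = emeasure (distr N ?P (\<lambda>\<omega>. \<lambda>t\<in>{0..}. Y t \<omega>)) ?C"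
      using cyl[OF J(1,2)] by simp
  next
    show "finite_measure (distr M ?P (\<lambda>\<omega>. \<lambda>t\<in>{0..}. X t \<omega>))"
      using meas by (intro X.finite_measure_distr)
  qed simp_all
qed

section \<open>Orbits as residual lifetimes\<close>

lemma normalise_inner_1: "a \<bullet> 1 \<noteq> 0 \<Longrightarrow> normalise a \<bullet> 1 = 1"
  by (simp add: normalise_def)

lemma outer_row: "(a v* outer u v) \<bullet> b = (a \<bullet> u) * (v \<bullet> b)"
proof -
  have "outer u v *v b = (v \<bullet> b) *\<^sub>R u"
    by (simp add: vec_eq_iff outer_def matrix_vector_mult_def inner_vec_def sum_distrib_left mult_ac)
  then show ?thesis by (simp add: dot_lmul_matrix)
qed

text \<open>The exit vector is \<open>- S 1\<close>, so \<open>a e\<^sup>S\<^sup>x s\<close> is the density that belongs to the tail function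
  \<open>a e\<^sup>S\<^sup>x 1\<close>.\<close>

lemma mexp_tail_has_derivative:
  "((\<lambda>x. (a v* mexp (x *\<^sub>R S)) \<bullet> 1) has_real_derivative - ((a v* mexp (x *\<^sub>R S)) \<bullet> exit_vec S)) (at x within X)"
  using mexp_bilinear_has_derivative[of a S 1 x]
  by (auto simp: exit_vec_def intro: has_field_derivative_at_within)

lemma continuous_on_mexp_bilinear [continuous_intros]:
  "continuous_on X f \<Longrightarrow> continuous_on X (\<lambda>x. (a v* mexp (f x *\<^sub>R A)) \<bullet> b)"
  by (rule continuous_on_compose2[of UNIV "\<lambda>x. (a v* mexp (x *\<^sub>R A)) \<bullet> b"])
    (auto intro!: DERIV_continuous_on mexp_bilinear_has_derivative)

lemma continuous_on_mexp_row' [continuous_intros]: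
  fixes A :: "real^'n^'n"
  shows "continuous_on X f \<Longrightarrow> continuous_on X (\<lambda>x. a v* mexp (f x *\<^sub>R A))"
  using continuous_on_compose2[OF continuous_on_mexp_row[of UNIV A], of X "\<lambda>x. (a, f x)"]
  by (simp add: continuous_on_Pair)

context me_variable
begin

lemma residual_tail_row: "(mexp (x *\<^sub>R S) *v b) $ n = (axis n 1 v* mexp (x *\<^sub>R S)) \<bullet> b"
  by (simp add: dot_lmul_matrix inner_axis')

text \<open>The density is minus the derivative of a residual survival function, and such a function is nonincreasing.\<close>

lemma residual_density_nonneg:
  assumes "0 \<le> x"
  shows "0 \<le> (mexp (x *\<^sub>R S) *v exit_vec S) $ n"
proof (rule ccontr)
  let ?f = "\<lambda>x. (axis n 1 v* mexp (x *\<^sub>R S)) \<bullet> 1"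
  assume "\<not> ?thesis"
  then obtain h where h: "0 < h" "\<And>k. 0 < k \<Longrightarrow> k < h \<Longrightarrow> ?f x < ?f (x + k)"
    using DERIV_pos_inc_right[OF mexp_tail_has_derivative[of "axis n 1" S x UNIV]]
    by (auto simp: residual_tail_row)
  have "?f x < ?f (x + h / 2)" using h by simp
  moreover have "?f (x + h / 2) \<le> ?f x"
    using residual_life[of x n] residual_life[of "x + h / 2" n] assms h
    by (auto simp flip: residual_tail_row simp: cond_prob_def intro!: divide_right_mono
        finite_measure_mono_AE)
      (auto intro!: finite_measure_mono Z_measurable measurable)
  ultimately show False by simp
qed

lemma t_nonneg: "0 \<le> t n"
  using t_mono t_first by (metis Min_le UNIV_I finite strict_mono_less_eq)

text \<open>Markov's inequality bounds each residual survival function by a multiple of \<open>1 / x\<close>, and every tail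
  function \<open>a e\<^sup>S\<^sup>x 1\<close> is a linear combination of them.\<close>

lemma residual_tail_tendsto_0:
  "((\<lambda>x. (a v* mexp (x *\<^sub>R S)) \<bullet> 1) \<longlongrightarrow> 0) at_top"
proof -
  have "((\<lambda>x. (mexp (x *\<^sub>R S) *v 1) $ n) \<longlongrightarrow> 0) at_top" for n
  proof (rule tendsto_sandwich)
    let ?p = "\<P>(\<omega> in N. t n < Z \<omega>)"
    show "\<forall>\<^sub>F x in at_top. 0 \<le> (mexp (x *\<^sub>R S) *v 1) $ n"
      using eventually_ge_at_top[of 0] by eventually_elim (simp add: residual_life cond_prob_def)
    show "\<forall>\<^sub>F x in at_top. (mexp (x *\<^sub>R S) *v 1) $ n \<le> (\<Delta> / x) / ?p"
      using eventually_gt_at_top[of 0]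
    proof eventually_elim
      case (elim x)
      have "\<P>(\<omega> in N. x \<le> Z \<omega> - t n \<and> t n < Z \<omega>) \<le> \<P>(\<omega> in N. Z \<omega> \<ge> x)"
        using t_nonneg[of n] Z_measurable by (intro finite_measure_mono) auto
      also have "\<dots> \<le> \<Delta> / x"
        using integral_Markov_inequality_measure[OF Z_integrable(1), of "{}" x] Z_nonneg elim
        by (simp add: Z_mean)
      finally have "\<P>(\<omega> in N. x \<le> Z \<omega> - t n \<and> t n < Z \<omega>) / ?p \<le> (\<Delta> / x) / ?p"
        by (rule divide_right_mono) simp
      then show ?case
        using elim by (simp add: residual_life cond_prob_def)
    qed
    show "((\<lambda>x. \<Delta> / x / ?p) \<longlongrightarrow> 0) at_top"
      by (intro tendsto_divide_zero tendsto_divide_0[OF tendsto_const] filterlim_at_top_imp_at_infinity filterlim_ident)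
  qed simp
  then have "((\<lambda>x. \<Sum>n\<in>UNIV. a $ n * (mexp (x *\<^sub>R S) *v 1) $ n) \<longlongrightarrow> (\<Sum>n\<in>UNIV. a $ n * 0)) at_top"
    by (intro tendsto_intros)
  then show ?thesis
    unfolding dot_lmul_matrix by (simp add: inner_vec_def)
qed

text \<open>A tail function is the integral of its negative derivative because it vanishes at infinity. For unit
  rows the integrand is nonnegative, which gives integrability; the general case follows by linearity.\<close>

lemma exit_density_integral:
  assumes x: "0 \<le> x"
  shows "has_bochner_integral lborel
    (\<lambda>y. indicator {x..} y *\<^sub>R ((a v* mexp (y *\<^sub>R S)) \<bullet> exit_vec S)) ((a v* mexp (x *\<^sub>R S)) \<bullet> 1)"
proof -
  let ?f = "\<lambda>n y. (mexp (y *\<^sub>R S) *v exit_vec S) $ n"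
  have comp: "has_bochner_integral lborel (\<lambda>y. indicator {x..} y *\<^sub>R ?f n y) ((mexp (x *\<^sub>R S) *v 1) $ n)" for n
  proof (rule has_bochner_integral_nn_integral)
    have [measurable]: "?f n \<in> borel_measurable borel"
      unfolding residual_tail_row by (intro borel_measurable_continuous_onI continuous_intros)
    show "(\<lambda>y. indicator {x..} y *\<^sub>R ?f n y) \<in> borel_measurable lborel" by measurable
    show "AE y in lborel. 0 \<le> indicator {x..} y *\<^sub>R ?f n y"
      using x by (auto simp: residual_density_nonneg split: split_indicator)
    have "0 \<le> ?f n y" if "x \<le> y" for y
      using x that by (intro residual_density_nonneg) simp
    moreover have "((\<lambda>y. - ((axis n 1 v* mexp (y *\<^sub>R S)) \<bullet> 1)) has_real_derivative ?f n y) (at y)" for y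
      using DERIV_minus[OF mexp_tail_has_derivative[of "axis n 1" S y UNIV]]
      by (simp only: residual_tail_row minus_minus)
    ultimately have "(\<integral>\<^sup>+ y. ennreal (?f n y) * indicator {x..} y \<partial>lborel) = ennreal (- 0 - - ((axis n 1 v* mexp (x *\<^sub>R S)) \<bullet> 1))"
      by (intro nn_integral_FTC_atLeast tendsto_minus residual_tail_tendsto_0) auto
    then show "(\<integral>\<^sup>+ y. ennreal (indicator {x..} y *\<^sub>R ?f n y) \<partial>lborel) = ennreal ((mexp (x *\<^sub>R S) *v 1) $ n)"
      unfolding residual_tail_row by (simp add: mult.commute ennreal_mult' ennreal_indicator)
    show "0 \<le> (mexp (x *\<^sub>R S) *v 1) $ n"
      using x by (simp add: residual_life cond_prob_def)
  qed
  have "has_bochner_integral lborel (\<lambda>y. \<Sum>n\<in>UNIV. a $ n *\<^sub>R (indicator {x..} y *\<^sub>R ?f n y))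
      (\<Sum>n\<in>UNIV. a $ n *\<^sub>R ((mexp (x *\<^sub>R S) *v 1) $ n))"
    by (intro has_bochner_integral_sum has_bochner_integral_scaleR_right comp)
  also have "(\<lambda>y. \<Sum>n\<in>UNIV. a $ n *\<^sub>R (indicator {x..} y *\<^sub>R ?f n y))
      = (\<lambda>y. indicator {x..} y *\<^sub>R ((a v* mexp (y *\<^sub>R S)) \<bullet> exit_vec S))"
    unfolding dot_lmul_matrix by (simp add: inner_vec_def sum_distrib_left mult_ac)
  also have "(\<Sum>n\<in>UNIV. a $ n *\<^sub>R ((mexp (x *\<^sub>R S) *v 1) $ n)) = (a v* mexp (x *\<^sub>R S)) \<bullet> 1"
    unfolding dot_lmul_matrix by (simp add: inner_vec_def)
  finally show ?thesis .
qed

text \<open>Nonnegativity is required of the density that a row represents, not of the entries of the row. The set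
  of these rows is closed under all operations from which the valid orbits are built.\<close>

definition is_residual_orbit :: "real^('p::{finite,linorder}) \<Rightarrow> bool" where
  "is_residual_orbit a \<longleftrightarrow> a \<noteq> 0 \<and> (\<forall>y\<ge>0. 0 \<le> (a v* mexp (y *\<^sub>R S)) \<bullet> exit_vec S)"

lemma residual_orbit_inner_1_nonneg:
  assumes "\<And>y. 0 \<le> y \<Longrightarrow> 0 \<le> (a v* mexp (y *\<^sub>R S)) \<bullet> exit_vec S" "0 \<le> y"
  shows "0 \<le> (a v* mexp (y *\<^sub>R S)) \<bullet> 1"
proof -
  have "0 \<le> (\<integral>x. indicator {y..} x *\<^sub>R ((a v* mexp (x *\<^sub>R S)) \<bullet> exit_vec S) \<partial>lborel)"
    using assms by (intro Bochner_Integration.integral_nonneg) (auto split: split_indicator)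
  then show ?thesis
    by (simp only: has_bochner_integral_integral_eq[OF exit_density_integral[OF assms(2)]])
qed

lemma residual_orbit_antimono:
  assumes "is_residual_orbit a" "0 \<le> x" "x \<le> y"
  shows "(a v* mexp (y *\<^sub>R S)) \<bullet> 1 \<le> (a v* mexp (x *\<^sub>R S)) \<bullet> 1"
proof (rule DERIV_nonpos_imp_nonincreasing[OF \<open>x \<le> y\<close>])
  fix z assume "x \<le> z" "z \<le> y"
  then show "\<exists>y. ((\<lambda>z. (a v* mexp (z *\<^sub>R S)) \<bullet> 1) has_real_derivative y) (at z) \<and> y \<le> 0"
    using assms by (intro exI[of _ "- ((a v* mexp (z *\<^sub>R S)) \<bullet> exit_vec S)"])
      (auto simp: is_residual_orbit_def intro: mexp_tail_has_derivative)
qed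

text \<open>If \<open>a 1\<close> were not positive, the tail function of \<open>a\<close>, nonnegative and nonincreasing, would vanish identically. The linear
  independence of the residual survival functions would then force \<open>a = 0\<close>.\<close>

lemma residual_orbit_inner_1_pos:
  assumes a: "is_residual_orbit a"
  shows "0 < a \<bullet> 1"
proof (rule ccontr)
  assume "\<not> 0 < a \<bullet> 1"
  then have "(a v* mexp (y *\<^sub>R S)) \<bullet> 1 = 0" if "0 \<le> y" for y
    using residual_orbit_inner_1_nonneg[of a y] residual_orbit_antimono[OF a order_refl that] a that
    by (auto simp: is_residual_orbit_def)
  then have "a \<bullet> (mexp (y *\<^sub>R S) *v 1) = 0" if "0 \<le> y" for y
    using that by (simp add: dot_lmul_matrix)
  then have "a = 0"
    by (intro residual_life_independent) (simp add: inner_vec_def)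
  then show False using a by (simp add: is_residual_orbit_def)
qed

lemma residual_orbit_mexp:
  assumes "is_residual_orbit a" "0 \<le> u"
  shows "is_residual_orbit (a v* mexp (u *\<^sub>R S))"
  using assms by (auto simp: is_residual_orbit_def mexp_row_eq_0_iff mexp_bilinear_add)

lemma residual_orbit_scaleR:
  assumes "is_residual_orbit a" "0 < r"
  shows "is_residual_orbit (r *\<^sub>R a)"
  using assms by (simp add: is_residual_orbit_def dot_lmul_matrix)

lemma residual_orbit_normalise: "is_residual_orbit a \<Longrightarrow> is_residual_orbit (normalise a)"
  unfolding normalise_def by (intro residual_orbit_scaleR) (auto dest: residual_orbit_inner_1_pos)

lemma residual_orbit_initial: "is_residual_orbit \<alpha>"
  using residual_density_nonneg
  by (simp add: is_residual_orbit_def initial_vector axis_eq_0_iff flip: residual_tail_row)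

context
  fixes d :: real
  assumes d: "0 \<le> d"
begin

text \<open>Between a row and a column, \<open>D\<close> becomes a scalar integral. In its second part the direction is
  constant and the exit density integrates to the tail at \<open>d\<close>.\<close>

lemma D_bilinear:
  "(a v* qbd_rap_data.D \<alpha> S d) \<bullet> b =
     (LBINT y:{0..d}. ((a v* mexp (y *\<^sub>R S)) \<bullet> exit_vec S) * (normalise (\<alpha> v* mexp (y *\<^sub>R S)) \<bullet> b))
     + ((a v* mexp (d *\<^sub>R S)) \<bullet> 1) * (normalise (\<alpha> v* mexp (d *\<^sub>R S)) \<bullet> b)" (is "?L = ?R1 + ?R2")
proof -
  let ?phi = "\<lambda>B :: real^('p::{finite,linorder})^('p::{finite,linorder}). (a v* B) \<bullet> b"
  let ?F = "\<lambda>v y. outer (mexp (y *\<^sub>R S) *v exit_vec S) v"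
  let ?G = "\<lambda>y. normalise (\<alpha> v* mexp (y *\<^sub>R S))"
  have phi: "bounded_linear ?phi"
    by (auto intro!: linear_conv_bounded_linear[THEN iffD1] linearI
        simp: inner_left_distrib vector_matrix_mult_add_rdistrib vector_scaleR_matrix_ac)
  have push: "?phi (LBINT y:X. F y) = (LBINT y:X. ?phi (F y))" if "set_integrable lborel X F" for X F
    using integral_bounded_linear[OF phi that[unfolded set_integrable_def]]
    by (simp add: set_lebesgue_integral_def linear_scale[OF bounded_linear.linear[OF phi]])
  have row: "?phi (?F v y) = ((a v* mexp (y *\<^sub>R S)) \<bullet> exit_vec S) * (v \<bullet> b)" for v y
    unfolding outer_row by (simp add: dot_lmul_matrix)
  have "continuous_on {0..d} (\<lambda>y. ?F (?G y) y)"
  proof -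
    have nz: "(\<alpha> v* mexp (y *\<^sub>R S)) \<bullet> 1 \<noteq> 0" if "y \<in> {0..d}" for y
      using residual_orbit_inner_1_pos[OF residual_orbit_mexp[OF residual_orbit_initial, of y]] that by simp
    show ?thesis
      unfolding outer_def normalise_def residual_tail_row
      by (intro continuous_on_vec_lambda continuous_intros continuous_on_component) (use nz in auto)
  qed
  then have int1: "set_integrable lborel {0..d} (\<lambda>y. ?F (?G y) y)"
    by (rule borel_integrable_atLeastAtMost')
  \<comment> \<open>On the unbounded interval integrability comes from the exit densities of the unit rows.\<close>
  have int2: "set_integrable lborel {d..} (\<lambda>y. ?F v y)" for v
  proof -
    have "outer u v = (\<Sum>n\<in>UNIV. u $ n *\<^sub>R outer (axis n 1) v)" for u v :: "real^('p::{finite,linorder})"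
    proof -
      have "u $ n * (axis n 1 $ i * v $ j) = (if i = n then u $ n * v $ j else 0)" for n i j
        by (simp add: axis_def)
      then show ?thesis by (simp add: vec_eq_iff outer_def)
    qed
    note sum_axis = this
    have "(\<lambda>y. indicator {d..} y *\<^sub>R ?F v y) = (\<lambda>y. \<Sum>n\<in>UNIV.
        (indicator {d..} y *\<^sub>R ((axis n 1 v* mexp (y *\<^sub>R S)) \<bullet> exit_vec S)) *\<^sub>R outer (axis n 1) v)"
      by (intro ext, subst sum_axis)
        (simp only: scaleR_sum_right residual_tail_row[symmetric] scaleR_scaleR real_scaleR_def)
    then show ?thesis
      unfolding set_integrable_def
      by (simp only:) (intro Bochner_Integration.integrable_sum integrable_scaleR_left
          integrable.intros[OF exit_density_integral[OF d]])
  qed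
  have "?L = ?phi (LBINT y:{0..d}. ?F (?G y) y) + ?phi (LBINT y:{d..}. ?F (?G d) y)"
    by (simp add: qbd_rap_data.D_def inner_left_distrib vector_matrix_mult_add_rdistrib)
  also have "\<dots> = ?R1 + (LBINT y:{d..}. ((a v* mexp (y *\<^sub>R S)) \<bullet> exit_vec S) * (?G d \<bullet> b))"
    by (simp only: push[OF int1] push[OF int2] row)
  also have "(LBINT y:{d..}. ((a v* mexp (y *\<^sub>R S)) \<bullet> exit_vec S) * (?G d \<bullet> b)) = ?R2"
    using has_bochner_integral_integral_eq[OF exit_density_integral[OF d, of a]]
    by (simp add: set_lebesgue_integral_def)
  finally show ?thesis .
qed

text \<open>The normalised directions in \<open>D\<close> have row sum \<open>1\<close>, so \<open>a D 1\<close> is the mass of the exit density of \<open>a\<close> on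
  \<open>[0, d]\<close> plus its tail at \<open>d\<close>. This is the reason why the changes of phase ignore the orbit.\<close>

lemma D_row_sum: "(a v* qbd_rap_data.D \<alpha> S d) \<bullet> 1 = a \<bullet> 1"
proof -
  have "(LBINT y:{0..d}. ((a v* mexp (y *\<^sub>R S)) \<bullet> exit_vec S) * (normalise (\<alpha> v* mexp (y *\<^sub>R S)) \<bullet> 1))
      = (LBINT y:{0..d}. (a v* mexp (y *\<^sub>R S)) \<bullet> exit_vec S)"
  proof (intro set_lebesgue_integral_cong allI impI)
    fix y assume "y \<in> {0..d}"
    then have "0 < (\<alpha> v* mexp (y *\<^sub>R S)) \<bullet> 1"
      by (intro residual_orbit_inner_1_pos residual_orbit_mexp residual_orbit_initial) simp
    then show "((a v* mexp (y *\<^sub>R S)) \<bullet> exit_vec S) * (normalise (\<alpha> v* mexp (y *\<^sub>R S)) \<bullet> 1)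
        = (a v* mexp (y *\<^sub>R S)) \<bullet> exit_vec S"
      by (simp add: normalise_inner_1)
  qed simp
  also have "\<dots> = - ((a v* mexp (d *\<^sub>R S)) \<bullet> 1) - - ((a v* mexp (0 *\<^sub>R S)) \<bullet> 1)"
    unfolding set_lebesgue_integral_def
    by (intro integral_FTC_atLeastAtMost d continuous_intros)
      (auto intro!: derivative_eq_intros mexp_tail_has_derivative
        simp flip: has_real_derivative_iff_has_vector_derivative)
  finally have first: "(LBINT y:{0..d}. ((a v* mexp (y *\<^sub>R S)) \<bullet> exit_vec S) * (normalise (\<alpha> v* mexp (y *\<^sub>R S)) \<bullet> 1))
      = a \<bullet> 1 - (a v* mexp (d *\<^sub>R S)) \<bullet> 1" by simp
  have "0 < (\<alpha> v* mexp (d *\<^sub>R S)) \<bullet> 1"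
    by (intro residual_orbit_inner_1_pos residual_orbit_mexp residual_orbit_initial d)
  then show ?thesis
    unfolding D_bilinear first by (simp add: normalise_inner_1)
qed

text \<open>The row \<open>a D\<close> is a mixture, with nonnegative weights, of the residual orbits
  \<open>\<alpha> e\<^sup>S\<^sup>y / (\<alpha> e\<^sup>S\<^sup>y 1)\<close>.\<close>

lemma residual_orbit_D:
  assumes a: "is_residual_orbit a"
  shows "is_residual_orbit (a v* qbd_rap_data.D \<alpha> S d)"
  unfolding is_residual_orbit_def
proof (intro conjI allI impI)
  show "a v* qbd_rap_data.D \<alpha> S d \<noteq> 0"
    using D_row_sum[of a] residual_orbit_inner_1_pos[OF a] by (metis inner_zero_left less_irrefl)
  fix u :: real assume u: "0 \<le> u"
  have pos: "0 \<le> normalise (\<alpha> v* mexp (y *\<^sub>R S)) \<bullet> (mexp (u *\<^sub>R S) *v exit_vec S)" if "0 \<le> y" for y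
    using residual_orbit_normalise[OF residual_orbit_mexp[OF residual_orbit_initial that]] u
    by (auto simp: is_residual_orbit_def dot_lmul_matrix)
  have "0 \<le> (a v* qbd_rap_data.D \<alpha> S d) \<bullet> (mexp (u *\<^sub>R S) *v exit_vec S)"
    unfolding D_bilinear set_lebesgue_integral_def using a d
    by (intro add_nonneg_nonneg Bochner_Integration.integral_nonneg)
      (auto simp: is_residual_orbit_def pos residual_orbit_inner_1_nonneg split: split_indicator)
  then show "0 \<le> ((a v* qbd_rap_data.D \<alpha> S d) v* mexp (u *\<^sub>R S)) \<bullet> exit_vec S"
    by (simp only: dot_lmul_matrix)
qed

text \<open>The residual orbits of row sum \<open>1\<close> form a convex set, and it contains the rows of which the valid orbits
  are the hull: \<open>\<alpha>\<close> is a residual orbit, and \<open>e\<^sup>S\<^sup>u\<close>, \<open>D\<close> and the normalisation preserve this property.\<close>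

lemma valid_orbit_residual:
  assumes "a \<in> qbd_rap_data.valid_orbits c \<alpha> S d"
  shows "is_residual_orbit a \<and> a \<bullet> 1 = 1"
proof -
  let ?K = "{a. is_residual_orbit a \<and> a \<bullet> 1 = 1}"
  have "convex ?K"
  proof (rule convexI)
    fix x y :: "real^('p::{finite,linorder})" and u v :: real
    assume xy: "x \<in> ?K" "y \<in> ?K" and uv: "0 \<le> u" "0 \<le> v" "u + v = 1"
    have s: "(u *\<^sub>R x + v *\<^sub>R y) \<bullet> 1 = 1" using xy uv by (simp add: inner_left_distrib)
    moreover have "u *\<^sub>R x + v *\<^sub>R y \<noteq> 0" using s by auto
    ultimately show "u *\<^sub>R x + v *\<^sub>R y \<in> ?K"
      using xy uv by (auto simp: is_residual_orbit_def inner_left_distrib dot_lmul_matrix)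
  qed
  moreover have "normalise (\<alpha> v* (mat_prod (\<lambda>n. mexp (u n *\<^sub>R S) ** qbd_rap_data.D_phase c \<alpha> S d (i n) (i (Suc n))) m
                        ** mexp (u (Suc m) *\<^sub>R S))) \<in> ?K" if u: "\<forall>n. 0 \<le> u n" for m u i
  proof -
    have "is_residual_orbit (\<alpha> v* mat_prod (\<lambda>n. mexp (u n *\<^sub>R S) ** qbd_rap_data.D_phase c \<alpha> S d (i n) (i (Suc n))) m)"
    proof (induction m)
      case (Suc m)
      then show ?case using u
        by (auto simp: qbd_rap_data.D_phase_def residual_orbit_mexp residual_orbit_D
            simp flip: vector_matrix_mul_assoc)
    qed (simp add: residual_orbit_initial)
    then have *: "is_residual_orbit (\<alpha> v* (mat_prod (\<lambda>n. mexp (u n *\<^sub>R S) ** qbd_rap_data.D_phase c \<alpha> S d (i n) (i (Suc n))) m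
                        ** mexp (u (Suc m) *\<^sub>R S)))"
      using u by (auto simp: residual_orbit_mexp simp flip: vector_matrix_mul_assoc)
    then show ?thesis
      using residual_orbit_inner_1_pos[OF *] by (auto intro: residual_orbit_normalise normalise_inner_1)
  qed
  ultimately have "qbd_rap_data.valid_orbits c \<alpha> S d \<subseteq> ?K"
    unfolding qbd_rap_data.valid_orbits_def by (intro hull_minimal) auto
  then show ?thesis using assms by auto
qed

end

end

section \<open>The orbit equation and the density of the next event\<close>

context qbd_rap_data
begin

text \<open>Time is scaled because in phase \<open>i\<close> the orbit runs through the residual lifetimes at speed \<open>\<bar>c\<^sub>i\<bar>\<close>.\<close>

definition orbit_tail :: "'s \<Rightarrow> real^'p \<Rightarrow> real \<Rightarrow> real" where
  "orbit_tail i a s = (a v* mexp ((\<bar>c i\<bar> * s) *\<^sub>R S)) \<bullet> 1"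

lemma orbit_tail_has_derivative:
  "(orbit_tail i a has_real_derivative - (\<bar>c i\<bar> * ((a v* mexp ((\<bar>c i\<bar> * s) *\<^sub>R S)) \<bullet> exit_vec S))) (at s within X)"
  unfolding orbit_tail_def using mexp_bilinear_has_derivative_scaled[of a "\<bar>c i\<bar>" S 1 s X]
  by (simp add: exit_vec_def)

lemma orbit_tail_0 [simp]: "orbit_tail i a 0 = a \<bullet> 1"
  by (simp add: orbit_tail_def)

text \<open>The quotient rule turns the linear equation for \<open>a e\<^sup>S\<^sup>r\<close>, \<open>r = \<bar>c\<^sub>i\<bar> s\<close>, into the orbit equation for its
  normalisation.\<close>

lemma normalised_orbit_solves:
  assumes pos: "0 < orbit_tail i a s"
  shows "((\<lambda>s. normalise (a v* mexp ((\<bar>c i\<bar> * s) *\<^sub>R S)))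
    has_vector_derivative orbit_field i (normalise (a v* mexp ((\<bar>c i\<bar> * s) *\<^sub>R S)))) (at s within X)"
proof (rule has_vector_derivative_componentwise)
  fix b
  let ?m = "\<lambda>s. a v* mexp ((\<bar>c i\<bar> * s) *\<^sub>R S)"
  have "((\<lambda>s. (?m s \<bullet> b) / (?m s \<bullet> 1)) has_real_derivative
      ((\<bar>c i\<bar> * (?m s \<bullet> (S *v b))) * (?m s \<bullet> 1) - (?m s \<bullet> b) * (\<bar>c i\<bar> * (?m s \<bullet> (S *v 1))))
        / ((?m s \<bullet> 1) * (?m s \<bullet> 1))) (at s within X)"
    using pos by (intro DERIV_divide mexp_bilinear_has_derivative_scaled) (simp add: orbit_tail_def)
  also have "((\<bar>c i\<bar> * (?m s \<bullet> (S *v b))) * (?m s \<bullet> 1) - (?m s \<bullet> b) * (\<bar>c i\<bar> * (?m s \<bullet> (S *v 1))))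
        / ((?m s \<bullet> 1) * (?m s \<bullet> 1)) = orbit_field i (normalise (?m s)) \<bullet> b"
  proof -
    have "x \<noteq> 0 \<Longrightarrow> ((r * y) * x - v * (r * u)) / (x * x) = r * (y / x - u / x * (v / x))" for x y v r u :: real
      by (simp add: field_simps)
    moreover have "?m s \<bullet> 1 \<noteq> 0" using pos by (simp add: orbit_tail_def)
    moreover have "orbit_field i (normalise x) \<bullet> b
        = \<bar>c i\<bar> * (x \<bullet> (S *v b) / (x \<bullet> 1) - x \<bullet> (S *v 1) / (x \<bullet> 1) * (x \<bullet> b / (x \<bullet> 1)))" for x
      unfolding orbit_field_def normalise_def inner_scaleR_left inner_diff_left dot_lmul_matrix
      by simp
    ultimately show ?thesis by metis
  qed
  finally show "((\<lambda>s. normalise (?m s) \<bullet> b) has_real_derivative orbit_field i (normalise (?m s)) \<bullet> b) (at s within X)"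
    by (simp add: normalise_def)
qed

text \<open>An integrating factor makes the orbit equation linear. For a solution \<open>g\<close> let \<open>\<Gamma>\<close> be the integral of
  \<open>\<gamma> = \<bar>c\<^sub>i\<bar> g S 1\<close>. Then \<open>w = e\<^sup>\<Gamma> g\<close> satisfies \<open>w' = \<bar>c\<^sub>i\<bar> w S\<close>, whose solutions are exponentials, and both
  \<open>w 1\<close> and \<open>e\<^sup>\<Gamma>\<close> have the derivative \<open>e\<^sup>\<Gamma> \<gamma>\<close> and the initial value \<open>1\<close>. So \<open>g\<close> is \<open>w\<close> divided by its row sum.\<close>

lemma orbit_ODE_unique:
  assumes g0: "g 0 = a" and a1: "a \<bullet> 1 = 1"
    and g: "\<And>s. 0 \<le> s \<Longrightarrow> (g has_vector_derivative orbit_field i (g s)) (at s within {0..})"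
    and t: "0 \<le> t"
  shows "g t = normalise (a v* mexp ((\<bar>c i\<bar> * t) *\<^sub>R S))"
proof -
  let ?r = "\<bar>c i\<bar>"
  define \<gamma> where "\<gamma> s = ?r * (g s \<bullet> (S *v 1))" for s
  define \<Gamma> where "\<Gamma> s = integral {0..s} \<gamma>" for s
  define w where "w s = exp (\<Gamma> s) *\<^sub>R g s" for s
  \<comment> \<open>The adjoint equation: \<open>w \<beta> b\<close> is constant, and at the time \<open>t\<close> it is \<open>w t \<bullet> b\<close>.\<close>
  define \<beta> where "\<beta> b s = mexp ((?r * (t - s)) *\<^sub>R S) *v b" for b s
  have g': "(g has_vector_derivative orbit_field i (g s)) (at s within {0..t})" if "s \<in> {0..t}" for s
    using that by (intro has_vector_derivative_within_subset[OF g]) auto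
  have "continuous_on {0..t} g"
    by (rule continuous_on_vector_derivative) (rule g')
  then have "continuous_on {0..t} \<gamma>"
    unfolding \<gamma>_def by (intro continuous_intros)
  then have \<Gamma>: "(\<Gamma> has_real_derivative \<gamma> s) (at s within {0..t})" if "s \<in> {0..t}" for s
    unfolding \<Gamma>_def using that by (intro integral_has_real_derivative)
  have w: "((\<lambda>s. w s \<bullet> b) has_real_derivative ?r * (w s \<bullet> (S *v b))) (at s within {0..t})"
    if s: "s \<in> {0..t}" for s b
  proof -
    have "((\<lambda>s. g s \<bullet> b) has_real_derivative orbit_field i (g s) \<bullet> b) (at s within {0..t})"
      using bounded_linear.has_vector_derivative[OF bounded_linear_inner_left g'[OF s], of b]
      by (simp add: has_real_derivative_iff_has_vector_derivative)
    then have "((\<lambda>s. exp (\<Gamma> s) * (g s \<bullet> b)) has_real_derivative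
        exp (\<Gamma> s) * \<gamma> s * (g s \<bullet> b) + orbit_field i (g s) \<bullet> b * exp (\<Gamma> s)) (at s within {0..t})"
      using \<Gamma>[OF s] by (auto intro!: derivative_eq_intros)
    also have "exp (\<Gamma> s) * \<gamma> s * (g s \<bullet> b) + orbit_field i (g s) \<bullet> b * exp (\<Gamma> s) = ?r * (w s \<bullet> (S *v b))"
      unfolding w_def \<gamma>_def orbit_field_def inner_scaleR_left inner_diff_left dot_lmul_matrix
      by (simp add: algebra_simps)
    finally show ?thesis by (simp add: w_def)
  qed
  have w': "(w has_vector_derivative ?r *\<^sub>R (w s v* S)) (at s within {0..t})" if s: "s \<in> {0..t}" for s
    by (rule has_vector_derivative_componentwise) (use w[OF s] in \<open>simp add: dot_lmul_matrix\<close>)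
  have \<beta>: "(\<beta> b has_vector_derivative - (?r *\<^sub>R (S *v \<beta> b s))) (at s within {0..t})" for b s
  proof (rule has_vector_derivative_componentwise)
    fix e
    have "((\<lambda>s. (e v* mexp ((?r * (t - s)) *\<^sub>R S)) \<bullet> b) has_real_derivative
        (e v* mexp ((?r * (t - s)) *\<^sub>R S)) \<bullet> (S *v b) * - ?r) (at s within {0..t})"
      by (rule DERIV_chain2[OF mexp_bilinear_has_derivative]) (auto intro!: derivative_eq_intros)
    moreover have "(e v* mexp (x *\<^sub>R S)) \<bullet> (S *v b) = (S *v (mexp (x *\<^sub>R S) *v b)) \<bullet> e" for x
      by (simp only: dot_lmul_matrix inner_commute[of e] matrix_vector_mul_assoc mexp_comm)
    moreover have "(e v* mexp (x *\<^sub>R S)) \<bullet> b = (mexp (x *\<^sub>R S) *v b) \<bullet> e" for x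
      by (simp only: dot_lmul_matrix inner_commute[of e])
    ultimately show "((\<lambda>s. \<beta> b s \<bullet> e) has_real_derivative - (?r *\<^sub>R (S *v \<beta> b s)) \<bullet> e) (at s within {0..t})"
      unfolding \<beta>_def by (simp add: mult.commute)
  qed
  have wt: "w t \<bullet> b = (a v* mexp ((?r * t) *\<^sub>R S)) \<bullet> b" for b
  proof -
    have "w t \<bullet> \<beta> b t = w 0 \<bullet> \<beta> b 0"
    proof -
      have "((\<lambda>s. w s \<bullet> \<beta> b s) has_real_derivative 0) (at s within {0..t})" if s: "s \<in> {0..t}" for s
      proof -
        have "w s \<bullet> - (?r *\<^sub>R (S *v \<beta> b s)) + (?r *\<^sub>R (w s v* S)) \<bullet> \<beta> b s = 0"
          by (simp add: dot_lmul_matrix)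
        then show ?thesis
          using bounded_bilinear.has_vector_derivative[OF bounded_bilinear_inner w'[OF s] \<beta>[of b s]]
          unfolding has_real_derivative_iff_has_vector_derivative by (simp only:)
      qed
      then show ?thesis
        using has_field_derivative_zero_constant[of "{0..t}" "\<lambda>s. w s \<bullet> \<beta> b s"] t by auto
    qed
    then show ?thesis by (simp add: \<beta>_def w_def \<Gamma>_def g0 dot_lmul_matrix)
  qed
  have "w t \<bullet> 1 - exp (\<Gamma> t) = w 0 \<bullet> 1 - exp (\<Gamma> 0)"
  proof -
    have "((\<lambda>s. w s \<bullet> 1 - exp (\<Gamma> s)) has_real_derivative 0) (at s within {0..t})" if s: "s \<in> {0..t}" for s
    proof -
      have "?r * (w s \<bullet> (S *v 1)) - exp (\<Gamma> s) * \<gamma> s = 0"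
        unfolding w_def \<gamma>_def by simp
      then show ?thesis
        using w[OF s, of 1] \<Gamma>[OF s] by (auto intro!: derivative_eq_intros)
    qed
    then show ?thesis
      using has_field_derivative_zero_constant[of "{0..t}" "\<lambda>s. w s \<bullet> 1 - exp (\<Gamma> s)"] t by auto
  qed
  then have "exp (\<Gamma> t) = (a v* mexp ((?r * t) *\<^sub>R S)) \<bullet> 1"
    using a1 by (simp add: wt) (simp add: w_def \<Gamma>_def g0)
  moreover have "w t = a v* mexp ((?r * t) *\<^sub>R S)"
    by (metis wt vector_eq_rdot)
  ultimately have "normalise (a v* mexp ((?r * t) *\<^sub>R S)) = (1 / exp (\<Gamma> t)) *\<^sub>R w t"
    by (simp only: normalise_def)
  then show ?thesis by (simp add: w_def)
qed

text \<open>Since the orbit equation has a solution, the choice in the definition of the flow picks one, and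
  uniqueness identifies it.\<close>

lemma orbit_flow_eq:
  assumes a1: "a \<bullet> 1 = 1" and pos: "\<And>s. 0 \<le> s \<Longrightarrow> 0 < orbit_tail i a s" and t: "0 \<le> t"
  shows "orbit_flow i a t = normalise (a v* mexp ((\<bar>c i\<bar> * t) *\<^sub>R S))"
proof -
  let ?P = "\<lambda>g. g 0 = a \<and> (\<forall>t\<ge>0. (g has_vector_derivative orbit_field i (g t)) (at t within {0..}))"
  have "?P (\<lambda>s. normalise (a v* mexp ((\<bar>c i\<bar> * s) *\<^sub>R S)))"
    using pos normalised_orbit_solves[of i a] by (simp add: a1 normalise_def)
  then have "?P (orbit_flow i a)"
    unfolding orbit_flow_def by (rule someI[of ?P])
  then show ?thesis
    by (intro orbit_ODE_unique a1 t) auto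
qed

text \<open>The density, at elapsed time \<open>s\<close>, of an event that leads to phase \<open>j\<close>. With \<open>\<sigma>\<close> for \<open>orbit_tail i a\<close>, no event
  has happened by then with probability \<open>e\<^sup>q\<^sup>s \<sigma>(s)\<close>, \<open>q = T\<^sub>i\<^sub>i\<close>. For \<open>j = i\<close> the event is a change of level, with
  hazard rate \<open>- \<sigma>'(s) / \<sigma>(s)\<close>, and \<open>\<sigma>(s)\<close> cancels.\<close>

definition phase_density :: "int \<times> (real^'p) \<times> 's \<Rightarrow> 's \<Rightarrow> real \<Rightarrow> real" where
  "phase_density x j s = (case x of (l, a, i) \<Rightarrow> exp (T $ i $ i * s) *
     (if j = i then \<bar>c i\<bar> * ((a v* mexp ((\<bar>c i\<bar> * s) *\<^sub>R S)) \<bullet> exit_vec S)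
      else T $ i $ j * orbit_tail i a s))"

end

text \<open>The facts through which the matrix exponential variable enters the law of the phase, separated here from
  the probabilistic argument.\<close>

locale row_sum_preserving_qbd_rap_data = qbd_rap_data c T \<alpha> S d
  for c :: "'s::finite \<Rightarrow> real" and T :: "real^'s^'s"
    and \<alpha> :: "real^'p::finite" and S :: "real^'p^'p" and d :: real +
  assumes generator: "generator_matrix T"
    and D_row_sum: "(a v* D) \<bullet> 1 = a \<bullet> 1"
    and valid_row_sum: "a \<in> valid_orbits \<Longrightarrow> a \<bullet> 1 = 1"
    and valid_tail_pos: "a \<in> valid_orbits \<Longrightarrow> 0 \<le> y \<Longrightarrow> 0 < (a v* mexp (y *\<^sub>R S)) \<bullet> 1"
    and valid_density_nonneg: "a \<in> valid_orbits \<Longrightarrow> 0 \<le> y \<Longrightarrow> 0 \<le> (a v* mexp (y *\<^sub>R S)) \<bullet> exit_vec S"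
begin

lemma T_nonneg: "i \<noteq> j \<Longrightarrow> 0 \<le> T $ i $ j"
  and T_diag: "(\<Sum>j\<in>UNIV - {i}. T $ i $ j) = - T $ i $ i"
proof -
  show "i \<noteq> j \<Longrightarrow> 0 \<le> T $ i $ j" using generator by (simp add: generator_matrix_def)
  have "(\<Sum>j\<in>UNIV. T $ i $ j) = 0" using generator by (simp add: generator_matrix_def)
  then show "(\<Sum>j\<in>UNIV - {i}. T $ i $ j) = - T $ i $ i"
    by (simp add: sum.remove[of UNIV i])
qed

lemma T_diag_nonpos: "T $ i $ i \<le> 0"
  using T_diag[of i] sum_nonneg[of "UNIV - {i}" "\<lambda>j. T $ i $ j"] T_nonneg[of i] by auto

lemma D_phase_row_sum: "(a v* D_phase i j) \<bullet> 1 = a \<bullet> 1"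
  by (simp add: D_phase_def D_row_sum)

lemma orbit_tail_pos: "a \<in> valid_orbits \<Longrightarrow> 0 \<le> s \<Longrightarrow> 0 < orbit_tail i a s"
  unfolding orbit_tail_def by (intro valid_tail_pos) auto

lemma valid_orbit_flow:
  "a \<in> valid_orbits \<Longrightarrow> 0 \<le> s \<Longrightarrow> orbit_flow i a s = normalise (a v* mexp ((\<bar>c i\<bar> * s) *\<^sub>R S))"
  by (intro orbit_flow_eq valid_row_sum orbit_tail_pos)

lemma phase_density_nonneg:
  "a \<in> valid_orbits \<Longrightarrow> 0 \<le> s \<Longrightarrow> 0 \<le> phase_density (l, a, i) j s"
  by (auto simp: phase_density_def intro!: mult_nonneg_nonneg valid_density_nonneg
      T_nonneg less_imp_le[OF orbit_tail_pos])

text \<open>Because \<open>D\<close> preserves row sums, the changes of phase occur with the intensities \<open>T\<^sub>i\<^sub>j\<close>. The orbit enters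
  only through the intensity of a change of level, which is the hazard rate of its tail.\<close>

lemma event_rate_flow:
  assumes a: "a \<in> valid_orbits" and s: "0 \<le> s"
  shows "event_rate (flow (l, a, i) s) {x. snd (snd x) = j} * orbit_tail i a s =
    (if j = i then \<bar>c i\<bar> * ((a v* mexp ((\<bar>c i\<bar> * s) *\<^sub>R S)) \<bullet> exit_vec S)
      else T $ i $ j * orbit_tail i a s)"
    and "event_rate (flow (l, a, i) s) UNIV =
      \<bar>c i\<bar> * ((a v* mexp ((\<bar>c i\<bar> * s) *\<^sub>R S)) \<bullet> exit_vec S) / orbit_tail i a s - T $ i $ i"
proof -
  let ?m = "a v* mexp ((\<bar>c i\<bar> * s) *\<^sub>R S)"
  have pos: "0 < ?m \<bullet> 1" using orbit_tail_pos[OF a s, of i] by (simp add: orbit_tail_def)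
  have level: "level_rate (flow (l, a, i) s) = \<bar>c i\<bar> * (?m \<bullet> exit_vec S) / orbit_tail i a s"
    using a s by (simp add: level_rate_def flow_def valid_orbit_flow normalise_def orbit_tail_def)
  have phase: "phase_rate k (flow (l, a, i) s) = T $ i $ k" for k
    using a s pos by (simp add: phase_rate_def flow_def valid_orbit_flow D_phase_row_sum normalise_inner_1)
  have phases: "snd (snd (flow (l, a, i) s)) = i" "snd (snd (level_target (flow (l, a, i) s))) = i"
      "snd (snd (phase_target k (flow (l, a, i) s))) = k" for k
    by (auto simp: flow_def level_target_def phase_target_def)
  show "event_rate (flow (l, a, i) s) UNIV
      = \<bar>c i\<bar> * (?m \<bullet> exit_vec S) / orbit_tail i a s - T $ i $ i"
    by (simp add: event_rate_def level phase phases T_diag)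
  have "(\<Sum>k\<in>UNIV - {i}. T $ i $ k * indicat_real {x. snd (snd x) = j} (phase_target k (flow (l, a, i) s)))
      = (\<Sum>k\<in>UNIV - {i}. if k = j then T $ i $ k else 0)"
    by (intro sum.cong) (auto simp: phases)
  also have "\<dots> = (if j = i then 0 else T $ i $ j)"
    by simp
  finally show "event_rate (flow (l, a, i) s) {x. snd (snd x) = j} * orbit_tail i a s =
    (if j = i then \<bar>c i\<bar> * (?m \<bullet> exit_vec S) else T $ i $ j * orbit_tail i a s)"
    using orbit_tail_pos[OF a s, of i]
    by (simp add: event_rate_def level phase phases indicator_def)
qed

text \<open>The total intensity \<open>- \<sigma>' / \<sigma> - T\<^sub>i\<^sub>i\<close> along the flow has the antiderivative \<open>- ln \<sigma>(s) - T\<^sub>i\<^sub>i s\<close>, so its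
  exponential is explicit.\<close>

lemma event_density_phase:
  assumes a: "a \<in> valid_orbits" and s: "0 \<le> s"
  shows "event_density (l, a, i) {x. snd (snd x) = j} s = phase_density (l, a, i) j s"
proof -
  let ?f = "\<lambda>r. \<bar>c i\<bar> * ((a v* mexp ((\<bar>c i\<bar> * r) *\<^sub>R S)) \<bullet> exit_vec S) / orbit_tail i a r - T $ i $ i"
  let ?F = "\<lambda>r. - ln (orbit_tail i a r) - T $ i $ i * r"
  have pos: "0 < orbit_tail i a r" if "r \<in> {0..s}" for r
    using orbit_tail_pos[OF a, of r i] that by simp
  have "(LBINT r:{0..s}. event_rate (flow (l, a, i) r) UNIV) = (LBINT r:{0..s}. ?f r)"
    by (intro set_lebesgue_integral_cong) (auto simp: event_rate_flow(2)[OF a])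
  also have "\<dots> = ?F s - ?F 0"
    unfolding set_lebesgue_integral_def
  proof (intro integral_FTC_atLeastAtMost s)
    fix r assume "0 \<le> r" "r \<le> s"
    then have "(?F has_real_derivative ?f r) (at r within {0..s})"
      using pos[of r] by (auto intro!: derivative_eq_intros orbit_tail_has_derivative)
    then show "(?F has_vector_derivative ?f r) (at r within {0..s})"
      by (simp add: has_real_derivative_iff_has_vector_derivative)
  next
    have "orbit_tail i a r \<noteq> 0" if "r \<in> {0..s}" for r using pos[OF that] by simp
    moreover have "continuous_on {0..s} (orbit_tail i a)"
      by (rule DERIV_continuous_on) (rule orbit_tail_has_derivative)
    ultimately show "continuous_on {0..s} ?f"
      by (intro continuous_intros) auto
  qed
  also have "\<dots> = - ln (orbit_tail i a s) - T $ i $ i * s"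
    using valid_row_sum[OF a] by simp
  finally have "exp (- (LBINT r:{0..s}. event_rate (flow (l, a, i) r) UNIV)) = orbit_tail i a s * exp (T $ i $ i * s)"
    using pos[of s] s by (simp add: exp_add)
  then show ?thesis
    using event_rate_flow(1)[OF a s, of l i j]
    by (simp add: event_density_def phase_density_def mult_ac)
qed

text \<open>The integrand is the derivative of \<open>- e\<^sup>q\<^sup>s \<sigma>(s) w\<^sub>i(r - s)\<close>, \<open>q = T\<^sub>i\<^sub>i\<close>: the derivative of \<open>\<sigma>\<close> yields the
  changes of level, and the differential equation for \<open>w\<close> yields the changes of phase. The values \<open>w\<close> and \<open>z\<close> are the rewards, at
  remaining time \<open>r - s\<close>, for an event that keeps the phase and for one that changes it. The last term on the left is
  the reward if there is no event until \<open>r\<close>.\<close>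

lemma phase_density_integral:
  fixes w z :: "real \<Rightarrow> 's \<Rightarrow> real"
  assumes a: "a \<in> valid_orbits" and br: "0 \<le> b" "b \<le> r"
    and z_meas: "\<And>j. (\<lambda>\<rho>. z \<rho> j) \<in> borel_measurable borel"
    and w_nonneg: "\<And>\<rho> j. 0 \<le> \<rho> \<Longrightarrow> 0 \<le> w \<rho> j" and z_nonneg: "\<And>\<rho> j. 0 \<le> \<rho> \<Longrightarrow> 0 \<le> z \<rho> j"
    and w: "\<And>\<rho> i. ((\<lambda>\<rho>. w \<rho> i) has_real_derivative
         T $ i $ i * w \<rho> i + (\<Sum>j\<in>UNIV - {i}. T $ i $ j * z \<rho> j)) (at \<rho>)"
  shows "(\<integral>\<^sup>+ s. (\<Sum>j\<in>UNIV. ennreal (phase_density (l, a, i) j s) *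
          ennreal (if j = i then w (r - s) j else z (r - s) j)) * indicator {b..r} s \<partial>lborel)
      + ennreal (exp (T $ i $ i * r) * orbit_tail i a r * w 0 i)
      = ennreal (exp (T $ i $ i * b) * orbit_tail i a b * w (r - b) i)"
proof -
  let ?X = "\<lambda>j s. if j = i then w (r - s) j else z (r - s) j"
  let ?f = "\<lambda>s. \<Sum>j\<in>UNIV. phase_density (l, a, i) j s * ?X j s"
  let ?F = "\<lambda>s. - (exp (T $ i $ i * s) * orbit_tail i a s * w (r - s) i)"
  let ?lev = "\<lambda>s. \<bar>c i\<bar> * ((a v* mexp ((\<bar>c i\<bar> * s) *\<^sub>R S)) \<bullet> exit_vec S)"
  have f_eq: "?f s = exp (T $ i $ i * s) * (?lev s * w (r - s) i
      + orbit_tail i a s * (\<Sum>j\<in>UNIV - {i}. T $ i $ j * z (r - s) j))" for s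
    by (subst sum.remove[of UNIV i])
      (auto simp: phase_density_def sum_distrib_left algebra_simps intro!: sum.cong)
  have f_nonneg: "0 \<le> ?f s" if "0 \<le> s" "s \<le> r" for s
    using that a by (intro sum_nonneg mult_nonneg_nonneg phase_density_nonneg) (auto intro: w_nonneg z_nonneg)
  have wr: "((\<lambda>s. w (r - s) i) has_real_derivative
      (T $ i $ i * w (r - s) i + (\<Sum>j\<in>UNIV - {i}. T $ i $ j * z (r - s) j)) * - 1) (at s)" for s
    by (rule DERIV_chain2[OF w]) (auto intro!: derivative_eq_intros)
  have F': "(?F has_real_derivative ?f s) (at s)" for s
    unfolding f_eq
    by (rule derivative_eq_intros wr orbit_tail_has_derivative refl | simp)+ (simp add: algebra_simps)
  have w_cont: "continuous_on UNIV (\<lambda>\<rho>. w \<rho> i)"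
    by (rule DERIV_continuous_on) (rule w)
  have [measurable]: "(\<lambda>\<rho>. w \<rho> i) \<in> borel_measurable borel" "\<And>j. (\<lambda>\<rho>. z \<rho> j) \<in> borel_measurable borel"
      "?lev \<in> borel_measurable borel" "orbit_tail i a \<in> borel_measurable borel"
    by (auto intro!: borel_measurable_continuous_onI w_cont z_meas continuous_intros simp: orbit_tail_def)
  have "(\<integral>\<^sup>+ s. (\<Sum>j\<in>UNIV. ennreal (phase_density (l, a, i) j s) * ennreal (?X j s)) * indicator {b..r} s \<partial>lborel)
      = (\<integral>\<^sup>+ s. ennreal (?f s) * indicator {b..r} s \<partial>lborel)"
  proof (intro nn_integral_cong)
    fix s
    have "(\<Sum>j\<in>UNIV. ennreal (phase_density (l, a, i) j s) * ennreal (?X j s)) = ennreal (?f s)" if "s \<in> {b..r}"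
    proof -
      have "0 \<le> phase_density (l, a, i) j s" "0 \<le> ?X j s" for j
        using that br a by (auto intro: phase_density_nonneg w_nonneg z_nonneg)
      then show ?thesis
        by (subst sum_ennreal[symmetric])
          (simp_all only: ennreal_mult' mult_nonneg_nonneg)
    qed
    then show "(\<Sum>j\<in>UNIV. ennreal (phase_density (l, a, i) j s) * ennreal (?X j s)) * indicator {b..r} s
        = ennreal (?f s) * indicator {b..r} s"
      by (auto split: split_indicator)
  qed
  also have "\<dots> = ennreal (?F r - ?F b)"
  proof (rule nn_integral_FTC_Icc)
    show "?f \<in> borel_measurable borel" unfolding f_eq by measurable
  qed (use F' f_nonneg br in auto)
  finally have eq: "(\<integral>\<^sup>+ s. (\<Sum>j\<in>UNIV. ennreal (phase_density (l, a, i) j s) * ennreal (?X j s)) * indicator {b..r} s \<partial>lborel)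
      = ennreal (?F r - ?F b)" .
  have "?F b \<le> ?F r"
    using br f_nonneg F' by (intro DERIV_nonneg_imp_nondecreasing[of b r ?F]) (auto intro!: exI[of _ "?f _"])
  moreover have "?F r \<le> 0"
    using a br by (auto intro!: mult_nonneg_nonneg w_nonneg less_imp_le[OF orbit_tail_pos])
  ultimately show ?thesis
    unfolding eq by (subst ennreal_plus[symmetric]) auto
qed

end

section \<open>Events and their history\<close>

text \<open>The additive form of the hypothesis avoids subtraction of extended numbers.\<close>

lemma telescope_ennreal:
  fixes e f :: "nat \<Rightarrow> ennreal"
  assumes step: "\<And>m. f m + e (Suc m) = e m" and lim: "e \<longlonglongrightarrow> 0"
  shows "(\<Sum>m. f m) = e 0"
proof -
  have sum: "(\<Sum>m<k. f m) + e k = e 0" for k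
    by (induction k) (auto simp: add.assoc step)
  have "(\<lambda>k. (\<Sum>m<k. f m) + e k) \<longlonglongrightarrow> (\<Sum>m. f m) + 0"
    by (intro tendsto_add summable_LIMSEQ lim) auto
  then have "(\<lambda>k. e 0) \<longlonglongrightarrow> (\<Sum>m. f m)" by (simp add: sum)
  then show ?thesis by (simp add: LIMSEQ_const_iff)
qed

locale row_sum_preserving_qbd_rap =
  qbd_rap c T \<alpha> S d M L A \<phi> \<tau> + row_sum_preserving_qbd_rap_data c T \<alpha> S d
  for c :: "'s::finite \<Rightarrow> real" and T :: "real^'s^'s"
    and \<alpha> :: "real^'p::finite" and S :: "real^'p^'p" and d :: real
    and M :: "'w measure"
    and L :: "real \<Rightarrow> 'w \<Rightarrow> int" and A :: "real \<Rightarrow> 'w \<Rightarrow> real^'p" and \<phi> :: "real \<Rightarrow> 'w \<Rightarrow> 's"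
    and \<tau> :: "nat \<Rightarrow> 'w \<Rightarrow> ereal"
begin

text \<open>The phase after the \<open>n\<close>-th event. If there are fewer events, this is the phase at time \<open>0\<close>.\<close>

definition J :: "nat \<Rightarrow> 'w \<Rightarrow> 's" where
  "J n \<omega> = \<phi> (real_of_ereal (\<tau> n \<omega>)) \<omega>"

lemma J_eq: "J n \<omega> = snd (snd (post n \<omega>))"
  by (simp add: J_def post_def)

lemma J_fun_eq: "J n = (\<lambda>\<omega>. snd (snd (post n \<omega>)))"
  by (simp add: fun_eq_iff J_eq)

lemma space_state_space [simp]: "space state_space = UNIV"
  by (simp add: state_space_def space_pair_measure)

lemma \<tau>_mono: "\<omega> \<in> space M \<Longrightarrow> m \<le> n \<Longrightarrow> \<tau> m \<omega> \<le> \<tau> n \<omega>"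
  by (rule lift_Suc_mono_le[of "\<lambda>n. \<tau> n \<omega>"])
    (metis event_infinite event_less less_imp_le order_refl ereal_less_PInfty less_ereal.simps(2) ereal_infty_less(1))

lemma \<tau>_nonneg: "\<omega> \<in> space M \<Longrightarrow> 0 \<le> \<tau> n \<omega>"
  using \<tau>_mono[of \<omega> 0 n] event_0 by simp

lemma \<tau>_finite_eq: "\<omega> \<in> space M \<Longrightarrow> \<tau> n \<omega> < \<infinity> \<Longrightarrow> ereal (real_of_ereal (\<tau> n \<omega>)) = \<tau> n \<omega>"
  using \<tau>_nonneg[of \<omega> n] by (intro ereal_real') auto

lemma \<tau>_real_nonneg: "\<omega> \<in> space M \<Longrightarrow> 0 \<le> real_of_ereal (\<tau> n \<omega>)"
  using \<tau>_nonneg by (simp add: real_of_ereal_pos)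

lemma \<tau>_strict: "\<omega> \<in> space M \<Longrightarrow> m < n \<Longrightarrow> \<tau> m \<omega> < \<infinity> \<Longrightarrow> \<tau> m \<omega> < \<tau> n \<omega>"
  using event_less[of \<omega> m] \<tau>_mono[of \<omega> "Suc m" n] by (auto simp: Suc_le_eq)

lemma post_valid: "\<omega> \<in> space M \<Longrightarrow> fst (snd (post n \<omega>)) \<in> valid_orbits"
  by (simp add: post_def orbit_valid \<tau>_real_nonneg)

lemma post_measurable [measurable]: "post n \<in> M \<rightarrow>\<^sub>M state_space"
proof -
  note event_measurable[measurable]
  have "(\<lambda>\<omega>. (real_of_ereal (\<tau> n \<omega>), \<omega>)) \<in> M \<rightarrow>\<^sub>M restrict_space borel {0..} \<Otimes>\<^sub>M M"
    by (intro measurable_Pair measurable_restrict_space2) (auto simp: \<tau>_real_nonneg)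
  from measurable_comp[OF this process_measurable] show ?thesis
    by (simp add: comp_def post_def[abs_def])
qed

lemma snd_snd_measurable [measurable]: "(\<lambda>x. snd (snd x)) \<in> state_space \<rightarrow>\<^sub>M count_space UNIV"
  unfolding state_space_def by measurable

lemma phase_sets: "{x. snd (snd x) = j} \<in> sets state_space"
  using measurable_sets[OF snd_snd_measurable, of "{j}"] by (simp add: vimage_def)

lemma history_fun_measurable:
  "(\<lambda>\<omega>. \<lambda>k\<in>{..n}. (\<tau> k \<omega>, post k \<omega>)) \<in> M \<rightarrow>\<^sub>M (\<Pi>\<^sub>M k\<in>{..n}. borel \<Otimes>\<^sub>M state_space)"
  using event_measurable by (intro measurable_restrict) auto

lemma space_history [simp]: "space (history n) = space M"
  by (simp add: history_def)

lemma subalgebra_history: "subalgebra M (history n)"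
proof -
  have "(\<lambda>\<omega>. \<omega>) \<in> M \<rightarrow>\<^sub>M history n"
    unfolding history_def by (intro measurable_vimage_algebra2) (auto intro: history_fun_measurable)
  note id = this
  have "A \<in> sets M" if "A \<in> sets (history n)" for A
    using measurable_sets[OF id that] sets.sets_into_space[OF that] by (simp add: Int_absorb2)
  then show ?thesis by (auto simp: subalgebra_def)
qed

lemma history_pair_measurable:
  assumes "k \<le> n"
  shows "(\<lambda>\<omega>. (\<tau> k \<omega>, post k \<omega>)) \<in> history n \<rightarrow>\<^sub>M borel \<Otimes>\<^sub>M state_space"
proof -
  have "(\<lambda>\<omega>. \<lambda>k\<in>{..n}. (\<tau> k \<omega>, post k \<omega>)) \<in> history n \<rightarrow>\<^sub>M (\<Pi>\<^sub>M k\<in>{..n}. borel \<Otimes>\<^sub>M state_space)"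
    unfolding history_def
    by (rule measurable_vimage_algebra1) (use measurable_space[OF history_fun_measurable] in auto)
  from measurable_compose[OF this measurable_component_singleton[of k]] assms show ?thesis by simp
qed

lemma history_measurable [measurable (raw)]:
  assumes "k \<le> n"
  shows "\<tau> k \<in> borel_measurable (history n)" "post k \<in> history n \<rightarrow>\<^sub>M state_space"
    "J k \<in> history n \<rightarrow>\<^sub>M count_space UNIV"
proof -
  show "\<tau> k \<in> borel_measurable (history n)"
    using measurable_compose[OF history_pair_measurable[OF assms] measurable_fst] by simp
  show *: "post k \<in> history n \<rightarrow>\<^sub>M state_space"
    using measurable_compose[OF history_pair_measurable[OF assms] measurable_snd] by simp
  show "J k \<in> history n \<rightarrow>\<^sub>M count_space UNIV"
    using measurable_compose[OF * snd_snd_measurable] by (simp add: J_fun_eq)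
qed

lemma history_mono: "m \<le> n \<Longrightarrow> sets (history m) \<subseteq> sets (history n)"
proof -
  assume "m \<le> n"
  then have "(\<lambda>\<omega>. \<lambda>k\<in>{..m}. (\<tau> k \<omega>, post k \<omega>)) \<in> history n \<rightarrow>\<^sub>M (\<Pi>\<^sub>M k\<in>{..m}. borel \<Otimes>\<^sub>M state_space)"
    by (intro measurable_restrict history_pair_measurable) auto
  then have "(\<lambda>\<omega>. \<omega>) \<in> history n \<rightarrow>\<^sub>M history m"
    unfolding history_def[of m] by (intro measurable_vimage_algebra2) auto
  from measurable_sets[OF this] show ?thesis
    using sets.sets_into_space[of _ "history m"] by (force simp: Int_absorb2)
qed

lemma J_measurable [measurable]: "J n \<in> M \<rightarrow>\<^sub>M count_space UNIV"
  using measurable_compose[OF post_measurable snd_snd_measurable] by (simp add: J_fun_eq)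

lemma \<tau>_measurable [measurable]: "\<tau> n \<in> borel_measurable M"
  by (rule event_measurable)

lemma history_subset: "sets (history n) \<subseteq> sets M"
  using subalgebra_history by (simp add: subalgebra_def)

lemma phase_density_measurable [measurable]:
  "(\<lambda>(x, s). phase_density x j s) \<in> borel_measurable (state_space \<Otimes>\<^sub>M borel)"
proof -
  have "(\<lambda>p. phase_density (fst p) j (snd p)) = (\<lambda>p. (\<lambda>i p. exp (T $ i $ i * snd p) *
     (if j = i then \<bar>c i\<bar> * ((fst (snd (fst p)) v* mexp ((\<bar>c i\<bar> * snd p) *\<^sub>R S)) \<bullet> exit_vec S)
      else T $ i $ j * ((fst (snd (fst p)) v* mexp ((\<bar>c i\<bar> * snd p) *\<^sub>R S)) \<bullet> 1))) (snd (snd (fst p))) p)"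
    by (auto simp: phase_density_def orbit_tail_def fun_eq_iff)
  also have "\<dots> \<in> borel_measurable (state_space \<Otimes>\<^sub>M borel)"
  \<comment> \<open>The phase takes finitely many values, so it may be held fixed.\<close>
  proof (rule measurable_compose_countable)
    fix i
    have "(\<lambda>p. (fst (snd (fst p)), snd p)) \<in> state_space \<Otimes>\<^sub>M borel \<rightarrow>\<^sub>M (borel \<Otimes>\<^sub>M borel :: ((real^'p) \<times> real) measure)"
      unfolding state_space_def by measurable
    from measurable_compose[OF this mexp_row_inner_measurable]
    have [measurable]: "(\<lambda>p. (fst (snd (fst p)) v* mexp ((r * snd p) *\<^sub>R S)) \<bullet> b) \<in> borel_measurable (state_space \<Otimes>\<^sub>M borel)" for r b
      by simp
    show "(\<lambda>p. exp (T $ i $ i * snd p) *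
     (if j = i then \<bar>c i\<bar> * ((fst (snd (fst p)) v* mexp ((\<bar>c i\<bar> * snd p) *\<^sub>R S)) \<bullet> exit_vec S)
      else T $ i $ j * ((fst (snd (fst p)) v* mexp ((\<bar>c i\<bar> * snd p) *\<^sub>R S)) \<bullet> 1))) \<in> borel_measurable (state_space \<Otimes>\<^sub>M borel)"
      by measurable
  qed measurable
  finally show ?thesis by (simp add: case_prod_beta')
qed

lemma phase_density_nonneg': "\<omega> \<in> space M \<Longrightarrow> 0 \<le> s \<Longrightarrow> 0 \<le> phase_density (post n \<omega>) j s"
  using phase_density_nonneg[OF post_valid[of \<omega> n], of s "fst (post n \<omega>)" "snd (snd (post n \<omega>))" j] by simp

lemma event_density_phase': "\<omega> \<in> space M \<Longrightarrow> 0 \<le> s \<Longrightarrow>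
    event_density (post n \<omega>) {x. snd (snd x) = j} s = phase_density (post n \<omega>) j s"
  using event_density_phase[OF post_valid[of \<omega> n], of s "fst (post n \<omega>)" "snd (snd (post n \<omega>))" j] by simp

text \<open>The conditional law of the next event, integrated over an event \<open>G\<close> of the history, with the explicit
  density of the next event inserted.\<close>

lemma next_event_rectangle:
  assumes G: "G \<in> sets (history n)" and fin: "\<And>\<omega>. \<omega> \<in> G \<Longrightarrow> \<tau> n \<omega> < \<infinity>" and t: "0 \<le> t"
  shows "emeasure M {\<omega>\<in>G. \<tau> (Suc n) \<omega> \<le> \<tau> n \<omega> + ereal t \<and> J (Suc n) \<omega> = j}
    = (\<integral>\<^sup>+\<omega>\<in>G. (\<integral>\<^sup>+ s. ennreal (phase_density (post n \<omega>) j s) * indicator {0..t} s \<partial>lborel) \<partial>M)"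
proof -
  interpret finite_measure_subalgebra M "history n"
    by standard (rule subalgebra_history)
  let ?B = "{x. snd (snd x) = j}"
  let ?E = "{\<omega>\<in>space M. \<tau> (Suc n) \<omega> \<le> \<tau> n \<omega> + ereal t \<and> post (Suc n) \<omega> \<in> ?B}"
  let ?I = "\<lambda>\<omega>. LBINT s:{0..t}. event_density (post n \<omega>) ?B s"
  let ?C = "real_cond_exp M (history n) (indicat_real ?E)"
  have GM [measurable]: "G \<in> sets M" using G history_subset by auto
  have [measurable]: "?B \<in> sets state_space" by (rule phase_sets)
  have E [measurable]: "?E \<in> sets M" by measurable
  have law: "AE \<omega> in M. \<tau> n \<omega> < \<infinity> \<longrightarrow> ?C \<omega> = ?I \<omega>"
    by (rule event_law[OF t phase_sets])
  have I: "(\<integral>\<^sup>+ s. ennreal (phase_density (post n \<omega>) j s) * indicator {0..t} s \<partial>lborel) = ennreal (?I \<omega>)"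
    "0 \<le> ?I \<omega>" if \<omega>: "\<omega> \<in> space M" for \<omega>
  proof -
    have eq: "?I \<omega> = (LBINT s:{0..t}. phase_density (post n \<omega>) j s)"
      by (intro set_lebesgue_integral_cong) (auto simp: event_density_phase'[OF \<omega>])
    show "0 \<le> ?I \<omega>"
      unfolding eq unfolding set_lebesgue_integral_def
      by (intro Bochner_Integration.integral_nonneg) (auto simp: phase_density_nonneg'[OF \<omega>] split: split_indicator)
    obtain l a i where x: "post n \<omega> = (l, a, i)" by (cases "post n \<omega>")
    have "continuous_on {0..t} (\<lambda>s. phase_density (post n \<omega>) j s)"
      unfolding x phase_density_def orbit_tail_def prod.case
      by (cases "j = i") (auto intro!: continuous_intros)
    then have int: "integrable lborel (\<lambda>s. indicator {0..t} s *\<^sub>R phase_density (post n \<omega>) j s)"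
      by (rule borel_integrable_atLeastAtMost'[unfolded set_integrable_def])
    have "(\<integral>\<^sup>+ s. ennreal (phase_density (post n \<omega>) j s) * indicator {0..t} s \<partial>lborel)
        = (\<integral>\<^sup>+ s. ennreal (indicator {0..t} s *\<^sub>R phase_density (post n \<omega>) j s) \<partial>lborel)"
      by (intro nn_integral_cong) (auto split: split_indicator)
    also have "\<dots> = ennreal (?I \<omega>)"
      unfolding eq unfolding set_lebesgue_integral_def
      by (intro nn_integral_eq_integral int AE_I2) (auto simp: phase_density_nonneg'[OF \<omega>] split: split_indicator)
    finally show "(\<integral>\<^sup>+ s. ennreal (phase_density (post n \<omega>) j s) * indicator {0..t} s \<partial>lborel) = ennreal (?I \<omega>)" .
  qed
  have intE: "integrable M (indicat_real ?E)"
    by (auto intro!: integrable_real_indicator simp: emeasure_eq_measure)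
  have AE_eq: "AE \<omega> in M. indicator G \<omega> *\<^sub>R ?C \<omega> = indicator G \<omega> *\<^sub>R ?I \<omega>"
    using law by eventually_elim (use fin in \<open>auto split: split_indicator\<close>)
  have "measure M (G \<inter> ?E) = (LINT \<omega>:G|M. indicat_real ?E \<omega>)"
    by (simp add: set_lebesgue_integral_def flip: indicator_inter_arith)
  also have "\<dots> = (LINT \<omega>:G|M. ?C \<omega>)"
    by (rule real_cond_exp_intA[OF intE G])
  finally have "emeasure M (G \<inter> ?E) = ennreal (\<integral>\<omega>. indicator G \<omega> *\<^sub>R ?C \<omega> \<partial>M)"
    by (simp add: emeasure_eq_measure set_lebesgue_integral_def)
  also have "\<dots> = (\<integral>\<^sup>+\<omega>. ennreal (indicator G \<omega> *\<^sub>R ?C \<omega>) \<partial>M)"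
  proof (rule nn_integral_eq_integral[symmetric])
    show "integrable M (\<lambda>\<omega>. indicator G \<omega> *\<^sub>R ?C \<omega>)"
      by (intro integrable_mult_indicator GM real_cond_exp_int(1) intE)
    show "AE \<omega> in M. 0 \<le> indicator G \<omega> *\<^sub>R ?C \<omega>"
      using AE_eq AE_space by eventually_elim (auto simp: I(2))
  qed
  also have "\<dots> = (\<integral>\<^sup>+\<omega>\<in>G. (\<integral>\<^sup>+ s. ennreal (phase_density (post n \<omega>) j s) * indicator {0..t} s \<partial>lborel) \<partial>M)"
    by (rule nn_integral_cong_AE) (use AE_eq AE_space in eventually_elim, auto simp: I split: split_indicator)
  also have "G \<inter> ?E = {\<omega>\<in>G. \<tau> (Suc n) \<omega> \<le> \<tau> n \<omega> + ereal t \<and> J (Suc n) \<omega> = j}"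
    using sets.sets_into_space[OF GM] by (auto simp: J_eq)
  finally show ?thesis .
qed

section \<open>The joint law of the next event and the history\<close>

text \<open>Meaningful only if the event \<open>Suc n\<close> occurs: the real part of \<open>\<infinity>\<close> is \<open>0\<close>.\<close>

definition waiting_time :: "nat \<Rightarrow> 'w \<Rightarrow> real" where
  "waiting_time n \<omega> = real_of_ereal (\<tau> (Suc n) \<omega>) - real_of_ereal (\<tau> n \<omega>)"

lemma waiting_time_pos:
  assumes "\<omega> \<in> space M" "\<tau> (Suc n) \<omega> < \<infinity>"
  shows "0 < waiting_time n \<omega>"
proof -
  have "\<tau> n \<omega> < \<tau> (Suc n) \<omega>" using assms event_infinite[of \<omega> n] event_less[of \<omega> n] by force
  then have "ereal (real_of_ereal (\<tau> n \<omega>)) < ereal (real_of_ereal (\<tau> (Suc n) \<omega>))"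
    using \<tau>_finite_eq[of \<omega> n] \<tau>_finite_eq[of \<omega> "Suc n"] assms by (metis order.strict_trans)
  then show ?thesis by (simp add: waiting_time_def)
qed

lemma waiting_time_le_iff:
  assumes "\<omega> \<in> space M" "\<tau> n \<omega> < \<infinity>"
  shows "\<tau> (Suc n) \<omega> < \<infinity> \<and> waiting_time n \<omega> \<in> {..t} \<longleftrightarrow> \<tau> (Suc n) \<omega> \<le> \<tau> n \<omega> + ereal t"
proof -
  obtain x where x: "\<tau> n \<omega> = ereal x" using \<tau>_finite_eq[OF assms] by metis
  have "\<tau> (Suc n) \<omega> \<noteq> - \<infinity>" using \<tau>_nonneg[OF assms(1), of "Suc n"] by auto
  then show ?thesis
    by (cases "\<tau> (Suc n) \<omega>") (auto simp: x waiting_time_def)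
qed

text \<open>Both sides integrate \<open>h\<close> with respect to a finite measure on pairs of a point of the sample space, observed
  through the history, and a waiting time. These measures agree on products of an event of the history with an interval
  \<open>(-\<infinity>, t]\<close>, hence everywhere. So rewards that depend on the past and on the time of the next event at once are covered.\<close>

lemma next_event_joint:
  assumes h: "h \<in> borel_measurable (history n \<Otimes>\<^sub>M borel)"
    and G: "G \<in> sets (history n)" and fin: "\<And>\<omega>. \<omega> \<in> G \<Longrightarrow> \<tau> n \<omega> < \<infinity>"
  shows "(\<integral>\<^sup>+\<omega>\<in>{\<omega>\<in>G. \<tau> (Suc n) \<omega> < \<infinity> \<and> J (Suc n) \<omega> = j}. h (\<omega>, waiting_time n \<omega>) \<partial>M)
    = (\<integral>\<^sup>+\<omega>\<in>G. (\<integral>\<^sup>+ s. ennreal (phase_density (post n \<omega>) j s) * h (\<omega>, s) * indicator {0..} s \<partial>lborel) \<partial>M)"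
proof -
  let ?E = "{\<omega>\<in>G. \<tau> (Suc n) \<omega> < \<infinity> \<and> J (Suc n) \<omega> = j}"
  let ?W = "\<lambda>\<omega>. (\<omega>, waiting_time n \<omega>)"
  let ?HB = "history n \<Otimes>\<^sub>M borel :: ('w \<times> real) measure"
  let ?p = "\<lambda>(\<omega>, s). ennreal (phase_density (post n \<omega>) j s) * indicator {0..} s * indicator G \<omega>"
  let ?R = "restr_to_subalg M (history n)"
  let ?M1 = "distr (density M (indicator ?E)) ?HB ?W"
  let ?M2 = "density (?R \<Otimes>\<^sub>M lborel) ?p"
  have GM: "G \<in> sets M" using G history_subset by auto
  have E: "?E \<in> sets M"
  proof -
    have "?E = G \<inter> {\<omega>\<in>space M. \<tau> (Suc n) \<omega> < \<infinity> \<and> J (Suc n) \<omega> = j}"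
      using sets.sets_into_space[OF GM] by auto
    also have "\<dots> \<in> sets M" by (intro sets.Int GM) measurable
    finally show ?thesis .
  qed
  have W: "?W \<in> M \<rightarrow>\<^sub>M ?HB"
    unfolding waiting_time_def
    by (intro measurable_Pair measurable_from_subalg[OF subalgebra_history measurable_ident, unfolded id_def])
      measurable
  have setsR: "sets (?R \<Otimes>\<^sub>M lborel) = sets ?HB"
    by (intro sets_pair_measure_cong sets_restr_to_subalg subalgebra_history) simp
  note measR = measurable_cong_sets[OF setsR refl, THEN eqset_imp_iff]
  have p: "?p \<in> borel_measurable ?HB"
  proof -
    have [measurable]: "G \<in> sets (history n)" by fact
    have "(\<lambda>x. (post n (fst x), snd x)) \<in> ?HB \<rightarrow>\<^sub>M state_space \<Otimes>\<^sub>M borel"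
      using history_measurable(2)[of n n] by measurable
    from measurable_compose[OF this phase_density_measurable]
    have [measurable]: "(\<lambda>x. phase_density (post n (fst x)) j (snd x)) \<in> borel_measurable ?HB" by simp
    show ?thesis unfolding case_prod_beta' by measurable
  qed
  interpret R: finite_measure ?R
    by (intro finite_measure_restr_to_subalg subalgebra_history finite_measure_axioms)
  have M2_times: "emeasure ?M2 (H \<times> C)
      = (\<integral>\<^sup>+\<omega>\<in>H \<inter> G. (\<integral>\<^sup>+ s. ennreal (phase_density (post n \<omega>) j s) * indicator ({0..} \<inter> C) s \<partial>lborel) \<partial>M)"
    if H: "H \<in> sets (history n)" and C: "C \<in> sets borel" for H C
  proof -
    have HC: "H \<times> C \<in> sets ?HB" using H C by auto
    have m: "(\<lambda>x. ?p x * indicator (H \<times> C) x) \<in> borel_measurable ?HB"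
      by (intro borel_measurable_times_ennreal p borel_measurable_indicator HC)
    have m': "(\<lambda>x. ?p x * indicator (H \<times> C) x) \<in> borel_measurable (?R \<Otimes>\<^sub>M lborel)"
      using m by (simp only: measR)
    have "emeasure ?M2 (H \<times> C) = (\<integral>\<^sup>+ x. ?p x * indicator (H \<times> C) x \<partial>(?R \<Otimes>\<^sub>M lborel))"
      using p HC by (intro emeasure_density) (simp_all only: measR setsR)
    also have "\<dots> = (\<integral>\<^sup>+\<omega>. (\<integral>\<^sup>+ s. ?p (\<omega>, s) * indicator (H \<times> C) (\<omega>, s) \<partial>lborel) \<partial>?R)"
      by (rule lborel.nn_integral_fst[symmetric]) (rule m')
    also have "\<dots> = (\<integral>\<^sup>+\<omega>. (\<integral>\<^sup>+ s. ?p (\<omega>, s) * indicator (H \<times> C) (\<omega>, s) \<partial>lborel) \<partial>M)"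
    proof (rule nn_integral_subalgebra2[OF subalgebra_history])
      have "(\<lambda>\<omega>. (\<integral>\<^sup>+ s. ?p (\<omega>, s) * indicator (H \<times> C) (\<omega>, s) \<partial>lborel)) \<in> borel_measurable ?R"
        by (rule lborel.borel_measurable_nn_integral_fst) (rule m')
      then show "(\<lambda>\<omega>. (\<integral>\<^sup>+ s. ?p (\<omega>, s) * indicator (H \<times> C) (\<omega>, s) \<partial>lborel)) \<in> borel_measurable (history n)"
        using sets_restr_to_subalg[OF subalgebra_history] measurable_cong_sets by blast
    qed
    also have "\<dots> = (\<integral>\<^sup>+\<omega>\<in>H \<inter> G. (\<integral>\<^sup>+ s. ennreal (phase_density (post n \<omega>) j s) * indicator ({0..} \<inter> C) s \<partial>lborel) \<partial>M)"
      by (intro nn_integral_cong) (auto split: split_indicator intro!: nn_integral_cong)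
    finally show ?thesis .
  qed
  have M1_times: "emeasure ?M1 (H \<times> C) = emeasure M {\<omega>\<in>H \<inter> ?E. waiting_time n \<omega> \<in> C}"
    if H: "H \<in> sets (history n)" and C: "C \<in> sets borel" for H C
  proof -
    have HC: "H \<times> C \<in> sets ?HB" using H C by auto
    have "emeasure ?M1 (H \<times> C) = emeasure (density M (indicator ?E)) (?W -` (H \<times> C) \<inter> space M)"
      by (subst emeasure_distr) (use HC W in \<open>auto cong: measurable_cong_sets\<close>)
    also have "\<dots> = emeasure M (?E \<inter> (?W -` (H \<times> C) \<inter> space M))"
      by (intro emeasure_restricted E measurable_sets[OF W HC])
    also have "?E \<inter> (?W -` (H \<times> C) \<inter> space M) = {\<omega>\<in>H \<inter> ?E. waiting_time n \<omega> \<in> C}"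
      using sets.sets_into_space[OF GM] by auto
    finally show ?thesis .
  qed
  define M1 where "M1 = ?M1"
  define M2 where "M2 = ?M2"
  have sets12: "sets M1 = sets ?HB" "sets M2 = sets ?HB"
    using setsR by (simp_all add: M1_def M2_def)
  note M1_times = M1_times[folded M1_def] and M2_times = M2_times[folded M2_def]
  \<comment> \<open>Waiting times up to a fixed bound are what the conditional law of the next event describes.\<close>
  have half_lines: "emeasure M1 (H \<times> {..t}) = emeasure M2 (H \<times> {..t})" if H: "H \<in> sets (history n)" for H t
  proof (cases "0 \<le> t")
    case True
    have HG: "H \<inter> G \<in> sets (history n)" using H G by auto
    have sp: "H \<inter> G \<subseteq> space M" using sets.sets_into_space[OF GM] by auto
    have "{\<omega>\<in>H \<inter> ?E. waiting_time n \<omega> \<in> {..t}}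
        = {\<omega>\<in>H \<inter> G. \<tau> (Suc n) \<omega> \<le> \<tau> n \<omega> + ereal t \<and> J (Suc n) \<omega> = j}"
      using sp fin waiting_time_le_iff[of _ n t] by blast
    note seteq = this
    have C: "{..t} \<in> sets borel" and i: "{0..} \<inter> {..t} = {0..t}" by auto
    show ?thesis
      unfolding M1_times[OF H C] M2_times[OF H C] i seteq
      by (rule next_event_rectangle[OF HG _ True]) (use fin in auto)
  next
    case False
    have empty: "{\<omega>\<in>H \<inter> ?E. waiting_time n \<omega> \<in> {..t}} = {}"
      using False waiting_time_pos[of _ n] sets.sets_into_space[OF GM] by force
    have C: "{..t} \<in> sets borel" and i: "{0..} \<inter> {..t} = {}" using False by auto
    show ?thesis
      unfolding M1_times[OF H C] M2_times[OF H C] i empty by simp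
  qed
  have fin1: "emeasure M1 X \<noteq> \<infinity>" for X
  proof -
    have "emeasure M1 X \<le> emeasure M1 (space M1)" by (rule emeasure_space)
    also have "\<dots> = emeasure M1 (space M \<times> UNIV)"
      using sets_eq_imp_space_eq[OF sets12(1)] by (simp add: space_pair_measure)
    also have "\<dots> \<le> 1"
      using sets.top[of "history n"] by (subst M1_times) (auto simp: emeasure_eq_measure)
    finally show ?thesis by (auto simp: top_unique)
  qed
  \<comment> \<open>For a fixed event of the history, half-lines generate the Borel sets of waiting times.\<close>
  have rect: "emeasure M1 (H \<times> C) = emeasure M2 (H \<times> C)"
    if H: "H \<in> sets (history n)" and C: "C \<in> sets borel" for H C
  proof -
    let ?slice = "\<lambda>N. distr (density N (indicator (H \<times> UNIV))) borel snd"
    have HU: "H \<times> UNIV \<in> sets ?HB" using H by auto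
    have slice: "emeasure (?slice N) C = emeasure N (H \<times> C)" if N: "sets N = sets ?HB" and C: "C \<in> sets borel" for N C
    proof -
      have sp: "space N = space M \<times> UNIV"
        using sets_eq_imp_space_eq[OF N] by (simp add: space_pair_measure)
      have snd: "snd \<in> N \<rightarrow>\<^sub>M borel"
        using measurable_snd[of "history n" borel] by (simp add: measurable_cong_sets[OF N refl])
      have "emeasure (?slice N) C = emeasure (density N (indicator (H \<times> UNIV))) (snd -` C \<inter> space N)"
        using snd C by (subst emeasure_distr) auto
      also have "\<dots> = emeasure N ((H \<times> UNIV) \<inter> (snd -` C \<inter> space N))"
        using measurable_sets[OF snd C] HU N by (intro emeasure_restricted) auto
      also have "(H \<times> UNIV) \<inter> (snd -` C \<inter> space N) = H \<times> C"
        using sets.sets_into_space[OF H] by (auto simp: sp)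
      finally show ?thesis .
    qed
    have "?slice M1 = ?slice M2"
    proof (rule measure_eqI_generator_eq[where \<Omega>=UNIV and E="range (\<lambda>t::real. {..t})" and A="\<lambda>k. {..real k}"])
      show "Int_stable (range (\<lambda>t::real. {..t}))"
        by (auto simp: Int_stable_def intro!: image_eqI[of _ _ "min _ _"])
      show "emeasure (?slice M1) X = emeasure (?slice M2) X" if "X \<in> range (\<lambda>t::real. {..t})" for X
        using that half_lines[OF H] sets12 by (auto simp: slice)
      show "emeasure (?slice M1) {..real k} \<noteq> \<infinity>" for k
        using fin1 sets12 by (subst slice) auto
      show "(\<Union>k. {..real k}) = (UNIV :: real set)"
        by (auto simp: real_arch_simple)
    qed (auto simp: borel_eq_atMost)
    then show ?thesis
      using slice[of M1 C] slice[of M2 C] C sets12 by simp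
  qed
  \<comment> \<open>Rectangles generate the product \<open>\<sigma>\<close>-algebra.\<close>
  have M_eq: "M1 = M2"
  proof (rule measure_eqI_generator_eq[where \<Omega>="space M \<times> UNIV"
        and E="{a \<times> b | a b. a \<in> sets (history n) \<and> b \<in> sets borel}" and A="\<lambda>_. space M \<times> UNIV"])
    show "Int_stable {a \<times> b | a b. a \<in> sets (history n) \<and> b \<in> sets (borel :: real measure)}"
      by (rule Int_stable_pair_measure_generator)
    show "sets M1 = sigma_sets (space M \<times> UNIV) {a \<times> b | a b. a \<in> sets (history n) \<and> b \<in> sets borel}"
      "sets M2 = sigma_sets (space M \<times> UNIV) {a \<times> b | a b. a \<in> sets (history n) \<and> b \<in> sets borel}"
      using sets12 by (simp_all add: sets_pair_measure)
    show "{a \<times> b | a b. a \<in> sets (history n) \<and> b \<in> sets (borel :: real measure)} \<subseteq> Pow (space M \<times> UNIV)"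
      using sets.sets_into_space[of _ "history n"] by fastforce
    show "range (\<lambda>_. space M \<times> UNIV) \<subseteq> {a \<times> b | a b. a \<in> sets (history n) \<and> b \<in> sets (borel :: real measure)}"
      using sets.top[of "history n"] by (intro image_subsetI CollectI exI[of _ "space M"] exI[of _ UNIV]) simp
  qed (use rect fin1 in auto)
  have "(\<integral>\<^sup>+\<omega>\<in>?E. h (?W \<omega>) \<partial>M) = (\<integral>\<^sup>+ x. h x \<partial>?M1)"
    using h W E by (subst nn_integral_distr)
      (auto simp: nn_integral_density mult.commute measurable_compose[OF W h] cong: measurable_cong_sets)
  also have "\<dots> = (\<integral>\<^sup>+ x. ?p x * h x \<partial>(?R \<Otimes>\<^sub>M lborel))"
    unfolding M_eq[unfolded M1_def M2_def] using h p by (subst nn_integral_density) (simp_all only: measR)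
  also have "\<dots> = (\<integral>\<^sup>+\<omega>. (\<integral>\<^sup>+ s. ?p (\<omega>, s) * h (\<omega>, s) \<partial>lborel) \<partial>?R)"
    using h p by (intro lborel.nn_integral_fst[symmetric] borel_measurable_times_ennreal)
      (simp_all only: measR)
  also have "\<dots> = (\<integral>\<^sup>+\<omega>. (\<integral>\<^sup>+ s. ?p (\<omega>, s) * h (\<omega>, s) \<partial>lborel) \<partial>M)"
  proof (rule nn_integral_subalgebra2[OF subalgebra_history])
    have "(\<lambda>\<omega>. (\<integral>\<^sup>+ s. ?p (\<omega>, s) * h (\<omega>, s) \<partial>lborel)) \<in> borel_measurable ?R"
      using h p by (intro lborel.borel_measurable_nn_integral_fst borel_measurable_times_ennreal)
        (simp_all only: measR)
    then show "(\<lambda>\<omega>. (\<integral>\<^sup>+ s. ?p (\<omega>, s) * h (\<omega>, s) \<partial>lborel)) \<in> borel_measurable (history n)"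
      using sets_restr_to_subalg[OF subalgebra_history] measurable_cong_sets by blast
  qed
  also have "\<dots> = (\<integral>\<^sup>+\<omega>\<in>G. (\<integral>\<^sup>+ s. ennreal (phase_density (post n \<omega>) j s) * h (\<omega>, s) * indicator {0..} s \<partial>lborel) \<partial>M)"
    by (intro nn_integral_cong) (auto split: split_indicator intro!: nn_integral_cong)
  finally show ?thesis .
qed

text \<open>The probability, given the history, that the \<open>n\<close>-th event is followed by no other within time \<open>s\<close>.\<close>

definition phase_survival :: "nat \<Rightarrow> 'w \<Rightarrow> real \<Rightarrow> real" where
  "phase_survival n \<omega> s = exp (T $ J n \<omega> $ J n \<omega> * s) * orbit_tail (J n \<omega>) (fst (snd (post n \<omega>))) s"

lemma post_integral:
  fixes w z :: "real \<Rightarrow> 's \<Rightarrow> real"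
  assumes \<omega>: "\<omega> \<in> space M" and br: "0 \<le> b" "b \<le> r"
    and z_meas: "\<And>j. (\<lambda>\<rho>. z \<rho> j) \<in> borel_measurable borel"
    and w_nonneg: "\<And>\<rho> j. 0 \<le> \<rho> \<Longrightarrow> 0 \<le> w \<rho> j" and z_nonneg: "\<And>\<rho> j. 0 \<le> \<rho> \<Longrightarrow> 0 \<le> z \<rho> j"
    and w: "\<And>\<rho> i. ((\<lambda>\<rho>. w \<rho> i) has_real_derivative
         T $ i $ i * w \<rho> i + (\<Sum>j\<in>UNIV - {i}. T $ i $ j * z \<rho> j)) (at \<rho>)"
  shows "(\<integral>\<^sup>+ s. (\<Sum>j\<in>UNIV. ennreal (phase_density (post n \<omega>) j s) *
          ennreal (if j = J n \<omega> then w (r - s) j else z (r - s) j)) * indicator {b..r} s \<partial>lborel)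
      + ennreal (phase_survival n \<omega> r * w 0 (J n \<omega>))
      = ennreal (phase_survival n \<omega> b * w (r - b) (J n \<omega>))"
  using phase_density_integral[where w=w and z=z, OF post_valid[OF \<omega>, of n] br z_meas w_nonneg z_nonneg w,
      of "fst (post n \<omega>)" "J n \<omega>"]
  by (simp add: phase_survival_def J_eq)

lemma phase_survival_pos: "\<omega> \<in> space M \<Longrightarrow> 0 \<le> s \<Longrightarrow> 0 < phase_survival n \<omega> s"
  unfolding phase_survival_def by (intro mult_pos_pos orbit_tail_pos post_valid) auto

lemma phase_survival_0: "\<omega> \<in> space M \<Longrightarrow> phase_survival n \<omega> 0 = 1"
  by (simp add: phase_survival_def valid_row_sum post_valid)

lemma phase_survival_measurable [measurable]:
  assumes [measurable]: "f \<in> borel_measurable (history n)"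
  shows "(\<lambda>\<omega>. phase_survival n \<omega> (f \<omega>)) \<in> borel_measurable (history n)"
proof -
  have [measurable]: "(\<lambda>x. fst (snd x)) \<in> state_space \<rightarrow>\<^sub>M borel"
    unfolding state_space_def by measurable
  note [measurable] = history_measurable(2,3)[of n n, simplified]
  have "(\<lambda>\<omega>. (fst (snd (post n \<omega>)), f \<omega>)) \<in> history n \<rightarrow>\<^sub>M borel \<Otimes>\<^sub>M borel" by measurable
  from measurable_compose[OF this mexp_row_inner_measurable]
  have [measurable]: "(\<lambda>\<omega>. (fst (snd (post n \<omega>)) v* mexp ((r * f \<omega>) *\<^sub>R S)) \<bullet> 1) \<in> borel_measurable (history n)" for r
    by simp
  have "(\<lambda>\<omega>. (\<lambda>i \<omega>. exp (T $ i $ i * f \<omega>) * ((fst (snd (post n \<omega>)) v* mexp ((\<bar>c i\<bar> * f \<omega>) *\<^sub>R S)) \<bullet> 1)) (J n \<omega>) \<omega>)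
      \<in> borel_measurable (history n)"
    by (rule measurable_compose_countable) measurable
  then show ?thesis by (simp add: phase_survival_def orbit_tail_def)
qed

definition elapsed :: "nat \<Rightarrow> ('w \<Rightarrow> real) \<Rightarrow> 'w \<Rightarrow> real" where
  "elapsed n R \<omega> = R \<omega> - real_of_ereal (\<tau> n \<omega>)"

lemma elapsed_measurable [measurable]:
  "R \<in> borel_measurable (history n) \<Longrightarrow> elapsed n R \<in> borel_measurable (history n)"
  unfolding elapsed_def[abs_def]
  by (intro borel_measurable_diff borel_measurable_real_of_ereal history_measurable(1)[OF order_refl])

context
  fixes n :: nat and G :: "'w set"
  assumes G: "G \<in> sets (history n)" and fin: "\<And>\<omega>. \<omega> \<in> G \<Longrightarrow> \<tau> n \<omega> < \<infinity>"
begin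

lemma G_space: "\<omega> \<in> G \<Longrightarrow> \<omega> \<in> space M"
  using sets.sets_into_space[OF G] by auto

lemma GM: "G \<in> sets M"
  using G history_subset by auto

lemma elapsed_nonneg: "\<omega> \<in> G \<Longrightarrow> \<tau> n \<omega> \<le> ereal (R \<omega>) \<Longrightarrow> 0 \<le> elapsed n R \<omega>"
  using \<tau>_finite_eq[OF G_space fin, of \<omega>] unfolding elapsed_def by (metis diff_ge_0_iff_ge ereal_less_eq(3))

lemma \<tau>_Suc_le_iff:
  assumes \<omega>: "\<omega> \<in> G"
  shows "\<tau> (Suc n) \<omega> \<le> ereal (R \<omega>) \<longleftrightarrow> \<tau> (Suc n) \<omega> < \<infinity> \<and> waiting_time n \<omega> \<le> elapsed n R \<omega>"
proof -
  obtain x where x: "\<tau> n \<omega> = ereal x" using \<tau>_finite_eq[OF G_space fin, OF \<omega> \<omega>] by metis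
  have "\<tau> (Suc n) \<omega> \<noteq> - \<infinity>" using \<tau>_nonneg[OF G_space[OF \<omega>], of "Suc n"] by auto
  then show ?thesis
    by (cases "\<tau> (Suc n) \<omega>") (auto simp: x waiting_time_def elapsed_def)
qed

text \<open>The next event on a window \<open>(B, R]\<close> of time whose ends are known from the history. Up to a null set the
  window is closed once time is measured from the \<open>n\<close>-th event.\<close>

lemma next_event_integral:
  assumes X: "\<And>j. (\<lambda>(\<omega>, s). X \<omega> s j) \<in> borel_measurable (history n \<Otimes>\<^sub>M borel)"
    and R: "R \<in> borel_measurable (history n)" and B: "B \<in> borel_measurable (history n)"
    and B_ge: "\<And>\<omega>. \<omega> \<in> G \<Longrightarrow> \<tau> n \<omega> \<le> ereal (B \<omega>)"
  shows "(\<integral>\<^sup>+\<omega>\<in>{\<omega>\<in>G. ereal (B \<omega>) < \<tau> (Suc n) \<omega> \<and> \<tau> (Suc n) \<omega> \<le> ereal (R \<omega>)}. X \<omega> (waiting_time n \<omega>) (J (Suc n) \<omega>) \<partial>M)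
    = (\<integral>\<^sup>+\<omega>\<in>G. (\<integral>\<^sup>+ s. (\<Sum>j\<in>UNIV. ennreal (phase_density (post n \<omega>) j s) * X \<omega> s j) *
         indicator {elapsed n B \<omega>..elapsed n R \<omega>} s \<partial>lborel) \<partial>M)"
proof -
  let ?q = "\<lambda>\<omega> s. (\<Sum>j\<in>UNIV. ennreal (phase_density (post n \<omega>) j s) * X \<omega> s j) *
    (indicator {elapsed n B \<omega>..elapsed n R \<omega>} s :: ennreal)"
  let ?E = "{\<omega>\<in>G. ereal (B \<omega>) < \<tau> (Suc n) \<omega> \<and> \<tau> (Suc n) \<omega> \<le> ereal (R \<omega>)}"
  let ?h = "\<lambda>j (\<omega>, s). X \<omega> s j * (indicator {s. elapsed n B \<omega> < s \<and> s \<le> elapsed n R \<omega>} s :: ennreal)"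
  have h: "?h j \<in> borel_measurable (history n \<Otimes>\<^sub>M borel)" for j
  proof -
    have [measurable]: "(\<lambda>x. X (fst x) (snd x) j) \<in> borel_measurable (history n \<Otimes>\<^sub>M borel)"
      using X[of j] by (simp add: case_prod_beta')
    have [measurable]: "elapsed n B \<in> borel_measurable (history n)" "elapsed n R \<in> borel_measurable (history n)"
      using R B by measurable
    have "(\<lambda>x. X (fst x) (snd x) j * (if elapsed n B (fst x) < snd x \<and> snd x \<le> elapsed n R (fst x) then 1 else 0))
        \<in> borel_measurable (history n \<Otimes>\<^sub>M borel)" by measurable
    then show ?thesis by (simp add: case_prod_beta' indicator_def)
  qed
  have pointwise: "X \<omega> (waiting_time n \<omega>) (J (Suc n) \<omega>) * indicator ?E \<omega>
      = (\<Sum>j\<in>UNIV. ?h j (\<omega>, waiting_time n \<omega>) * indicator {\<omega>\<in>G. \<tau> (Suc n) \<omega> < \<infinity> \<and> J (Suc n) \<omega> = j} \<omega>)" for \<omega>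
  proof (cases "\<omega> \<in> G \<and> \<tau> (Suc n) \<omega> < \<infinity>")
    case True
    then have "\<omega> \<in> ?E \<longleftrightarrow> elapsed n B \<omega> < waiting_time n \<omega> \<and> waiting_time n \<omega> \<le> elapsed n R \<omega>"
      using \<tau>_Suc_le_iff[of \<omega> R] \<tau>_Suc_le_iff[of \<omega> B] by (auto simp: not_le[symmetric])
    moreover have "(\<Sum>j\<in>UNIV. ?h j (\<omega>, waiting_time n \<omega>) * indicator {\<omega>\<in>G. \<tau> (Suc n) \<omega> < \<infinity> \<and> J (Suc n) \<omega> = j} \<omega>)
        = (\<Sum>j\<in>UNIV. if j = J (Suc n) \<omega> then ?h j (\<omega>, waiting_time n \<omega>) else 0)"
      using True by (intro sum.cong) (auto simp: indicator_def)
    ultimately show ?thesis by (auto simp: indicator_def)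
  next
    case False
    then have "\<omega> \<notin> ?E" by auto
    then show ?thesis using False by (auto simp: indicator_def)
  qed
  have wm: "(\<lambda>\<omega>. (\<omega>, waiting_time n \<omega>)) \<in> M \<rightarrow>\<^sub>M history n \<Otimes>\<^sub>M borel"
    unfolding waiting_time_def
    by (intro measurable_Pair measurable_from_subalg[OF subalgebra_history measurable_ident, unfolded id_def]) measurable
  have hm: "(\<lambda>\<omega>. ?h j (\<omega>, waiting_time n \<omega>) * indicator {\<omega>\<in>G. \<tau> (Suc n) \<omega> < \<infinity> \<and> J (Suc n) \<omega> = j} \<omega>) \<in> borel_measurable M" for j
  proof -
    have "{\<omega>\<in>G. \<tau> (Suc n) \<omega> < \<infinity> \<and> J (Suc n) \<omega> = j} = G \<inter> {\<omega>\<in>space M. \<tau> (Suc n) \<omega> < \<infinity> \<and> J (Suc n) \<omega> = j}"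
      using G_space by auto
    also have "\<dots> \<in> sets M" by (intro sets.Int GM) measurable
    finally show ?thesis
      by (intro borel_measurable_times_ennreal borel_measurable_indicator measurable_compose[OF wm h])
  qed
  have "(\<integral>\<^sup>+\<omega>\<in>?E. X \<omega> (waiting_time n \<omega>) (J (Suc n) \<omega>) \<partial>M)
      = (\<Sum>j\<in>UNIV. \<integral>\<^sup>+\<omega>\<in>{\<omega>\<in>G. \<tau> (Suc n) \<omega> < \<infinity> \<and> J (Suc n) \<omega> = j}. ?h j (\<omega>, waiting_time n \<omega>) \<partial>M)"
    unfolding pointwise using hm by (intro nn_integral_sum) auto
  also have "\<dots> = (\<Sum>j\<in>UNIV. \<integral>\<^sup>+\<omega>\<in>G. (\<integral>\<^sup>+ s. ennreal (phase_density (post n \<omega>) j s) * ?h j (\<omega>, s) * indicator {0..} s \<partial>lborel) \<partial>M)"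
    by (intro sum.cong refl next_event_joint h G fin)
  also have "\<dots> = (\<integral>\<^sup>+\<omega>\<in>G. (\<integral>\<^sup>+ s. ?q \<omega> s \<partial>lborel) \<partial>M)"
  proof -
    let ?f = "\<lambda>j x. ennreal (phase_density (post n (fst x)) j (snd x)) * ?h j x * indicator {0..} (snd x)"
    have f [measurable]: "?f j \<in> borel_measurable (history n \<Otimes>\<^sub>M borel)" for j
    proof -
      have "(\<lambda>x. (post n (fst x), snd x)) \<in> history n \<Otimes>\<^sub>M borel \<rightarrow>\<^sub>M state_space \<Otimes>\<^sub>M (borel :: real measure)"
        using history_measurable(2)[of n n] by measurable
      from measurable_compose[OF this phase_density_measurable]
      have pd: "(\<lambda>x. phase_density (post n (fst x)) j (snd x)) \<in> borel_measurable (history n \<Otimes>\<^sub>M borel)" by simp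
      show ?thesis
        by (intro borel_measurable_times_ennreal h measurable_compose[OF pd measurable_ennreal]) measurable
    qed
    have fl: "?f j \<in> borel_measurable (history n \<Otimes>\<^sub>M lborel)" for j
      using f[of j] by (simp cong: measurable_cong_sets)
    have inner: "(\<lambda>\<omega>. \<integral>\<^sup>+ s. ?f j (\<omega>, s) \<partial>lborel) \<in> borel_measurable M" for j
      using measurable_from_subalg[OF subalgebra_history lborel.borel_measurable_nn_integral_fst[OF fl[of j]]] .
    have slice: "(\<lambda>s. ?f j (\<omega>, s)) \<in> borel_measurable lborel" if "\<omega> \<in> space M" for \<omega> j
      using measurable_Pair2[OF fl[of j], of \<omega>] that by simp
    have "(\<Sum>j\<in>UNIV. \<integral>\<^sup>+\<omega>\<in>G. (\<integral>\<^sup>+ s. ?f j (\<omega>, s) \<partial>lborel) \<partial>M)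
        = (\<integral>\<^sup>+\<omega>. (\<Sum>j\<in>UNIV. (\<integral>\<^sup>+ s. ?f j (\<omega>, s) \<partial>lborel) * indicator G \<omega>) \<partial>M)"
      using inner GM by (intro nn_integral_sum[symmetric] borel_measurable_times_ennreal) auto
    also have "\<dots> = (\<integral>\<^sup>+\<omega>\<in>G. (\<integral>\<^sup>+ s. ?q \<omega> s \<partial>lborel) \<partial>M)"
    proof (intro nn_integral_cong)
      fix \<omega> assume \<omega>: "\<omega> \<in> space M"
      have "(\<Sum>j\<in>UNIV. \<integral>\<^sup>+ s. ?f j (\<omega>, s) \<partial>lborel) = (\<integral>\<^sup>+ s. ?q \<omega> s \<partial>lborel)" if \<omega>G: "\<omega> \<in> G"
      proof -
        have "(\<Sum>j\<in>UNIV. \<integral>\<^sup>+ s. ?f j (\<omega>, s) \<partial>lborel) = (\<integral>\<^sup>+ s. (\<Sum>j\<in>UNIV. ?f j (\<omega>, s)) \<partial>lborel)"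
          using slice[OF \<omega>] by (intro nn_integral_sum[symmetric]) auto
        also have "\<dots> = (\<integral>\<^sup>+ s. ?q \<omega> s \<partial>lborel)"
        proof (rule nn_integral_cong_AE)
          show "AE s in lborel. (\<Sum>j\<in>UNIV. ?f j (\<omega>, s)) = ?q \<omega> s"
            using AE_lborel_singleton[of "elapsed n B \<omega>"]
          proof eventually_elim
            case (elim s)
            then show ?case
              using elapsed_nonneg[of \<omega> B, OF \<omega>G B_ge[OF \<omega>G]]
              by (auto simp: indicator_def)
          qed
        qed
        finally show ?thesis .
      qed
      then show "(\<Sum>j\<in>UNIV. (\<integral>\<^sup>+ s. ?f j (\<omega>, s) \<partial>lborel) * indicator G \<omega>) = (\<integral>\<^sup>+ s. ?q \<omega> s \<partial>lborel) * indicator G \<omega>"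
        by (auto split: split_indicator)
    qed
    finally show ?thesis by simp
  qed
  finally show ?thesis .
qed

end

section \<open>Backward equations along the events\<close>

text \<open>By the time \<open>B\<close> an event has happened or not. The density of the next event up to \<open>B\<close> and the survival
  probability add up to \<open>1\<close>, which is the telescoping integral of the density for \<open>w = z = 1\<close>. The bound \<open>K\<close> makes the mass of the first
  case finite, so that it can be cancelled.\<close>

lemma survival:
  assumes G: "G \<in> sets (history n)" and fin: "\<And>\<omega>. \<omega> \<in> G \<Longrightarrow> \<tau> n \<omega> < \<infinity>"
    and B: "B \<in> borel_measurable (history n)" and B_ge: "\<And>\<omega>. \<omega> \<in> G \<Longrightarrow> \<tau> n \<omega> \<le> ereal (B \<omega>)"
    and k: "k \<in> borel_measurable (history n)" and k_le: "\<And>\<omega>. \<omega> \<in> G \<Longrightarrow> k \<omega> \<le> ennreal K"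
  shows "(\<integral>\<^sup>+\<omega>\<in>{\<omega>\<in>G. ereal (B \<omega>) < \<tau> (Suc n) \<omega>}. k \<omega> \<partial>M)
    = (\<integral>\<^sup>+\<omega>\<in>G. ennreal (phase_survival n \<omega> (elapsed n B \<omega>)) * k \<omega> \<partial>M)"
proof -
  let ?t = "\<lambda>\<omega>. real_of_ereal (\<tau> n \<omega>)"
  let ?s = "\<lambda>\<omega>. ennreal (phase_survival n \<omega> (elapsed n B \<omega>))"
  let ?q = "\<lambda>\<omega> s. (\<Sum>j\<in>UNIV. ennreal (phase_density (post n \<omega>) j s) * k \<omega>) *
    (indicator {elapsed n ?t \<omega>..elapsed n B \<omega>} s :: ennreal)"
  let ?A = "{\<omega>\<in>G. \<tau> (Suc n) \<omega> \<le> ereal (B \<omega>)}"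
  let ?C = "{\<omega>\<in>G. ereal (B \<omega>) < \<tau> (Suc n) \<omega>}"
  have GM: "G \<in> sets M" using G history_subset by auto
  have sp: "\<omega> \<in> space M" if "\<omega> \<in> G" for \<omega> using that sets.sets_into_space[OF GM] by auto
  have t: "?t \<in> borel_measurable (history n)"
    by (intro borel_measurable_real_of_ereal history_measurable(1)[OF order_refl])
  have tG: "\<tau> n \<omega> = ereal (?t \<omega>)" if "\<omega> \<in> G" for \<omega> using \<tau>_finite_eq[OF sp fin] that by simp
  have BM: "B \<in> borel_measurable M" and kM: "k \<in> borel_measurable M"
    using B k measurable_from_subalg[OF subalgebra_history] by auto
  have A_alt: "?A = {\<omega>\<in>G. ereal (?t \<omega>) < \<tau> (Suc n) \<omega> \<and> \<tau> (Suc n) \<omega> \<le> ereal (B \<omega>)}"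
    using fin sp event_less[of _ n] tG by force
  have sets: "?A \<in> sets M" "?C \<in> sets M"
  proof -
    have "?A = G \<inter> {\<omega>\<in>space M. \<tau> (Suc n) \<omega> \<le> ereal (B \<omega>)}" "?C = G \<inter> {\<omega>\<in>space M. ereal (B \<omega>) < \<tau> (Suc n) \<omega>}"
      using sp by auto
    moreover have "{\<omega>\<in>space M. \<tau> (Suc n) \<omega> \<le> ereal (B \<omega>)} \<in> sets M" "{\<omega>\<in>space M. ereal (B \<omega>) < \<tau> (Suc n) \<omega>} \<in> sets M"
      using BM by measurable
    ultimately show "?A \<in> sets M" "?C \<in> sets M" using GM by auto
  qed
  have surv_M: "?s \<in> borel_measurable M"
    by (rule measurable_compose[OF measurable_from_subalg[OF subalgebra_history
            phase_survival_measurable[OF elapsed_measurable[OF B]]] measurable_ennreal])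
  have one: "(\<integral>\<^sup>+ s. (\<Sum>j\<in>UNIV. ennreal (phase_density (post n \<omega>) j s)) * indicator {0..elapsed n B \<omega>} s \<partial>lborel) + ?s \<omega> = 1"
    if \<omega>: "\<omega> \<in> G" for \<omega>
  proof -
    have "0 \<le> elapsed n B \<omega>" using elapsed_nonneg[where R=B, OF G fin \<omega> B_ge[OF \<omega>]] by simp
    from post_integral[OF sp[OF \<omega>] order_refl this, of "\<lambda>_ _. 1" "\<lambda>_ _. 1" n]
    show ?thesis by (simp add: T_diag phase_survival_0[OF sp[OF \<omega>]])
  qed
  have le1: "?s \<omega> \<le> 1" if "\<omega> \<in> G" for \<omega>
    using add_increasing[OF zero_le order_refl, of "?s \<omega>"] one[OF that] by metis
  have "(\<integral>\<^sup>+\<omega>\<in>?A. k \<omega> \<partial>M) = (\<integral>\<^sup>+\<omega>\<in>G. (\<integral>\<^sup>+ s. ?q \<omega> s \<partial>lborel) \<partial>M)"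
    unfolding A_alt
  proof (rule next_event_integral[where X="\<lambda>\<omega> s j. k \<omega>"])
    show "(\<lambda>(\<omega>, s). k \<omega>) \<in> borel_measurable (history n \<Otimes>\<^sub>M borel)"
      using measurable_compose[OF measurable_fst k] by (simp add: case_prod_beta')
    show "\<tau> n \<omega> \<le> ereal (?t \<omega>)" if "\<omega> \<in> G" for \<omega> using tG[OF that] by simp
  qed (use G fin B t in auto)
  also have "\<dots> = (\<integral>\<^sup>+\<omega>\<in>G. (1 - ?s \<omega>) * k \<omega> \<partial>M)"
  proof (intro nn_integral_cong)
    fix \<omega>
    have "(\<integral>\<^sup>+ s. ?q \<omega> s \<partial>lborel) = (1 - ?s \<omega>) * k \<omega>" if \<omega>: "\<omega> \<in> G"
    proof -
      let ?I = "\<integral>\<^sup>+ s. (\<Sum>j\<in>UNIV. ennreal (phase_density (post n \<omega>) j s)) * indicator {0..elapsed n B \<omega>} s \<partial>lborel"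
      have "(\<integral>\<^sup>+ s. ?q \<omega> s \<partial>lborel) =
         (\<integral>\<^sup>+ s. k \<omega> * ((\<Sum>j\<in>UNIV. ennreal (phase_density (post n \<omega>) j s)) * indicator {0..elapsed n B \<omega>} s) \<partial>lborel)"
      proof -
        have e0: "elapsed n ?t \<omega> = 0" by (simp add: elapsed_def)
        show ?thesis unfolding e0 sum_distrib_right[symmetric] by (simp only: mult_ac)
      qed
      also have "\<dots> = k \<omega> * ?I"
      proof (intro nn_integral_cmult borel_measurable_times_ennreal borel_measurable_sum)
        fix j
        show "(\<lambda>s. ennreal (phase_density (post n \<omega>) j s)) \<in> borel_measurable lborel"
          using measurable_Pair2[OF phase_density_measurable[of j], of "post n \<omega>"] by simp
      qed simp
      also have "?I = 1 - ?s \<omega>"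
        using one[OF \<omega>] by (metis ennreal_add_diff_cancel_right ennreal_neq_top)
      finally show ?thesis by (simp add: mult.commute)
    qed
    then show "(\<integral>\<^sup>+ s. ?q \<omega> s \<partial>lborel) * indicator G \<omega> = (1 - ?s \<omega>) * k \<omega> * indicator G \<omega>"
      by (auto split: split_indicator)
  qed
  finally have A_eq: "(\<integral>\<^sup>+\<omega>\<in>?A. k \<omega> \<partial>M) = (\<integral>\<^sup>+\<omega>\<in>G. (1 - ?s \<omega>) * k \<omega> \<partial>M)" .
  have "(\<integral>\<^sup>+\<omega>\<in>?A. k \<omega> \<partial>M) + (\<integral>\<^sup>+\<omega>\<in>?C. k \<omega> \<partial>M) = (\<integral>\<^sup>+\<omega>. k \<omega> * indicator ?A \<omega> + k \<omega> * indicator ?C \<omega> \<partial>M)"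
    using kM sets by (intro nn_integral_add[symmetric] borel_measurable_times_ennreal) auto
  also have "\<dots> = (\<integral>\<^sup>+\<omega>\<in>G. k \<omega> \<partial>M)"
    by (intro nn_integral_cong) (auto split: split_indicator)
  also have "\<dots> = (\<integral>\<^sup>+\<omega>. (1 - ?s \<omega>) * k \<omega> * indicator G \<omega> + ?s \<omega> * k \<omega> * indicator G \<omega> \<partial>M)"
  proof (intro nn_integral_cong)
    fix \<omega>
    have "k \<omega> = (1 - ?s \<omega>) * k \<omega> + ?s \<omega> * k \<omega>" if "\<omega> \<in> G"
      using diff_add_cancel_ennreal[OF le1[OF that]] by (metis distrib_right mult_1)
    then show "k \<omega> * indicator G \<omega> = (1 - ?s \<omega>) * k \<omega> * indicator G \<omega> + ?s \<omega> * k \<omega> * indicator G \<omega>"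
      by (auto split: split_indicator)
  qed
  also have "\<dots> = (\<integral>\<^sup>+\<omega>\<in>G. (1 - ?s \<omega>) * k \<omega> \<partial>M) + (\<integral>\<^sup>+\<omega>\<in>G. ?s \<omega> * k \<omega> \<partial>M)"
    using kM GM surv_M by (intro nn_integral_add borel_measurable_times_ennreal borel_measurable_minus_ennreal) auto
  finally have "(\<integral>\<^sup>+\<omega>\<in>?A. k \<omega> \<partial>M) + (\<integral>\<^sup>+\<omega>\<in>?C. k \<omega> \<partial>M)
      = (\<integral>\<^sup>+\<omega>\<in>?A. k \<omega> \<partial>M) + (\<integral>\<^sup>+\<omega>\<in>G. ?s \<omega> * k \<omega> \<partial>M)"
    unfolding A_eq .
  moreover have "(\<integral>\<^sup>+\<omega>\<in>?A. k \<omega> \<partial>M) \<noteq> \<top>"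
  proof -
    have "(\<integral>\<^sup>+\<omega>\<in>?A. k \<omega> \<partial>M) \<le> (\<integral>\<^sup>+\<omega>. ennreal K \<partial>M)"
      by (intro nn_integral_mono) (auto split: split_indicator simp: k_le)
    also have "\<dots> = ennreal K" by (simp add: emeasure_space_1)
    finally show ?thesis by (auto simp: top_unique)
  qed
  ultimately show ?thesis by (simp add: ennreal_add_left_cancel)
qed

text \<open>Kolmogorov's backward equation, with the value after a change of phase prescribed by a function \<open>z\<close>
  that may differ from \<open>w\<close>. The equation is required on the whole line, which avoids one-sided derivatives at \<open>0\<close>.\<close>

definition backward_solution :: "(real \<Rightarrow> 's \<Rightarrow> real) \<Rightarrow> (real \<Rightarrow> 's \<Rightarrow> real) \<Rightarrow> bool" where
  "backward_solution w z \<longleftrightarrow> (\<forall>\<rho>\<ge>0. \<forall>j. 0 \<le> w \<rho> j \<and> 0 \<le> z \<rho> j) \<and> (\<forall>j. continuous_on UNIV (\<lambda>\<rho>. z \<rho> j)) \<and>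
     (\<forall>\<rho> i. ((\<lambda>\<rho>. w \<rho> i) has_real_derivative
         T $ i $ i * w \<rho> i + (\<Sum>j\<in>UNIV - {i}. T $ i $ j * z \<rho> j)) (at \<rho>))"

lemma backward_solutionD:
  assumes "backward_solution w z"
  shows "0 \<le> \<rho> \<Longrightarrow> 0 \<le> w \<rho> j" "0 \<le> \<rho> \<Longrightarrow> 0 \<le> z \<rho> j"
    "continuous_on UNIV (\<lambda>\<rho>. z \<rho> j)" "continuous_on UNIV (\<lambda>\<rho>. w \<rho> j)"
    "((\<lambda>\<rho>. w \<rho> i) has_real_derivative
         T $ i $ i * w \<rho> i + (\<Sum>j\<in>UNIV - {i}. T $ i $ j * z \<rho> j)) (at \<rho>)"
  using assms by (auto simp: backward_solution_def intro!: DERIV_continuous_on)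

lemma backward_solution_bounded:
  assumes "backward_solution w z"
  obtains K where "\<And>\<rho> j. 0 \<le> \<rho> \<Longrightarrow> \<rho> \<le> U \<Longrightarrow> w \<rho> j \<le> K"
proof -
  have "\<exists>K. \<forall>\<rho>\<in>{0..U}. w \<rho> j \<le> K" for j
  proof -
    have "compact ((\<lambda>\<rho>. w \<rho> j) ` {0..U})"
      by (intro compact_continuous_image continuous_on_subset[OF backward_solutionD(4)[OF assms]]) auto
    then have "bdd_above ((\<lambda>\<rho>. w \<rho> j) ` {0..U})"
      by (intro bounded_imp_bdd_above compact_imp_bounded)
    then show ?thesis by (auto simp: bdd_above_def)
  qed
  then obtain K where K: "\<And>j \<rho>. \<rho> \<in> {0..U} \<Longrightarrow> w \<rho> j \<le> K j" by metis
  have "w \<rho> j \<le> Max (range K)" if "0 \<le> \<rho>" "\<rho> \<le> U" for \<rho> j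
    using K[of \<rho> j] that by (intro order.trans[OF K Max_ge]) auto
  then show ?thesis by (rule that)
qed

text \<open>Optional stopping over one event. Read \<open>w (R - s) i\<close> as the value of being in phase \<open>i\<close> at the time \<open>s\<close>
  before the deadline \<open>R\<close>. If no event occurs until \<open>B\<close>, the value at \<open>B\<close> is the mean of the value at the next event
  or, if that comes too late, at the deadline.\<close>

lemma next_event_step:
  assumes ws: "backward_solution w z"
    and G: "G \<in> sets (history n)" and fin: "\<And>\<omega>. \<omega> \<in> G \<Longrightarrow> \<tau> n \<omega> < \<infinity>"
    and B: "B \<in> borel_measurable (history n)" and B_ge: "\<And>\<omega>. \<omega> \<in> G \<Longrightarrow> \<tau> n \<omega> \<le> ereal (B \<omega>)"
    and R: "R \<in> borel_measurable (history n)" and R_ge: "\<And>\<omega>. \<omega> \<in> G \<Longrightarrow> B \<omega> \<le> R \<omega>"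
    and RB: "\<And>\<omega>. \<omega> \<in> G \<Longrightarrow> R \<omega> - B \<omega> \<le> U"
  shows "(\<integral>\<^sup>+\<omega>\<in>{\<omega>\<in>G. ereal (B \<omega>) < \<tau> (Suc n) \<omega> \<and> \<tau> (Suc n) \<omega> \<le> ereal (R \<omega>)}.
        ennreal (if J (Suc n) \<omega> = J n \<omega> then w (R \<omega> - real_of_ereal (\<tau> (Suc n) \<omega>)) (J (Suc n) \<omega>)
          else z (R \<omega> - real_of_ereal (\<tau> (Suc n) \<omega>)) (J (Suc n) \<omega>)) \<partial>M)
      + (\<integral>\<^sup>+\<omega>\<in>{\<omega>\<in>G. ereal (R \<omega>) < \<tau> (Suc n) \<omega>}. ennreal (w 0 (J n \<omega>)) \<partial>M)
      = (\<integral>\<^sup>+\<omega>\<in>{\<omega>\<in>G. ereal (B \<omega>) < \<tau> (Suc n) \<omega>}. ennreal (w (R \<omega> - B \<omega>) (J n \<omega>)) \<partial>M)"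
proof -
  note ws' = backward_solutionD[OF ws]
  obtain K where K: "\<And>\<rho> j. 0 \<le> \<rho> \<Longrightarrow> \<rho> \<le> max U 0 \<Longrightarrow> w \<rho> j \<le> K"
    using backward_solution_bounded[OF ws, of "max U 0"] by metis
  let ?b = "elapsed n B" and ?r = "elapsed n R"
  let ?s = "\<lambda>f \<omega>. phase_survival n \<omega> (elapsed n f \<omega>)"
  let ?X = "\<lambda>\<omega> s j. ennreal (if j = J n \<omega> then w (?r \<omega> - s) j else z (?r \<omega> - s) j)"
  have GM: "G \<in> sets M" using G history_subset by auto
  have sp: "\<omega> \<in> space M" if "\<omega> \<in> G" for \<omega> using that sets.sets_into_space[OF GM] by auto
  have r_b: "?r \<omega> - ?b \<omega> = R \<omega> - B \<omega>" for \<omega> by (simp add: elapsed_def)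
  have r_w: "?r \<omega> - waiting_time n \<omega> = R \<omega> - real_of_ereal (\<tau> (Suc n) \<omega>)" for \<omega>
    by (simp add: elapsed_def waiting_time_def)
  have R_ge': "\<tau> n \<omega> \<le> ereal (R \<omega>)" if "\<omega> \<in> G" for \<omega>
    using B_ge[OF that] R_ge[OF that] by (metis ereal_less_eq(3) order.trans)
  have b_nonneg: "0 \<le> ?b \<omega>" and b_le_r: "?b \<omega> \<le> ?r \<omega>" if "\<omega> \<in> G" for \<omega>
    using elapsed_nonneg[where R=B, OF G fin that B_ge[OF that]] R_ge[OF that] by (auto simp: elapsed_def)
  have J: "J n \<in> history n \<rightarrow>\<^sub>M count_space UNIV" by (rule history_measurable(3)[OF order_refl])
  have wm: "(\<lambda>\<omega>. w (f \<omega>) (J n \<omega>)) \<in> borel_measurable (history n)" if f: "f \<in> borel_measurable (history n)" for f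
    by (rule measurable_compose_countable[OF measurable_compose[OF f borel_measurable_continuous_onI[OF ws'(4)]] J])
  have Xm: "(\<lambda>(\<omega>, s). ?X \<omega> s j) \<in> borel_measurable (history n \<Otimes>\<^sub>M borel)" for j
  proof -
    have d: "(\<lambda>x. ?r (fst x) - snd x) \<in> borel_measurable (history n \<Otimes>\<^sub>M borel)"
      by (intro borel_measurable_diff measurable_compose[OF measurable_fst elapsed_measurable[OF R]] measurable_snd)
    have e: "{x \<in> space (history n \<Otimes>\<^sub>M borel). j = J n (fst x)} \<in> sets (history n \<Otimes>\<^sub>M (borel :: real measure))"
    proof -
      have "(\<lambda>x. J n (fst x)) -` {j} \<inter> space (history n \<Otimes>\<^sub>M (borel :: real measure)) \<in> sets (history n \<Otimes>\<^sub>M borel)"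
        by (rule measurable_sets[OF measurable_compose[OF measurable_fst J]]) simp
      also have "(\<lambda>x. J n (fst x)) -` {j} \<inter> space (history n \<Otimes>\<^sub>M (borel :: real measure))
          = {x \<in> space (history n \<Otimes>\<^sub>M borel). j = J n (fst x)}" by auto
      finally show ?thesis .
    qed
    have "(\<lambda>x. if j = J n (fst x) then w (?r (fst x) - snd x) j else z (?r (fst x) - snd x) j)
        \<in> borel_measurable (history n \<Otimes>\<^sub>M borel)"
      by (intro measurable_If e measurable_compose[OF d borel_measurable_continuous_onI] ws')
    then show ?thesis by (simp add: case_prod_beta')
  qed
  let ?I = "\<lambda>\<omega>. \<integral>\<^sup>+ s. (\<Sum>j\<in>UNIV. ennreal (phase_density (post n \<omega>) j s) * ?X \<omega> s j) *
    indicator {?b \<omega>..?r \<omega>} s \<partial>lborel"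
  let ?a = "\<lambda>\<omega>. ?s B \<omega> * w (R \<omega> - B \<omega>) (J n \<omega>)" and ?c = "\<lambda>\<omega>. ?s R \<omega> * w 0 (J n \<omega>)"
  have c_nonneg: "0 \<le> ?c \<omega>" if "\<omega> \<in> G" for \<omega>
    using b_nonneg[OF that] b_le_r[OF that] R_ge[OF that]
    by (auto intro!: mult_nonneg_nonneg less_imp_le[OF phase_survival_pos[OF sp[OF that]]] ws')
  have I_add: "?I \<omega> + ennreal (?c \<omega>) = ennreal (?a \<omega>)" if \<omega>: "\<omega> \<in> G" for \<omega>
    unfolding r_b[symmetric]
    by (rule post_integral[OF sp[OF \<omega>] b_nonneg[OF \<omega>] b_le_r[OF \<omega>]])
      (auto intro: ws' borel_measurable_continuous_onI)
  have I_eq: "?I \<omega> = ennreal (?a \<omega> - ?c \<omega>)" if \<omega>: "\<omega> \<in> G" for \<omega>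
  proof -
    have "?I \<omega> = ?I \<omega> + ennreal (?c \<omega>) - ennreal (?c \<omega>)"
      by (rule ennreal_add_diff_cancel_right[symmetric]) simp
    also have "\<dots> = ennreal (?a \<omega> - ?c \<omega>)"
      unfolding I_add[OF \<omega>] by (rule ennreal_minus[OF c_nonneg[OF \<omega>]])
    finally show ?thesis .
  qed
  have "(\<integral>\<^sup>+\<omega>\<in>{\<omega>\<in>G. ereal (B \<omega>) < \<tau> (Suc n) \<omega> \<and> \<tau> (Suc n) \<omega> \<le> ereal (R \<omega>)}. ?X \<omega> (waiting_time n \<omega>) (J (Suc n) \<omega>) \<partial>M)
    = (\<integral>\<^sup>+\<omega>\<in>G. ?I \<omega> \<partial>M)"
    by (intro next_event_integral[where X="?X"] G fin B R B_ge Xm)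
  also have "\<dots> = (\<integral>\<^sup>+\<omega>\<in>G. ennreal (?a \<omega> - ?c \<omega>) \<partial>M)"
  proof (intro nn_integral_cong)
    show "?I \<omega> * indicator G \<omega> = ennreal (?a \<omega> - ?c \<omega>) * indicator G \<omega>" for \<omega>
      by (cases "\<omega> \<in> G") (simp_all only: I_eq indicator_simps mult_zero_right not_False_eq_True)
  qed
  finally have first: "(\<integral>\<^sup>+\<omega>\<in>{\<omega>\<in>G. ereal (B \<omega>) < \<tau> (Suc n) \<omega> \<and> \<tau> (Suc n) \<omega> \<le> ereal (R \<omega>)}.
        ennreal (if J (Suc n) \<omega> = J n \<omega> then w (R \<omega> - real_of_ereal (\<tau> (Suc n) \<omega>)) (J (Suc n) \<omega>)
          else z (R \<omega> - real_of_ereal (\<tau> (Suc n) \<omega>)) (J (Suc n) \<omega>)) \<partial>M) = \<dots>"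
    unfolding r_w .
  have surv: "(\<integral>\<^sup>+\<omega>\<in>{\<omega>\<in>G. ereal (f \<omega>) < \<tau> (Suc n) \<omega>}. ennreal (w (R \<omega> - f \<omega>) (J n \<omega>)) \<partial>M)
      = (\<integral>\<^sup>+\<omega>\<in>G. ennreal (?s f \<omega> * w (R \<omega> - f \<omega>) (J n \<omega>)) \<partial>M)"
    if f: "f \<in> borel_measurable (history n)" and fB: "\<And>\<omega>. \<omega> \<in> G \<Longrightarrow> B \<omega> \<le> f \<omega> \<and> f \<omega> \<le> R \<omega>" for f
  proof -
    have f_ge: "\<tau> n \<omega> \<le> ereal (f \<omega>)" if "\<omega> \<in> G" for \<omega>
      using B_ge[OF that] fB[OF that] by (metis ereal_less_eq(3) order.trans)
    have "(\<integral>\<^sup>+\<omega>\<in>{\<omega>\<in>G. ereal (f \<omega>) < \<tau> (Suc n) \<omega>}. ennreal (w (R \<omega> - f \<omega>) (J n \<omega>)) \<partial>M)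
      = (\<integral>\<^sup>+\<omega>\<in>G. ennreal (?s f \<omega>) * ennreal (w (R \<omega> - f \<omega>) (J n \<omega>)) \<partial>M)"
    proof (rule survival[OF G fin f f_ge])
      show "(\<lambda>\<omega>. ennreal (w (R \<omega> - f \<omega>) (J n \<omega>))) \<in> borel_measurable (history n)"
        by (intro measurable_compose[OF wm measurable_ennreal] borel_measurable_diff R f)
      show "ennreal (w (R \<omega> - f \<omega>) (J n \<omega>)) \<le> ennreal K" if "\<omega> \<in> G" for \<omega>
        using fB[OF that] RB[OF that] by (intro ennreal_leI K) auto
    qed
    also have "\<dots> = (\<integral>\<^sup>+\<omega>\<in>G. ennreal (?s f \<omega> * w (R \<omega> - f \<omega>) (J n \<omega>)) \<partial>M)"
    proof (intro nn_integral_cong)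
      fix \<omega>
      have "ennreal (?s f \<omega>) * ennreal (w (R \<omega> - f \<omega>) (J n \<omega>)) = ennreal (?s f \<omega> * w (R \<omega> - f \<omega>) (J n \<omega>))" if "\<omega> \<in> G"
        using fB[OF that] by (intro ennreal_mult''[symmetric] ws') auto
      then show "ennreal (?s f \<omega>) * ennreal (w (R \<omega> - f \<omega>) (J n \<omega>)) * indicator G \<omega>
          = ennreal (?s f \<omega> * w (R \<omega> - f \<omega>) (J n \<omega>)) * indicator G \<omega>"
        by (auto split: split_indicator)
    qed
    finally show ?thesis .
  qed
  have am: "?a \<in> borel_measurable M" and cm: "?c \<in> borel_measurable M"
    by (intro measurable_from_subalg[OF subalgebra_history[of n]] borel_measurable_times
        phase_survival_measurable[OF elapsed_measurable] wm borel_measurable_diff R B borel_measurable_const)+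
  have "(\<integral>\<^sup>+\<omega>\<in>G. ennreal (?a \<omega> - ?c \<omega>) \<partial>M) + (\<integral>\<^sup>+\<omega>\<in>G. ennreal (?c \<omega>) \<partial>M)
    = (\<integral>\<^sup>+\<omega>. ennreal (?a \<omega> - ?c \<omega>) * indicator G \<omega> + ennreal (?c \<omega>) * indicator G \<omega> \<partial>M)"
    by (intro nn_integral_add[symmetric] borel_measurable_times_ennreal borel_measurable_indicator GM
        measurable_compose[OF _ measurable_ennreal] borel_measurable_diff am cm)
  also have "\<dots> = (\<integral>\<^sup>+\<omega>\<in>G. ennreal (?a \<omega>) \<partial>M)"
  proof (intro nn_integral_cong)
    show "ennreal (?a \<omega> - ?c \<omega>) * indicator G \<omega> + ennreal (?c \<omega>) * indicator G \<omega> = ennreal (?a \<omega>) * indicator G \<omega>" for \<omega>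
      by (cases "\<omega> \<in> G")
        (simp_all only: I_eq[symmetric] I_add indicator_simps mult_zero_right mult_1_right add_0 not_False_eq_True)
  qed
  finally have sum: "(\<integral>\<^sup>+\<omega>\<in>G. ennreal (?a \<omega> - ?c \<omega>) \<partial>M) + (\<integral>\<^sup>+\<omega>\<in>G. ennreal (?c \<omega>) \<partial>M)
    = (\<integral>\<^sup>+\<omega>\<in>G. ennreal (?a \<omega>) \<partial>M)" .
  have sB: "(\<integral>\<^sup>+\<omega>\<in>{\<omega>\<in>G. ereal (B \<omega>) < \<tau> (Suc n) \<omega>}. ennreal (w (R \<omega> - B \<omega>) (J n \<omega>)) \<partial>M) = (\<integral>\<^sup>+\<omega>\<in>G. ennreal (?a \<omega>) \<partial>M)"
    by (rule surv[OF B]) (simp add: R_ge)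
  have sR: "(\<integral>\<^sup>+\<omega>\<in>{\<omega>\<in>G. ereal (R \<omega>) < \<tau> (Suc n) \<omega>}. ennreal (w 0 (J n \<omega>)) \<partial>M) = (\<integral>\<^sup>+\<omega>\<in>G. ennreal (?c \<omega>) \<partial>M)"
    using surv[OF R] R_ge by simp
  show ?thesis unfolding first sB sR by (rule sum)
qed

section \<open>The first change of phase\<close>

lemma J_sets: "l \<le> m \<Longrightarrow> {\<omega>\<in>space M. J l \<omega> = i} \<in> sets (history m)"
  using measurable_sets[OF history_measurable(3), of l m "{i}"] by (simp add: vimage_def Int_def conj_commute)

lemma \<tau>_real_measurable: "k \<le> m \<Longrightarrow> (\<lambda>\<omega>. real_of_ereal (\<tau> k \<omega>)) \<in> borel_measurable (history m)"
  by (intro borel_measurable_real_of_ereal history_measurable(1))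

lemma \<tau>_le_sets:
  assumes "k \<le> m" "f \<in> borel_measurable (history m)"
  shows "{\<omega>\<in>space M. \<tau> k \<omega> \<le> ereal (f \<omega>)} \<in> sets (history m)"
    "{\<omega>\<in>space M. ereal (f \<omega>) < \<tau> k \<omega>} \<in> sets (history m)"
  using borel_measurable_le[OF history_measurable(1)[OF assms(1)] borel_measurable_ereal[OF assms(2)]]
    borel_measurable_less[OF borel_measurable_ereal[OF assms(2)] history_measurable(1)[OF assms(1)]]
  by simp_all

text \<open>The events do not accumulate. Therefore the remainders of the sums over all events before a deadline
  tend to zero.\<close>

lemma event_at_most_vanishes:
  assumes R: "R \<in> borel_measurable M"
  shows "(\<lambda>k. emeasure M {\<omega>\<in>space M. \<tau> (n + k) \<omega> \<le> ereal (R \<omega>)}) \<longlonglongrightarrow> 0"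
proof -
  let ?A = "\<lambda>k. {\<omega>\<in>space M. \<tau> (n + k) \<omega> \<le> ereal (R \<omega>)}"
  have A: "?A k \<in> sets M" for k using R by measurable
  have "decseq ?A"
    unfolding decseq_def
  proof (intro allI impI subsetI CollectI conjI; elim CollectE conjE)
    fix k l \<omega> assume "k \<le> l" "\<omega> \<in> space M" "\<tau> (n + l) \<omega> \<le> ereal (R \<omega>)"
    then show "\<tau> (n + k) \<omega> \<le> ereal (R \<omega>)"
      using \<tau>_mono[of \<omega> "n + k" "n + l"] by (simp add: order.trans)
  qed
  then have "(\<lambda>k. emeasure M (?A k)) \<longlonglongrightarrow> emeasure M (\<Inter>k. ?A k)"
    using A by (intro Lim_emeasure_decseq) auto
  moreover have "(\<Inter>k. ?A k) = {}"
  proof -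
    have "\<exists>k. ereal (R \<omega>) < \<tau> (n + k) \<omega>" if \<omega>: "\<omega> \<in> space M" for \<omega>
    proof -
      have "eventually (\<lambda>m. ereal (R \<omega>) < \<tau> m \<omega>) sequentially"
        using events_diverge[OF \<omega>] by (rule order_tendstoD) simp
      then obtain N where N: "\<And>m. N \<le> m \<Longrightarrow> ereal (R \<omega>) < \<tau> m \<omega>"
        by (auto simp: eventually_sequentially)
      then show ?thesis using N[of "n + N"] by (intro exI[of _ N]) simp
    qed
    then show ?thesis by (simp add: set_eq_iff not_le)
  qed
  ultimately show ?thesis by simp
qed

lemma T_row_zero: "T $ i $ i = 0 \<Longrightarrow> j \<noteq> i \<Longrightarrow> T $ i $ j = 0"
  using T_diag[of i] sum_nonneg_eq_0_iff[of "UNIV - {i}" "\<lambda>j. T $ i $ j"] T_nonneg[of i] by auto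

text \<open>The probability that a chain with generator \<open>T\<close>, started in \<open>i\<close>, leaves \<open>i\<close> by the time \<open>\<rho>\<close> and enters \<open>j'\<close> at that
  jump. If \<open>T $ i $ i = 0\<close>, the division by zero gives the right value \<open>0\<close>.\<close>

definition jump_by :: "'s \<Rightarrow> real \<Rightarrow> 's \<Rightarrow> real" where
  "jump_by j' \<rho> i = (if i = j' then 0 else T $ i $ j' / - T $ i $ i * (1 - exp (T $ i $ i * \<rho>)))"

lemma jump_by_0 [simp]: "jump_by j' 0 i = 0"
  by (simp add: jump_by_def)

text \<open>The first change of phase is rewarded with \<open>1\<close> if it leads to \<open>j'\<close> and with \<open>0\<close> otherwise.\<close>

lemma backward_solution_jump_by:
  "backward_solution (jump_by j') (\<lambda>\<rho> j. if j = j' then 1 else 0)"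
  unfolding backward_solution_def
proof (intro conjI allI impI)
  fix \<rho> :: real and j assume "0 \<le> \<rho>"
  then show "0 \<le> jump_by j' \<rho> j"
    using T_nonneg[of j j'] T_diag_nonpos[of j]
    by (auto simp: jump_by_def intro!: mult_nonneg_nonneg divide_nonneg_nonpos mult_nonpos_nonneg)
next
  fix \<rho> :: real and i
  have s: "(\<Sum>j\<in>UNIV - {i}. T $ i $ j * (if j = j' then 1 else 0)) = (if i = j' then 0 else T $ i $ j')"
    by (simp add: if_distrib cong: if_cong)
  show "((\<lambda>\<rho>. jump_by j' \<rho> i) has_real_derivative T $ i $ i * jump_by j' \<rho> i
      + (\<Sum>j\<in>UNIV - {i}. T $ i $ j * (if j = j' then 1 else 0))) (at \<rho>)"
  proof (cases "i = j' \<or> T $ i $ i = 0")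
    case True
    then have "(\<lambda>\<rho>. jump_by j' \<rho> i) = (\<lambda>\<rho>. 0)" by (auto simp: jump_by_def)
    moreover have "T $ i $ i * jump_by j' \<rho> i + (\<Sum>j\<in>UNIV - {i}. T $ i $ j * (if j = j' then 1 else 0)) = 0"
      unfolding s using True T_row_zero[of i j'] by (auto simp: jump_by_def)
    ultimately show ?thesis by (simp only: DERIV_const)
  next
    case False
    then have "(\<lambda>\<rho>. jump_by j' \<rho> i) = (\<lambda>\<rho>. T $ i $ j' / - T $ i $ i * (1 - exp (T $ i $ i * \<rho>)))"
      by (auto simp: jump_by_def)
    moreover have "((\<lambda>\<rho>. T $ i $ j' / - T $ i $ i * (1 - exp (T $ i $ i * \<rho>))) has_real_derivative
        T $ i $ j' / - T $ i $ i * (- (exp (T $ i $ i * \<rho>) * T $ i $ i))) (at \<rho>)"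
      by (auto intro!: derivative_eq_intros)
    moreover have "T $ i $ j' / - T $ i $ i * (- (exp (T $ i $ i * \<rho>) * T $ i $ i))
        = T $ i $ i * jump_by j' \<rho> i + (\<Sum>j\<in>UNIV - {i}. T $ i $ j * (if j = j' then 1 else 0))"
      unfolding s using False by (simp add: jump_by_def field_simps)
    ultimately show ?thesis by simp
  qed
qed auto

text \<open>This is \<open>(e\<^sup>T\<^sup>\<rho>)' = T e\<^sup>T\<^sup>\<rho>\<close> with the diagonal terms split off. A change of phase does not end the
  evaluation, so the same function serves as \<open>z\<close>.\<close>

lemma backward_solution_mexp: "backward_solution (\<lambda>\<rho> i. mexp (\<rho> *\<^sub>R T) $ i $ j') (\<lambda>\<rho> i. mexp (\<rho> *\<^sub>R T) $ i $ j')"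
  unfolding backward_solution_def
proof (intro conjI allI impI)
  fix \<rho> :: real and j assume "0 \<le> \<rho>"
  then show "0 \<le> mexp (\<rho> *\<^sub>R T) $ j $ j'" "0 \<le> mexp (\<rho> *\<^sub>R T) $ j $ j'"
    by (auto intro: mexp_generator_nonneg T_nonneg)
next
  fix i
  show "continuous_on UNIV (\<lambda>\<rho>. mexp (\<rho> *\<^sub>R T) $ i $ j')"
    by (rule DERIV_continuous_on, rule mexp_nth_has_derivative)
next
  fix \<rho> :: real and i
  have "(mexp (\<rho> *\<^sub>R T) ** T) $ i $ j' = (\<Sum>l\<in>UNIV. T $ i $ l * mexp (\<rho> *\<^sub>R T) $ l $ j')"
    unfolding mexp_comm[symmetric] by (simp add: matrix_matrix_mult_def)
  also have "\<dots> = T $ i $ i * mexp (\<rho> *\<^sub>R T) $ i $ j' + (\<Sum>j\<in>UNIV - {i}. T $ i $ j * mexp (\<rho> *\<^sub>R T) $ j $ j')"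
    by (rule sum.remove) auto
  finally show "((\<lambda>\<rho>. mexp (\<rho> *\<^sub>R T) $ i $ j') has_real_derivative
      T $ i $ i * mexp (\<rho> *\<^sub>R T) $ i $ j' + (\<Sum>j\<in>UNIV - {i}. T $ i $ j * mexp (\<rho> *\<^sub>R T) $ j $ j')) (at \<rho>)"
    using mexp_nth_has_derivative[of T i j' \<rho>] by simp
qed

text \<open>Only changes of level separate the \<open>n\<close>-th event from the next change of phase. With \<open>H k\<close> the event that the first \<open>k\<close> events
  after the \<open>n\<close>-th are changes of level before the deadline, \<open>C k\<close> that the one after them leads to \<open>j'\<close> in time, and \<open>e k\<close>
  the value still expected on \<open>H k\<close>, the step from \<open>k\<close> to \<open>Suc k\<close> costs \<open>e k - e (Suc k) = P(C k)\<close>.\<close>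

lemma first_phase_jump:
  assumes G: "G \<in> sets (history n)" and fin: "\<And>\<omega>. \<omega> \<in> G \<Longrightarrow> \<tau> n \<omega> < \<infinity>"
    and Ji: "\<And>\<omega>. \<omega> \<in> G \<Longrightarrow> J n \<omega> = i" and j': "j' \<noteq> i" and u: "0 \<le> u"
  shows "emeasure M {\<omega>\<in>G. \<exists>k. (\<forall>l\<in>{n..n+k}. J l \<omega> = i) \<and> J (Suc (n + k)) \<omega> = j'
            \<and> \<tau> (Suc (n + k)) \<omega> \<le> \<tau> n \<omega> + ereal u}
    = ennreal (jump_by j' u i) * emeasure M G"
proof -
  let ?E' = "{\<omega>\<in>G. \<exists>k. (\<forall>l\<in>{n..n+k}. J l \<omega> = i) \<and> J (Suc (n + k)) \<omega> = j' \<and> \<tau> (Suc (n + k)) \<omega> \<le> \<tau> n \<omega> + ereal u}"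
  let ?z = "\<lambda>\<rho> j. if j = j' then 1 else 0 :: real"
  note bs = backward_solution_jump_by[of j']
  define R where "R \<omega> = real_of_ereal (\<tau> n \<omega>) + u" for \<omega>
  define H where "H k = {\<omega>\<in>G. (\<forall>l\<in>{n..n+k}. J l \<omega> = i) \<and> \<tau> (n + k) \<omega> \<le> ereal (R \<omega>)}" for k
  define C where "C k = {\<omega>\<in>H k. J (Suc (n + k)) \<omega> = j' \<and> \<tau> (Suc (n + k)) \<omega> \<le> ereal (R \<omega>)}" for k
  define e where "e k = (\<integral>\<^sup>+\<omega>\<in>H k. ennreal (jump_by j' (R \<omega> - real_of_ereal (\<tau> (n + k) \<omega>)) i) \<partial>M)" for k
  have GM: "G \<in> sets M" using G history_subset by auto
  have sp: "\<omega> \<in> space M" if "\<omega> \<in> G" for \<omega> using that sets.sets_into_space[OF GM] by auto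
  have R: "R \<in> borel_measurable (history m)" if "n \<le> m" for m
    unfolding R_def[abs_def] by (intro borel_measurable_add \<tau>_real_measurable that) simp
  have RM: "R \<in> borel_measurable M" using R[OF order_refl] measurable_from_subalg[OF subalgebra_history] by blast
  have R_eq: "ereal (R \<omega>) = \<tau> n \<omega> + ereal u" if "\<omega> \<in> G" for \<omega>
    using \<tau>_finite_eq[OF sp fin, OF that that] unfolding R_def by (metis plus_ereal.simps(1))
  have H_sets: "H k \<in> sets (history (n + k))" for k
  proof -
    have "H k = G \<inter> (\<Inter>l\<in>{n..n+k}. {\<omega>\<in>space M. J l \<omega> = i}) \<inter> {\<omega>\<in>space M. \<tau> (n + k) \<omega> \<le> ereal (R \<omega>)}"
      using sp by (auto simp: H_def)
    also have "\<dots> \<in> sets (history (n + k))"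
      using G history_mono[of n "n + k"] by (intro sets.Int sets.finite_INT J_sets \<tau>_le_sets R) auto
    finally show ?thesis .
  qed
  have HM: "H k \<in> sets M" for k using H_sets history_subset by blast
  have HG: "\<omega> \<in> G" if "\<omega> \<in> H k" for \<omega> k using that by (simp add: H_def)
  have C_sets: "C k \<in> sets M" for k
  proof -
    have "C k = H k \<inter> {\<omega>\<in>space M. J (Suc (n + k)) \<omega> = j'} \<inter> {\<omega>\<in>space M. \<tau> (Suc (n + k)) \<omega> \<le> ereal (R \<omega>)}"
      using sp HG by (auto simp: C_def)
    also have "\<dots> \<in> sets M"
      using RM by (intro sets.Int HM) measurable
    finally show ?thesis .
  qed
  have H_fin: "\<tau> (n + k) \<omega> < \<infinity>" if "\<omega> \<in> H k" for k \<omega>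
    using that by (auto simp: H_def)
  have real_le: "real_of_ereal (\<tau> (n + k) \<omega>) \<le> R \<omega>" "\<tau> (n + k) \<omega> = ereal (real_of_ereal (\<tau> (n + k) \<omega>))" if "\<omega> \<in> H k" for k \<omega>
  proof -
    show eq: "\<tau> (n + k) \<omega> = ereal (real_of_ereal (\<tau> (n + k) \<omega>))"
      using \<tau>_finite_eq[OF sp[OF HG[OF that]] H_fin[OF that]] by simp
    have "\<tau> (n + k) \<omega> \<le> ereal (R \<omega>)" using that by (simp add: H_def)
    then show "real_of_ereal (\<tau> (n + k) \<omega>) \<le> R \<omega>" using eq by (metis ereal_less_eq(3))
  qed
  have rem_le: "R \<omega> - real_of_ereal (\<tau> (n + k) \<omega>) \<le> u" if "\<omega> \<in> H k" for k \<omega>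
  proof -
    have "ereal (real_of_ereal (\<tau> n \<omega>)) \<le> ereal (real_of_ereal (\<tau> (n + k) \<omega>))"
      using \<tau>_mono[of \<omega> n "n + k"] \<tau>_finite_eq[of \<omega> n] sp HG[OF that] fin real_le(2)[OF that] by auto
    then show ?thesis by (simp add: R_def)
  qed
  have J_H: "J (n + k) \<omega> = i" if "\<omega> \<in> H k" for k \<omega> using that by (simp add: H_def)
  have H_Suc: "\<omega> \<in> H (Suc k) \<longleftrightarrow> \<omega> \<in> H k \<and> J (Suc (n + k)) \<omega> = i \<and> \<tau> (Suc (n + k)) \<omega> \<le> ereal (R \<omega>)" for k \<omega>
  proof -
    have "{n..n + Suc k} = insert (Suc (n + k)) {n..n+k}" by auto
    then show ?thesis
      using \<tau>_mono[of \<omega> "n + k" "Suc (n + k)"] sp[of \<omega>] by (auto simp: H_def intro: order.trans)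
  qed
  have step: "emeasure M (C k) + e (Suc k) = e k" for k
  proof -
    let ?B = "\<lambda>\<omega>. real_of_ereal (\<tau> (n + k) \<omega>)"
    let ?E = "{\<omega>\<in>H k. ereal (?B \<omega>) < \<tau> (Suc (n + k)) \<omega> \<and> \<tau> (Suc (n + k)) \<omega> \<le> ereal (R \<omega>)}"
    have lt: "ereal (?B \<omega>) < \<tau> (Suc (n + k)) \<omega>" if "\<omega> \<in> H k" for \<omega>
      using event_less[OF sp[OF HG[OF that]] H_fin[OF that]] real_le(2)[OF that] by simp
    have "(\<integral>\<^sup>+\<omega>\<in>?E. ennreal (if J (Suc (n + k)) \<omega> = J (n + k) \<omega> then jump_by j' (R \<omega> - real_of_ereal (\<tau> (Suc (n + k)) \<omega>)) (J (Suc (n + k)) \<omega>)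
          else ?z (R \<omega> - real_of_ereal (\<tau> (Suc (n + k)) \<omega>)) (J (Suc (n + k)) \<omega>)) \<partial>M)
      + (\<integral>\<^sup>+\<omega>\<in>{\<omega>\<in>H k. ereal (R \<omega>) < \<tau> (Suc (n + k)) \<omega>}. ennreal (jump_by j' 0 (J (n + k) \<omega>)) \<partial>M)
      = (\<integral>\<^sup>+\<omega>\<in>{\<omega>\<in>H k. ereal (?B \<omega>) < \<tau> (Suc (n + k)) \<omega>}. ennreal (jump_by j' (R \<omega> - ?B \<omega>) (J (n + k) \<omega>)) \<partial>M)"
      by (rule next_event_step[OF bs H_sets H_fin, where U=u])
        (use real_le rem_le in \<open>auto intro: \<tau>_real_measurable R\<close>)
    also have "\<dots> = e k"
      unfolding e_def by (intro nn_integral_cong) (auto simp: lt J_H split: split_indicator)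
    also have "(\<integral>\<^sup>+\<omega>\<in>{\<omega>\<in>H k. ereal (R \<omega>) < \<tau> (Suc (n + k)) \<omega>}. ennreal (jump_by j' 0 (J (n + k) \<omega>)) \<partial>M) = 0"
      by simp
    also have "(\<integral>\<^sup>+\<omega>\<in>?E. ennreal (if J (Suc (n + k)) \<omega> = J (n + k) \<omega> then jump_by j' (R \<omega> - real_of_ereal (\<tau> (Suc (n + k)) \<omega>)) (J (Suc (n + k)) \<omega>)
          else ?z (R \<omega> - real_of_ereal (\<tau> (Suc (n + k)) \<omega>)) (J (Suc (n + k)) \<omega>)) \<partial>M)
      = (\<integral>\<^sup>+\<omega>. indicator (C k) \<omega> + ennreal (jump_by j' (R \<omega> - real_of_ereal (\<tau> (Suc (n + k)) \<omega>)) i) * indicator (H (Suc k)) \<omega> \<partial>M)"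
      using j' by (intro nn_integral_cong) (auto simp: lt J_H H_Suc C_def split: split_indicator)
    also have "\<dots> = emeasure M (C k) + e (Suc k)"
    proof -
      have "(\<lambda>\<omega>. jump_by j' (R \<omega> - real_of_ereal (\<tau> (Suc (n + k)) \<omega>)) i) \<in> borel_measurable M"
        by (rule measurable_compose[OF _ borel_measurable_continuous_onI[OF backward_solutionD(4)[OF bs]]])
          (intro borel_measurable_diff RM borel_measurable_real_of_ereal \<tau>_measurable)
      then show ?thesis
        using C_sets HM unfolding e_def by (subst nn_integral_add) auto
    qed
    finally show ?thesis by simp
  qed
  obtain K where K: "\<And>\<rho> j. 0 \<le> \<rho> \<Longrightarrow> \<rho> \<le> u \<Longrightarrow> jump_by j' \<rho> j \<le> K"
    using backward_solution_bounded[OF bs, of u] by metis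
  let ?A = "\<lambda>k. {\<omega>\<in>space M. \<tau> (n + k) \<omega> \<le> ereal (R \<omega>)}"
  have lim: "e \<longlonglongrightarrow> 0"
  proof (rule tendsto_sandwich[where f="\<lambda>_. 0" and h="\<lambda>k. ennreal K * emeasure M (?A k)"])
    have AM: "?A k \<in> sets M" for k using RM by measurable
    have "e k \<le> ennreal K * emeasure M (?A k)" for k
    proof -
      have "e k \<le> (\<integral>\<^sup>+\<omega>. ennreal K * indicator (?A k) \<omega> \<partial>M)"
        unfolding e_def
      proof (intro nn_integral_mono)
        fix \<omega>
        have "jump_by j' (R \<omega> - real_of_ereal (\<tau> (n + k) \<omega>)) i \<le> K" "\<omega> \<in> ?A k" if "\<omega> \<in> H k"
          using real_le(1)[OF that] rem_le[OF that] sp HG[OF that] that by (auto intro!: K simp: H_def)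
        then show "ennreal (jump_by j' (R \<omega> - real_of_ereal (\<tau> (n + k) \<omega>)) i) * indicator (H k) \<omega> \<le> ennreal K * indicator (?A k) \<omega>"
          by (auto split: split_indicator intro: ennreal_leI)
      qed
      then show ?thesis using AM by (simp add: nn_integral_cmult_indicator)
    qed
    then show "\<forall>\<^sub>F k in sequentially. e k \<le> ennreal K * emeasure M (?A k)" by simp
    have "(\<lambda>k. ennreal K * emeasure M (?A k)) \<longlonglongrightarrow> ennreal K * 0"
      by (intro ennreal_tendsto_cmult event_at_most_vanishes RM) simp
    then show "(\<lambda>k. ennreal K * emeasure M (?A k)) \<longlonglongrightarrow> 0" by simp
  qed auto
  have disj: "disjoint_family C"
  proof -
    have "C k \<inter> C l = {}" if "k < l" for k l
    proof -
      have "Suc (n + k) \<in> {n..n+l}" using that by auto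
      then show ?thesis using j' by (auto simp: C_def H_def)
    qed
    then show ?thesis unfolding disjoint_family_on_def by (metis inf_commute nat_neq_iff)
  qed
  have "?E' = (\<Union>k. C k)"
  proof (intro set_eqI iffI)
    fix \<omega>
    assume "\<omega> \<in> ?E'"
    then obtain k where k: "\<omega> \<in> G" "\<forall>l\<in>{n..n+k}. J l \<omega> = i" "J (Suc (n + k)) \<omega> = j'"
      "\<tau> (Suc (n + k)) \<omega> \<le> ereal (R \<omega>)" by (auto simp: R_eq)
    moreover have "\<tau> (n + k) \<omega> \<le> ereal (R \<omega>)"
      using \<tau>_mono[OF sp[OF k(1)], of "n + k" "Suc (n + k)"] k(4) by simp
    ultimately have "\<omega> \<in> C k" by (simp add: C_def H_def)
    then show "\<omega> \<in> (\<Union>k. C k)" by blast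
  next
    fix \<omega> assume "\<omega> \<in> (\<Union>k. C k)"
    then obtain k where "\<omega> \<in> C k" by blast
    then show "\<omega> \<in> ?E'"
      unfolding C_def H_def using R_eq[of \<omega>] by auto
  qed
  then have "emeasure M ?E'
      = (\<Sum>k. emeasure M (C k))"
    using C_sets disj by (simp add: suminf_emeasure image_subset_iff)
  also have "\<dots> = e 0"
    by (rule telescope_ennreal[OF step lim])
  also have "\<dots> = (\<integral>\<^sup>+\<omega>. ennreal (jump_by j' u i) * indicator G \<omega> \<partial>M)"
    unfolding e_def
  proof (intro nn_integral_cong)
    fix \<omega>
    have "\<omega> \<in> H 0 \<longleftrightarrow> \<omega> \<in> G"
      using R_eq[of \<omega>] Ji[of \<omega>] u by (auto simp: H_def ereal_le_add_self)
    then show "ennreal (jump_by j' (R \<omega> - real_of_ereal (\<tau> (n + 0) \<omega>)) i) * indicator (H 0) \<omega> = ennreal (jump_by j' u i) * indicator G \<omega>"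
      by (auto simp: R_def indicator_def)
  qed
  also have "\<dots> = ennreal (jump_by j' u i) * emeasure M G"
    using GM by (simp add: nn_integral_cmult_indicator)
  finally show ?thesis .
qed

section \<open>The Markov property of the phase\<close>

lemma phase_between_events:
  assumes "\<omega> \<in> space M" "\<tau> m \<omega> \<le> ereal t" "ereal t < \<tau> (Suc m) \<omega>"
  shows "\<phi> t \<omega> = J m \<omega>"
  using between_events[OF assms] by (auto simp: flow_def J_eq split: prod.splits)

lemma last_event_unique:
  assumes "\<omega> \<in> space M" "\<tau> m \<omega> \<le> ereal t" "ereal t < \<tau> (Suc m) \<omega>" "\<tau> l \<omega> \<le> ereal t" "ereal t < \<tau> (Suc l) \<omega>"
  shows "m = l"
proof (rule ccontr)
  assume "m \<noteq> l"
  then have "Suc m \<le> l \<or> Suc l \<le> m" by auto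
  then show False
    using \<tau>_mono[OF assms(1), of "Suc m" l] \<tau>_mono[OF assms(1), of "Suc l" m] assms(2-) by auto
qed

lemma last_event_exists:
  assumes \<omega>: "\<omega> \<in> space M" and t: "\<tau> n \<omega> \<le> ereal t"
  obtains k where "\<tau> (n + k) \<omega> \<le> ereal t" "ereal t < \<tau> (Suc (n + k)) \<omega>"
proof -
  have "eventually (\<lambda>m. ereal t < \<tau> m \<omega>) sequentially"
    using events_diverge[OF \<omega>] by (rule order_tendstoD) simp
  then obtain N where N: "\<And>m. N \<le> m \<Longrightarrow> ereal t < \<tau> m \<omega>"
    by (auto simp: eventually_sequentially)
  define k where "k = (LEAST k. ereal t < \<tau> (Suc (n + k)) \<omega>)"
  have ex: "ereal t < \<tau> (Suc (n + N)) \<omega>" by (rule N) simp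
  have 1: "ereal t < \<tau> (Suc (n + k)) \<omega>" unfolding k_def
    by (rule LeastI[of "\<lambda>k. ereal t < \<tau> (Suc (n + k)) \<omega>" N]) (rule ex)
  have 2: "\<tau> (n + k) \<omega> \<le> ereal t"
  proof (cases k)
    case 0 then show ?thesis using t by simp
  next
    case (Suc l)
    then have "\<not> ereal t < \<tau> (Suc (n + l)) \<omega>"
      using not_less_Least[of l "\<lambda>k. ereal t < \<tau> (Suc (n + k)) \<omega>"] by (simp add: k_def)
    then show ?thesis using Suc by simp
  qed
  show ?thesis by (rule that[OF 2 1])
qed

lemma \<phi>_measurable: "0 \<le> t \<Longrightarrow> \<phi> t \<in> M \<rightarrow>\<^sub>M count_space UNIV"
proof -
  assume t: "0 \<le> t"
  have "(\<lambda>\<omega>. (t, \<omega>)) \<in> M \<rightarrow>\<^sub>M restrict_space borel {0..} \<Otimes>\<^sub>M M"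
    using t by (intro measurable_Pair measurable_const measurable_ident_sets refl) (auto simp: space_restrict_space)
  from measurable_compose[OF measurable_compose[OF this process_measurable] snd_snd_measurable]
  show ?thesis by simp
qed

text \<open>The telescoping sum of the previous part, now over all events up to \<open>t'\<close> and without stopping at changes of
  phase. \<open>C k\<close> says that the \<open>(n+k)\<close>-th event is the last one up to \<open>t'\<close> and leads to \<open>j'\<close>. As no event occurs between the
  \<open>n\<close>-th one and \<open>t\<close>, the first step evaluates at \<open>t\<close> instead of \<open>\<tau> n\<close>, which is why the steps start from \<open>B\<close>.\<close>

lemma markov_at_fixed_time:
  assumes G: "G \<in> sets (history n)" and t: "0 \<le> t" "t \<le> t'"
  shows "emeasure M {\<omega>\<in>G. \<tau> n \<omega> \<le> ereal t \<and> ereal t < \<tau> (Suc n) \<omega> \<and> \<phi> t' \<omega> = j'}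
    = (\<integral>\<^sup>+\<omega>\<in>{\<omega>\<in>G. \<tau> n \<omega> \<le> ereal t \<and> ereal t < \<tau> (Suc n) \<omega>}. ennreal (mexp ((t' - t) *\<^sub>R T) $ J n \<omega> $ j') \<partial>M)"
proof -
  let ?w = "\<lambda>\<rho> i. mexp (\<rho> *\<^sub>R T) $ i $ j'"
  note bs = backward_solution_mexp[of j']
  define H where "H k = {\<omega>\<in>G. \<tau> n \<omega> \<le> ereal t \<and> (0 < k \<longrightarrow> ereal t < \<tau> (Suc n) \<omega>) \<and> \<tau> (n + k) \<omega> \<le> ereal t'}" for k
  define C where "C k = {\<omega>\<in>H k. ereal t' < \<tau> (Suc (n + k)) \<omega> \<and> J (n + k) \<omega> = j'}" for k
  define B where "B k \<omega> = max t (real_of_ereal (\<tau> (n + k) \<omega>))" for k \<omega>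
  define e where "e k = (\<integral>\<^sup>+\<omega>\<in>{\<omega>\<in>H k. ereal t < \<tau> (Suc (n + k)) \<omega>}. ennreal (?w (t' - B k \<omega>) (J (n + k) \<omega>)) \<partial>M)" for k
  have GM: "G \<in> sets M" using G history_subset by auto
  have sp: "\<omega> \<in> space M" if "\<omega> \<in> G" for \<omega> using that sets.sets_into_space[OF GM] by auto
  have HG: "\<omega> \<in> G" if "\<omega> \<in> H k" for \<omega> k using that by (simp add: H_def)
  have H_sets: "H k \<in> sets (history (n + k))" for k
  proof (cases "k = 0")
    case True
    have "H k = G \<inter> {\<omega>\<in>space M. \<tau> n \<omega> \<le> ereal t}"
      using sp t True by (auto simp: H_def intro: order.trans)
    also have "\<dots> \<in> sets (history (n + k))"
      using G True by (intro sets.Int \<tau>_le_sets(1)) auto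
    finally show ?thesis .
  next
    case False
    have "H k = G \<inter> {\<omega>\<in>space M. \<tau> n \<omega> \<le> ereal t} \<inter> {\<omega>\<in>space M. ereal t < \<tau> (Suc n) \<omega>} \<inter> {\<omega>\<in>space M. \<tau> (n + k) \<omega> \<le> ereal t'}"
      using sp False by (auto simp: H_def)
    also have "\<dots> \<in> sets (history (n + k))"
      using G history_mono[of n "n + k"] False by (intro sets.Int \<tau>_le_sets) auto
    finally show ?thesis .
  qed
  have HM: "H k \<in> sets M" for k using H_sets history_subset by blast
  have C_sets: "C k \<in> sets M" for k
  proof -
    have "C k = H k \<inter> {\<omega>\<in>space M. ereal t' < \<tau> (Suc (n + k)) \<omega>} \<inter> {\<omega>\<in>space M. J (n + k) \<omega> = j'}"
      using sp HG by (auto simp: C_def)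
    also have "\<dots> \<in> sets M" by (intro sets.Int HM) measurable
    finally show ?thesis .
  qed
  have H_fin: "\<tau> (n + k) \<omega> < \<infinity>" if "\<omega> \<in> H k" for k \<omega>
    using that by (auto simp: H_def)
  have real_eq: "\<tau> (n + k) \<omega> = ereal (real_of_ereal (\<tau> (n + k) \<omega>))" if "\<omega> \<in> H k" for k \<omega>
    using \<tau>_finite_eq[OF sp[OF HG[OF that]] H_fin[OF that]] by simp
  have B_ge: "\<tau> (n + k) \<omega> \<le> ereal (B k \<omega>)" if "\<omega> \<in> H k" for k \<omega>
    using real_eq[OF that] unfolding B_def by (metis ereal_less_eq(3) max.cobounded2)
  have B_le: "B k \<omega> \<le> t'" if "\<omega> \<in> H k" for k \<omega>
  proof -
    have "\<tau> (n + k) \<omega> \<le> ereal t'" using that by (simp add: H_def)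
    then show ?thesis using real_eq[OF that] t unfolding B_def by (metis ereal_less_eq(3) max.bounded_iff)
  qed
  have B_less: "ereal (B k \<omega>) < \<tau> (Suc (n + k)) \<omega> \<longleftrightarrow> ereal t < \<tau> (Suc (n + k)) \<omega>" if "\<omega> \<in> H k" for k \<omega>
  proof -
    have lt: "ereal (real_of_ereal (\<tau> (n + k) \<omega>)) < \<tau> (Suc (n + k)) \<omega>"
      using event_less[OF sp[OF HG[OF that]] H_fin[OF that]] real_eq[OF that] by simp
    show ?thesis
    proof (cases "t \<le> real_of_ereal (\<tau> (n + k) \<omega>)")
      case True
      then have "ereal t < \<tau> (Suc (n + k)) \<omega>" using lt by (metis ereal_less_eq(3) order.strict_trans1)
      then show ?thesis using lt True by (simp add: B_def max_def)
    next
      case False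
      then show ?thesis by (simp add: B_def max_def)
    qed
  qed
  have H_Suc: "\<omega> \<in> H (Suc k) \<longleftrightarrow> \<omega> \<in> H k \<and> ereal t < \<tau> (Suc (n + k)) \<omega> \<and> \<tau> (Suc (n + k)) \<omega> \<le> ereal t'" for k \<omega>
    using \<tau>_mono[of \<omega> "n + k" "Suc (n + k)"] \<tau>_mono[of \<omega> "Suc n" "Suc (n + k)"] sp[of \<omega>]
    by (cases "k = 0") (auto simp: H_def intro: order.trans order.strict_trans2)
  have H_Suc_less: "{\<omega>\<in>H (Suc k). ereal t < \<tau> (Suc (n + Suc k)) \<omega>} = H (Suc k)" for k
    using \<tau>_mono[of _ "Suc (n + k)" "Suc (n + Suc k)"] sp HG H_Suc by (force intro: order.strict_trans2)
  have B_Suc: "B (Suc k) \<omega> = real_of_ereal (\<tau> (Suc (n + k)) \<omega>)" if "\<omega> \<in> H (Suc k)" for k \<omega>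
  proof -
    have "ereal t < ereal (real_of_ereal (\<tau> (n + Suc k) \<omega>))"
      using that H_Suc[of \<omega> k] real_eq[OF that] by simp
    then show ?thesis by (simp add: B_def)
  qed
  have B_meas: "B k \<in> borel_measurable (history (n + k))" for k
    unfolding B_def[abs_def] by (intro borel_measurable_max \<tau>_real_measurable) auto
  have Jm: "(\<lambda>\<omega>. ?w (f \<omega>) (J m \<omega>)) \<in> borel_measurable M" if "f \<in> borel_measurable M" for f m
    by (rule measurable_compose_countable[OF measurable_compose[OF that borel_measurable_continuous_onI[OF backward_solutionD(4)[OF bs]]] J_measurable])
  have BM: "B k \<in> borel_measurable M" for k
    by (rule measurable_from_subalg[OF subalgebra_history B_meas])
  have step: "emeasure M (C k) + e (Suc k) = e k" for k
  proof -
    let ?E = "{\<omega>\<in>H k. ereal (B k \<omega>) < \<tau> (Suc (n + k)) \<omega> \<and> \<tau> (Suc (n + k)) \<omega> \<le> ereal t'}"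
    let ?r = "\<lambda>\<omega>. t' - real_of_ereal (\<tau> (Suc (n + k)) \<omega>)"
    have "(\<integral>\<^sup>+\<omega>\<in>?E. ennreal (if J (Suc (n + k)) \<omega> = J (n + k) \<omega> then ?w (?r \<omega>) (J (Suc (n + k)) \<omega>)
          else ?w (?r \<omega>) (J (Suc (n + k)) \<omega>)) \<partial>M)
      + (\<integral>\<^sup>+\<omega>\<in>{\<omega>\<in>H k. ereal t' < \<tau> (Suc (n + k)) \<omega>}. ennreal (?w 0 (J (n + k) \<omega>)) \<partial>M)
      = (\<integral>\<^sup>+\<omega>\<in>{\<omega>\<in>H k. ereal (B k \<omega>) < \<tau> (Suc (n + k)) \<omega>}. ennreal (?w (t' - B k \<omega>) (J (n + k) \<omega>)) \<partial>M)"
      by (rule next_event_step[where R="\<lambda>_. t'" and U="t' - t", OF bs H_sets H_fin B_meas B_ge _ B_le])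
        (auto simp: B_def)
    also have "{\<omega>\<in>H k. ereal (B k \<omega>) < \<tau> (Suc (n + k)) \<omega>} = {\<omega>\<in>H k. ereal t < \<tau> (Suc (n + k)) \<omega>}"
      using B_less by blast
    also have "?E = H (Suc k)"
      using B_less H_Suc by blast
    also have "(\<integral>\<^sup>+\<omega>\<in>H (Suc k). ennreal (if J (Suc (n + k)) \<omega> = J (n + k) \<omega> then ?w (?r \<omega>) (J (Suc (n + k)) \<omega>)
          else ?w (?r \<omega>) (J (Suc (n + k)) \<omega>)) \<partial>M) = e (Suc k)"
      unfolding e_def H_Suc_less by (intro nn_integral_cong) (auto simp: B_Suc split: split_indicator)
    also have "(\<integral>\<^sup>+\<omega>\<in>{\<omega>\<in>H k. ereal t' < \<tau> (Suc (n + k)) \<omega>}. ennreal (?w 0 (J (n + k) \<omega>)) \<partial>M)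
        = (\<integral>\<^sup>+\<omega>. indicator (C k) \<omega> \<partial>M)"
      by (intro nn_integral_cong) (auto simp: C_def mat_def split: split_indicator)
    finally show ?thesis using C_sets[of k] by (simp add: e_def add.commute)
  qed
  obtain K where K: "\<And>\<rho> j. 0 \<le> \<rho> \<Longrightarrow> \<rho> \<le> t' - t \<Longrightarrow> ?w \<rho> j \<le> K"
    using backward_solution_bounded[OF bs, of "t' - t"] by metis
  let ?A = "\<lambda>k. {\<omega>\<in>space M. \<tau> (n + k) \<omega> \<le> ereal t'}"
  have lim: "e \<longlonglongrightarrow> 0"
  proof (rule tendsto_sandwich[where f="\<lambda>_. 0" and h="\<lambda>k. ennreal K * emeasure M (?A k)"])
    have AM: "?A k \<in> sets M" for k by measurable
    have "e k \<le> ennreal K * emeasure M (?A k)" for k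
    proof -
      have "e k \<le> (\<integral>\<^sup>+\<omega>. ennreal K * indicator (?A k) \<omega> \<partial>M)"
        unfolding e_def
      proof (intro nn_integral_mono)
        fix \<omega>
        have "?w (t' - B k \<omega>) (J (n + k) \<omega>) \<le> K" "\<omega> \<in> ?A k" if "\<omega> \<in> H k"
          using B_le[OF that] sp HG[OF that] that by (auto intro!: K simp: H_def B_def)
        then show "ennreal (?w (t' - B k \<omega>) (J (n + k) \<omega>)) * indicator {\<omega>\<in>H k. ereal t < \<tau> (Suc (n + k)) \<omega>} \<omega> \<le> ennreal K * indicator (?A k) \<omega>"
          by (auto split: split_indicator intro: ennreal_leI)
      qed
      then show ?thesis using AM by (simp add: nn_integral_cmult_indicator)
    qed
    then show "\<forall>\<^sub>F k in sequentially. e k \<le> ennreal K * emeasure M (?A k)" by simp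
    have "(\<lambda>k. ennreal K * emeasure M (?A k)) \<longlonglongrightarrow> ennreal K * 0"
      by (intro ennreal_tendsto_cmult event_at_most_vanishes) simp_all
    then show "(\<lambda>k. ennreal K * emeasure M (?A k)) \<longlonglongrightarrow> 0" by simp
  qed auto
  have disj: "disjoint_family C"
    unfolding disjoint_family_on_def
  proof (intro ballI impI)
    fix k l :: nat assume "k \<noteq> l"
    show "C k \<inter> C l = {}"
    proof (rule ccontr)
      assume "C k \<inter> C l \<noteq> {}"
      then obtain \<omega> where "\<omega> \<in> C k" "\<omega> \<in> C l" by blast
      then have "n + k = n + l"
        using sp by (intro last_event_unique[of \<omega> "n + k" t' "n + l"]) (simp_all add: C_def H_def)
      then show False using \<open>k \<noteq> l\<close> by simp
    qed
  qed
  have "{\<omega>\<in>G. \<tau> n \<omega> \<le> ereal t \<and> ereal t < \<tau> (Suc n) \<omega> \<and> \<phi> t' \<omega> = j'} = (\<Union>k. C k) \<inter> {\<omega>\<in>G. ereal t < \<tau> (Suc n) \<omega>}"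
  proof (intro set_eqI iffI)
    fix \<omega> assume \<omega>: "\<omega> \<in> {\<omega>\<in>G. \<tau> n \<omega> \<le> ereal t \<and> ereal t < \<tau> (Suc n) \<omega> \<and> \<phi> t' \<omega> = j'}"
    then have "\<tau> n \<omega> \<le> ereal t'" using t by (simp add: order.trans[of _ "ereal t"])
    then obtain k where k: "\<tau> (n + k) \<omega> \<le> ereal t'" "ereal t' < \<tau> (Suc (n + k)) \<omega>"
      using last_event_exists[of \<omega> n t'] sp \<omega> by blast
    then have "J (n + k) \<omega> = j'" using phase_between_events[OF _ k] sp \<omega> by auto
    then have "\<omega> \<in> C k" using k \<omega> by (simp add: C_def H_def)
    then show "\<omega> \<in> (\<Union>k. C k) \<inter> {\<omega>\<in>G. ereal t < \<tau> (Suc n) \<omega>}" using \<omega> by blast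
  next
    fix \<omega> assume "\<omega> \<in> (\<Union>k. C k) \<inter> {\<omega>\<in>G. ereal t < \<tau> (Suc n) \<omega>}"
    then obtain k where k: "\<omega> \<in> C k" "\<omega> \<in> G" "ereal t < \<tau> (Suc n) \<omega>" by blast
    then show "\<omega> \<in> {\<omega>\<in>G. \<tau> n \<omega> \<le> ereal t \<and> ereal t < \<tau> (Suc n) \<omega> \<and> \<phi> t' \<omega> = j'}"
      using phase_between_events[of \<omega> "n + k" t'] sp[OF k(2)] by (simp add: C_def H_def)
  qed
  also have "\<dots> = (\<Union>k. C k)"
  proof -
    have "ereal t < \<tau> (Suc n) \<omega>" if "\<omega> \<in> C k" for \<omega> k
    proof (cases "k = 0")
      case True
      then have "ereal t' < \<tau> (Suc n) \<omega>" using that by (simp add: C_def)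
      then show ?thesis using t by (metis ereal_less_eq(3) order.strict_trans1)
    next
      case False
      then show ?thesis using that by (simp add: C_def H_def)
    qed
    moreover have "\<omega> \<in> G" if "\<omega> \<in> C k" for \<omega> k using that by (simp add: C_def H_def)
    ultimately show ?thesis by blast
  qed
  also have "emeasure M \<dots> = (\<Sum>k. emeasure M (C k))"
    using C_sets disj by (simp add: suminf_emeasure image_subset_iff)
  also have "\<dots> = e 0"
    by (rule telescope_ennreal[OF step lim])
  also have "\<dots> = (\<integral>\<^sup>+\<omega>\<in>{\<omega>\<in>G. \<tau> n \<omega> \<le> ereal t \<and> ereal t < \<tau> (Suc n) \<omega>}. ennreal (?w (t' - t) (J n \<omega>)) \<partial>M)"
    unfolding e_def
  proof (intro nn_integral_cong)
    fix \<omega>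
    have H0: "\<omega> \<in> H 0 \<longleftrightarrow> \<omega> \<in> G \<and> \<tau> n \<omega> \<le> ereal t"
      using t by (auto simp: H_def order.trans[of _ "ereal t" "ereal t'"])
    have "B 0 \<omega> = t" if "\<omega> \<in> H 0"
    proof -
      have "ereal (real_of_ereal (\<tau> n \<omega>)) \<le> ereal t" using real_eq[OF that] that H0 by simp
      then show ?thesis by (simp add: B_def)
    qed
    then show "ennreal (?w (t' - B 0 \<omega>) (J (n + 0) \<omega>)) * indicator {\<omega>\<in>H 0. ereal t < \<tau> (Suc (n + 0)) \<omega>} \<omega>
      = ennreal (?w (t' - t) (J n \<omega>)) * indicator {\<omega>\<in>G. \<tau> n \<omega> \<le> ereal t \<and> ereal t < \<tau> (Suc n) \<omega>} \<omega>"
      using H0 by (auto simp: indicator_def)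
  qed
  finally show ?thesis .
qed

text \<open>The sample space is split by the number \<open>m\<close> of the last event up to \<open>ts n\<close>. On each piece, the phases at
  the times up to \<open>ts n\<close> are determined by the history of the first \<open>m\<close> events, so that the Markov property at the
  fixed time \<open>ts n\<close> applies.\<close>

lemma phase_transition:
  fixes ts :: "nat \<Rightarrow> real"
  assumes t0: "0 \<le> ts 0" and mono: "\<And>k. k \<le> n \<Longrightarrow> ts k \<le> ts (Suc k)"
  shows "\<P>(\<omega> in M. \<forall>k\<le>Suc n. \<phi> (ts k) \<omega> = js k) =
          \<P>(\<omega> in M. \<forall>k\<le>n. \<phi> (ts k) \<omega> = js k) * mexp ((ts (Suc n) - ts n) *\<^sub>R T) $ js n $ js (Suc n)"
proof -
  let ?p = "mexp ((ts (Suc n) - ts n) *\<^sub>R T) $ js n $ js (Suc n)"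
  let ?Q = "{\<omega>\<in>space M. \<forall>k\<le>n. \<phi> (ts k) \<omega> = js k}"
  let ?Q' = "{\<omega>\<in>space M. \<forall>k\<le>Suc n. \<phi> (ts k) \<omega> = js k}"
  let ?I = "\<lambda>m. {\<omega>\<in>space M. \<tau> m \<omega> \<le> ereal (ts n) \<and> ereal (ts n) < \<tau> (Suc m) \<omega>}"
  have ts_le: "ts k \<le> ts n" if "k \<le> n" for k
    using that
  proof (induct rule: inc_induct)
    case (step m)
    then show ?case using mono[of m] by simp
  qed simp
  have ts_nonneg: "0 \<le> ts k" if "k \<le> Suc n" for k
    using that
  proof (induction k)
    case (Suc k)
    then show ?case using mono[of k] by simp
  qed (simp add: t0)
  have p: "0 \<le> ?p" using mono by (intro mexp_generator_nonneg T_nonneg) auto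
  have Q_sets: "?Q \<in> sets M" "?Q' \<in> sets M"
  proof -
    have "{\<omega>\<in>space M. \<forall>k\<in>{..m}. \<phi> (ts k) \<omega> = js k} \<in> sets M" if "m \<le> Suc n" for m
    proof (intro sets.sets_Collect_finite_All')
      fix k assume "k \<in> {..m}"
      then have "\<phi> (ts k) -` {js k} \<inter> space M \<in> sets M"
        using that by (intro measurable_sets[OF \<phi>_measurable] ts_nonneg) auto
      then show "{\<omega>\<in>space M. \<phi> (ts k) \<omega> = js k} \<in> sets M" by (simp add: vimage_def Int_def conj_commute)
    qed auto
    note * = this
    have "?Q = {\<omega>\<in>space M. \<forall>k\<in>{..n}. \<phi> (ts k) \<omega> = js k}" "?Q' = {\<omega>\<in>space M. \<forall>k\<in>{..Suc n}. \<phi> (ts k) \<omega> = js k}"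
      by (simp_all only: Ball_def atMost_iff)
    then show "?Q \<in> sets M" "?Q' \<in> sets M" using *[of n] *[of "Suc n"] by simp_all
  qed
  have I_sets: "?I m \<in> sets M" for m by measurable
  have I_disj: "disjoint_family ?I"
    unfolding disjoint_family_on_def
  proof (intro ballI impI)
    fix k l :: nat assume "k \<noteq> l"
    show "?I k \<inter> ?I l = {}"
    proof (rule ccontr)
      assume "?I k \<inter> ?I l \<noteq> {}"
      then obtain \<omega> where "\<omega> \<in> ?I k" "\<omega> \<in> ?I l" by blast
      then have "k = l" by (intro last_event_unique[of \<omega> k "ts n" l]) simp_all
      then show False using \<open>k \<noteq> l\<close> by simp
    qed
  qed
  have I_UN: "(\<Union>m. ?I m) = space M"
  proof -
    have "\<exists>m. \<omega> \<in> ?I m" if \<omega>: "\<omega> \<in> space M" for \<omega>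
      using last_event_exists[OF \<omega>, of 0 "ts n"] event_0[OF \<omega>] ts_nonneg[of n] \<omega> by auto
    then show ?thesis by blast
  qed
  have split: "emeasure M X = (\<Sum>m. emeasure M (X \<inter> ?I m))" if X: "X \<in> sets M" for X
  proof -
    have "(\<Sum>m. emeasure M (X \<inter> ?I m)) = emeasure M (\<Union>m. X \<inter> ?I m)"
    proof (rule suminf_emeasure)
      show "range (\<lambda>m. X \<inter> ?I m) \<subseteq> sets M" using X I_sets by (auto intro: sets.Int)
      show "disjoint_family (\<lambda>m. X \<inter> ?I m)" using I_disj unfolding disjoint_family_on_def by blast
    qed
    also have "(\<Union>m. X \<inter> ?I m) = X" using I_UN sets.sets_into_space[OF X] by blast
    finally show ?thesis by simp
  qed
  have piece: "emeasure M (?Q' \<inter> ?I m) = ennreal ?p * emeasure M (?Q \<inter> ?I m)" for m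
  proof -
    \<comment> \<open>The end of the interval after the \<open>m\<close>-th event is not part of the history and is left out of \<open>V k m\<close>;
      on \<open>?I m\<close> it exceeds \<open>ts k\<close> anyway.\<close>
    define V where "V k l = {\<omega>\<in>space M. \<tau> l \<omega> \<le> ereal (ts k) \<and> (l = m \<or> ereal (ts k) < \<tau> (Suc l) \<omega>) \<and> J l \<omega> = js k}" for k l
    define G where "G = space M \<inter> (\<Inter>k\<in>{..n}. \<Union>l\<in>{..m}. V k l)"
    have G: "G \<in> sets (history m)"
      unfolding G_def
    proof (intro sets.Int sets.finite_INT sets.finite_UN)
      show "space M \<in> sets (history m)" using sets.top[of "history m"] by simp
      fix k l assume l: "l \<in> {..m}"
      show "V k l \<in> sets (history m)"
      proof (cases "l = m")
        case True
        then have "V k l = {\<omega>\<in>space M. \<tau> l \<omega> \<le> ereal (ts k)} \<inter> {\<omega>\<in>space M. J l \<omega> = js k}"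
          by (auto simp: V_def)
        then show ?thesis using l by (auto intro!: sets.Int \<tau>_le_sets J_sets)
      next
        case False
        then have "V k l = {\<omega>\<in>space M. \<tau> l \<omega> \<le> ereal (ts k)} \<inter> {\<omega>\<in>space M. ereal (ts k) < \<tau> (Suc l) \<omega>} \<inter> {\<omega>\<in>space M. J l \<omega> = js k}"
          by (auto simp: V_def)
        then show ?thesis using l False by (auto intro!: sets.Int \<tau>_le_sets J_sets)
      qed
    qed auto
    have GQ: "\<omega> \<in> G \<longleftrightarrow> \<omega> \<in> ?Q" if \<omega>: "\<omega> \<in> ?I m" for \<omega>
    proof -
      have sp: "\<omega> \<in> space M" using \<omega> by simp
      have "(\<exists>l\<in>{..m}. \<tau> l \<omega> \<le> ereal (ts k) \<and> (l = m \<or> ereal (ts k) < \<tau> (Suc l) \<omega>) \<and> J l \<omega> = js k) \<longleftrightarrow> \<phi> (ts k) \<omega> = js k"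
        if k: "k \<le> n" for k
      proof -
        have m: "ereal (ts k) < \<tau> (Suc m) \<omega>"
          using \<omega> ts_le[OF k] order.strict_trans1[of "ereal (ts k)" "ereal (ts n)" "\<tau> (Suc m) \<omega>"] by simp
        obtain l where l: "\<tau> l \<omega> \<le> ereal (ts k)" "ereal (ts k) < \<tau> (Suc l) \<omega>"
          using last_event_exists[OF sp, of 0 "ts k"] event_0[OF sp] ts_nonneg[of k] k by auto
        have "l \<le> m"
        proof (rule ccontr)
          assume "\<not> l \<le> m"
          then have "\<tau> (Suc m) \<omega> \<le> \<tau> l \<omega>" using \<tau>_mono[OF sp] by simp
          then show False using l(1) m by auto
        qed
        moreover have "l' = l" if "\<tau> l' \<omega> \<le> ereal (ts k)" "l' = m \<or> ereal (ts k) < \<tau> (Suc l') \<omega>" for l'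
          using last_event_unique[OF sp that(1) _ l] that(2) m by blast
        moreover have "\<phi> (ts k) \<omega> = J l \<omega>" by (rule phase_between_events[OF sp l])
        ultimately show ?thesis using l by (metis atMost_iff)
      qed
      then have "(\<forall>k\<le>n. \<exists>l\<in>{..m}. \<tau> l \<omega> \<le> ereal (ts k) \<and> (l = m \<or> ereal (ts k) < \<tau> (Suc l) \<omega>) \<and> J l \<omega> = js k)
          \<longleftrightarrow> (\<forall>k\<le>n. \<phi> (ts k) \<omega> = js k)" by blast
      moreover have "\<omega> \<in> G \<longleftrightarrow> (\<forall>k\<le>n. \<exists>l\<in>{..m}. \<omega> \<in> V k l)"
        using sp by (auto simp: G_def)
      moreover have "\<omega> \<in> V k l \<longleftrightarrow> \<tau> l \<omega> \<le> ereal (ts k) \<and> (l = m \<or> ereal (ts k) < \<tau> (Suc l) \<omega>) \<and> J l \<omega> = js k" for k l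
        using sp by (simp add: V_def)
      ultimately show ?thesis using sp by simp
    qed
    have "?Q' \<inter> ?I m = {\<omega>\<in>G. \<tau> m \<omega> \<le> ereal (ts n) \<and> ereal (ts n) < \<tau> (Suc m) \<omega> \<and> \<phi> (ts (Suc n)) \<omega> = js (Suc n)}"
    proof -
      have "\<omega> \<in> ?Q' \<longleftrightarrow> \<omega> \<in> ?Q \<and> \<phi> (ts (Suc n)) \<omega> = js (Suc n)" for \<omega>
        by (auto simp: le_Suc_eq)
      moreover have "G \<subseteq> space M" by (auto simp: G_def)
      ultimately show ?thesis using GQ by blast
    qed
    also have "emeasure M \<dots> = (\<integral>\<^sup>+\<omega>\<in>{\<omega>\<in>G. \<tau> m \<omega> \<le> ereal (ts n) \<and> ereal (ts n) < \<tau> (Suc m) \<omega>}.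
        ennreal (mexp ((ts (Suc n) - ts n) *\<^sub>R T) $ J m \<omega> $ js (Suc n)) \<partial>M)"
      using mono by (intro markov_at_fixed_time G ts_nonneg) auto
    also have "{\<omega>\<in>G. \<tau> m \<omega> \<le> ereal (ts n) \<and> ereal (ts n) < \<tau> (Suc m) \<omega>} = ?Q \<inter> ?I m"
    proof -
      have "G \<subseteq> space M" by (auto simp: G_def)
      then show ?thesis using GQ by blast
    qed
    also have "(\<integral>\<^sup>+\<omega>\<in>?Q \<inter> ?I m. ennreal (mexp ((ts (Suc n) - ts n) *\<^sub>R T) $ J m \<omega> $ js (Suc n)) \<partial>M)
        = (\<integral>\<^sup>+\<omega>. ennreal ?p * indicator (?Q \<inter> ?I m) \<omega> \<partial>M)"
    proof (intro nn_integral_cong)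
      fix \<omega>
      have "J m \<omega> = js n" if "\<omega> \<in> ?Q \<inter> ?I m"
        using that phase_between_events[of \<omega> m "ts n"] by auto
      then show "ennreal (mexp ((ts (Suc n) - ts n) *\<^sub>R T) $ J m \<omega> $ js (Suc n)) * indicator (?Q \<inter> ?I m) \<omega>
          = ennreal ?p * indicator (?Q \<inter> ?I m) \<omega>"
        by (auto split: split_indicator)
    qed
    also have "\<dots> = ennreal ?p * emeasure M (?Q \<inter> ?I m)"
      by (intro nn_integral_cmult_indicator sets.Int Q_sets I_sets)
    finally show ?thesis .
  qed
  have "emeasure M ?Q' = ennreal ?p * emeasure M ?Q"
    unfolding split[OF Q_sets(2)] split[OF Q_sets(1)] piece by (simp add: ennreal_suminf_cmult)
  then have "ennreal (measure M ?Q') = ennreal (?p * measure M ?Q)"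
    using p by (simp add: emeasure_eq_measure ennreal_mult)
  then show ?thesis using p by (simp add: mult.commute)
qed

section \<open>Jump times of the phase\<close>

lemma phase_ctmc: "ctmc M \<phi> T"
proof
  show "generator_matrix T" by (rule generator)
  show "\<phi> t \<in> M \<rightarrow>\<^sub>M count_space UNIV" if "0 \<le> t" for t using that by (rule \<phi>_measurable)
  show "\<P>(\<omega> in M. \<forall>k\<le>Suc n. \<phi> (ts k) \<omega> = js k) =
          \<P>(\<omega> in M. \<forall>k\<le>n. \<phi> (ts k) \<omega> = js k) * mexp ((ts (Suc n) - ts n) *\<^sub>R T) $ js n $ js (Suc n)"
    if "0 \<le> ts 0" "\<And>k. k \<le> n \<Longrightarrow> ts k \<le> ts (Suc k)" for n :: nat and ts js
    using that by (rule phase_transition)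
qed

text \<open>The \<open>n\<close>-th event is the \<open>k\<close>-th jump of the phase (the start counts as jump \<open>0\<close>). Changes of level come in
  between, so the index is random; \<open>n\<close> being the index of a jump is nevertheless an event of the history.\<close>

primrec phase_jump_index :: "nat \<Rightarrow> nat \<Rightarrow> 'w \<Rightarrow> bool" where
  "phase_jump_index 0 n \<omega> \<longleftrightarrow> n = 0"
| "phase_jump_index (Suc k) m \<omega> \<longleftrightarrow> \<tau> m \<omega> < \<infinity> \<and>
     (\<exists>n<m. phase_jump_index k n \<omega> \<and> (\<forall>l\<in>{n..<m}. J l \<omega> = J n \<omega>) \<and> J m \<omega> \<noteq> J n \<omega>)"

lemma phase_jump_index_finite: "\<omega> \<in> space M \<Longrightarrow> phase_jump_index k n \<omega> \<Longrightarrow> \<tau> n \<omega> < \<infinity>"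
proof (cases k)
  case 0
  then show "phase_jump_index k n \<omega> \<Longrightarrow> \<omega> \<in> space M \<Longrightarrow> \<tau> n \<omega> < \<infinity>" by (simp add: event_0)
next
  case (Suc l)
  then show "phase_jump_index k n \<omega> \<Longrightarrow> \<omega> \<in> space M \<Longrightarrow> \<tau> n \<omega> < \<infinity>"
    by (simp only: phase_jump_index.simps)
qed

lemma phase_jump_index_sets: "{\<omega>\<in>space M. phase_jump_index k n \<omega>} \<in> sets (history n)"
proof (induction k arbitrary: n)
  case 0
  show ?case using sets.top[of "history n"] by (cases "n = 0") simp_all
next
  case (Suc k)
  have "{\<omega>\<in>space M. phase_jump_index (Suc k) n \<omega>} = {\<omega>\<in>space M. \<tau> n \<omega> < \<infinity>} \<inter>
     (\<Union>m\<in>{..<n}. \<Union>i. {\<omega>\<in>space M. phase_jump_index k m \<omega>} \<inter> (\<Inter>l\<in>{m..<n}. {\<omega>\<in>space M. J l \<omega> = i}) \<inter> (space M - {\<omega>\<in>space M. J n \<omega> = i}))"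
    (is "_ = _ \<inter> (\<Union>m\<in>{..<n}. \<Union>i. ?A m i)")
  proof -
    have "\<omega> \<in> (\<Union>m\<in>{..<n}. \<Union>i. ?A m i) \<longleftrightarrow> \<omega> \<in> space M \<and> (\<exists>m<n. phase_jump_index k m \<omega> \<and> (\<forall>l\<in>{m..<n}. J l \<omega> = J m \<omega>) \<and> J n \<omega> \<noteq> J m \<omega>)" for \<omega>
    proof
      assume "\<omega> \<in> (\<Union>m\<in>{..<n}. \<Union>i. ?A m i)"
      then obtain m i where m: "m < n" "\<omega> \<in> ?A m i" by blast
      then have "J m \<omega> = i" by auto
      with m show "\<omega> \<in> space M \<and> (\<exists>m<n. phase_jump_index k m \<omega> \<and> (\<forall>l\<in>{m..<n}. J l \<omega> = J m \<omega>) \<and> J n \<omega> \<noteq> J m \<omega>)"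
        by (intro conjI exI[of _ m]) auto
    next
      assume "\<omega> \<in> space M \<and> (\<exists>m<n. phase_jump_index k m \<omega> \<and> (\<forall>l\<in>{m..<n}. J l \<omega> = J m \<omega>) \<and> J n \<omega> \<noteq> J m \<omega>)"
      then obtain m where "m < n" "\<omega> \<in> ?A m (J m \<omega>)" by auto
      then show "\<omega> \<in> (\<Union>m\<in>{..<n}. \<Union>i. ?A m i)" by blast
    qed
    note UN_iff' = this
    show ?thesis
      by (intro set_eqI) (simp only: Int_iff UN_iff' mem_Collect_eq phase_jump_index.simps, blast)
  qed
  also have "\<dots> \<in> sets (history n)"
  proof (intro sets.Int sets.finite_UN sets.Diff sets.finite_INT)
    have "\<tau> n -` {..<\<infinity>} \<inter> space (history n) \<in> sets (history n)"
      by (rule measurable_sets[OF history_measurable(1)[OF order_refl]]) simp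
    then show "{\<omega>\<in>space M. \<tau> n \<omega> < \<infinity>} \<in> sets (history n)"
      by (simp add: vimage_def Int_def conj_commute)
    show "space M \<in> sets (history n)" using sets.top[of "history n"] by simp
    show "{\<omega>\<in>space M. phase_jump_index k m \<omega>} \<in> sets (history n)" if "m \<in> {..<n}" for m
      using Suc[of m] history_mono[of m n] that by auto
  qed (auto intro!: J_sets)
  finally show ?case .
qed

abbreviation \<Theta> :: "nat \<Rightarrow> 'w \<Rightarrow> ereal" where
  "\<Theta> \<equiv> process_jump_time \<phi>"

text \<open>The phase is constant between events. So the infimum in the definition of the jump times, if finite, is attained at
  the first event after the \<open>n\<close>-th with a phase other than \<open>J n\<close>.\<close>

lemma next_jump_time:
  assumes \<omega>: "\<omega> \<in> space M" and n: "\<tau> n \<omega> < \<infinity>" and k: "\<Theta> k \<omega> = \<tau> n \<omega>"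
  shows "n < m \<Longrightarrow> \<tau> m \<omega> < \<infinity> \<Longrightarrow> (\<forall>l\<in>{n..<m}. J l \<omega> = J n \<omega>) \<Longrightarrow> J m \<omega> \<noteq> J n \<omega> \<Longrightarrow> \<Theta> (Suc k) \<omega> = \<tau> m \<omega>"
    and "\<Theta> (Suc k) \<omega> < \<infinity> \<Longrightarrow> \<exists>m>n. \<tau> m \<omega> < \<infinity> \<and> (\<forall>l\<in>{n..<m}. J l \<omega> = J n \<omega>) \<and> J m \<omega> \<noteq> J n \<omega>"
proof -
  define S where "S = {ereal s | s. \<tau> n \<omega> < ereal s \<and> \<phi> s \<omega> \<noteq> J n \<omega>}"
  have Inf: "\<Theta> (Suc k) \<omega> = Inf S"
    using k unfolding process_jump_time_def S_def by (simp add: J_def)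
  have S_ev: "\<exists>l>n. \<tau> l \<omega> \<le> x \<and> \<tau> l \<omega> < \<infinity> \<and> J l \<omega> \<noteq> J n \<omega>" if x: "x \<in> S" for x
  proof -
    obtain s where s: "x = ereal s" "\<tau> n \<omega> < ereal s" "\<phi> s \<omega> \<noteq> J n \<omega>" using x by (auto simp: S_def)
    obtain l where l: "\<tau> (n + l) \<omega> \<le> ereal s" "ereal s < \<tau> (Suc (n + l)) \<omega>"
      by (rule last_event_exists[OF \<omega> less_imp_le[OF s(2)]])
    have "J (n + l) \<omega> \<noteq> J n \<omega>" using phase_between_events[OF \<omega> l] s by simp
    moreover from this have "0 < l" by (cases l) auto
    moreover have "\<tau> (n + l) \<omega> < \<infinity>" using l(1) by auto
    ultimately show ?thesis using l s(1) by (intro exI[of _ "n + l"]) simp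
  qed
  show "\<Theta> (Suc k) \<omega> = \<tau> m \<omega>"
    if m: "n < m" "\<tau> m \<omega> < \<infinity>" "\<forall>l\<in>{n..<m}. J l \<omega> = J n \<omega>" "J m \<omega> \<noteq> J n \<omega>"
    unfolding Inf
  proof (rule antisym)
    have "\<tau> m \<omega> \<in> S"
    proof -
      have "\<phi> (real_of_ereal (\<tau> m \<omega>)) \<omega> \<noteq> J n \<omega>" using m(4) by (simp only: J_def not_False_eq_True)
      moreover have "\<tau> n \<omega> < ereal (real_of_ereal (\<tau> m \<omega>))"
        using \<tau>_strict[OF \<omega> m(1) n] by (simp only: \<tau>_finite_eq[OF \<omega> m(2)])
      ultimately show ?thesis
        unfolding S_def using \<tau>_finite_eq[OF \<omega> m(2)] by (metis (mono_tags, lifting) mem_Collect_eq)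
    qed
    then show "Inf S \<le> \<tau> m \<omega>" by (rule Inf_lower)
    show "\<tau> m \<omega> \<le> Inf S"
    proof (rule Inf_greatest)
      fix x assume "x \<in> S"
      then obtain l where l: "n < l" "\<tau> l \<omega> \<le> x" "J l \<omega> \<noteq> J n \<omega>" using S_ev by blast
      then have "m \<le> l" using m(3) by (metis atLeastLessThan_iff less_imp_le not_le)
      then show "\<tau> m \<omega> \<le> x" using \<tau>_mono[OF \<omega>, of m l] l(2) by simp
    qed
  qed
  show "\<exists>m>n. \<tau> m \<omega> < \<infinity> \<and> (\<forall>l\<in>{n..<m}. J l \<omega> = J n \<omega>) \<and> J m \<omega> \<noteq> J n \<omega>" if fin: "\<Theta> (Suc k) \<omega> < \<infinity>"
  proof -
    have "S \<noteq> {}" using fin unfolding Inf by (auto simp: top_ereal_def)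
    then obtain x where "x \<in> S" by blast
    then obtain l where l: "n < l" "\<tau> l \<omega> < \<infinity>" "J l \<omega> \<noteq> J n \<omega>" using S_ev by blast
    define m where "m = (LEAST l. n < l \<and> J l \<omega> \<noteq> J n \<omega>)"
    have m: "n < m \<and> J m \<omega> \<noteq> J n \<omega>"
      unfolding m_def by (rule LeastI[of "\<lambda>l. n < l \<and> J l \<omega> \<noteq> J n \<omega>" l]) (use l in simp)
    have "m \<le> l" unfolding m_def by (rule Least_le) (use l in simp)
    then have "\<tau> m \<omega> < \<infinity>" using \<tau>_mono[OF \<omega>, of m l] l(2) by (auto intro: order.strict_trans1)
    moreover have "J l' \<omega> = J n \<omega>" if "l' \<in> {n..<m}" for l'
      using not_less_Least[of l' "\<lambda>l. n < l \<and> J l \<omega> \<noteq> J n \<omega>"] that unfolding m_def[symmetric]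
      by (cases "l' = n") auto
    ultimately show ?thesis using m by blast
  qed
qed

lemma jump_time_event:
  assumes \<omega>: "\<omega> \<in> space M"
  shows "phase_jump_index k n \<omega> \<Longrightarrow> \<Theta> k \<omega> = \<tau> n \<omega>"
    and "\<Theta> k \<omega> < \<infinity> \<Longrightarrow> \<exists>n. phase_jump_index k n \<omega>"
proof (induction k arbitrary: n)
  case 0
  {
    case 1
    then show ?case by (simp add: process_jump_time_def event_0[OF \<omega>])
  next
    case 2
    then show ?case by simp
  }
next
  case (Suc k)
  {
    case 1
    then obtain l where l: "l < n" "phase_jump_index k l \<omega>" "\<forall>x\<in>{l..<n}. J x \<omega> = J l \<omega>" "J n \<omega> \<noteq> J l \<omega>" "\<tau> n \<omega> < \<infinity>"
      unfolding phase_jump_index.simps by blast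
    show ?case
      by (rule next_jump_time(1)[OF \<omega> phase_jump_index_finite[OF \<omega> l(2)] Suc(1)[OF l(2)] l(1,5,3,4)])
  next
    case 2
    have "\<Theta> k \<omega> < \<infinity>"
    proof (rule ccontr)
      assume "\<not> \<Theta> k \<omega> < \<infinity>"
      then show False using 2 by (simp add: process_jump_time_def top_ereal_def)
    qed
    then obtain n where n: "phase_jump_index k n \<omega>" using Suc(2) by blast
    obtain m where "m > n" "\<tau> m \<omega> < \<infinity>" "\<forall>l\<in>{n..<m}. J l \<omega> = J n \<omega>" "J m \<omega> \<noteq> J n \<omega>"
      using next_jump_time(2)[OF \<omega> phase_jump_index_finite[OF \<omega> n] Suc(1)[OF n] 2] by blast
    then show ?case using n unfolding phase_jump_index.simps by blast
  }
qed

lemma phase_jump_index_unique: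
  assumes "\<omega> \<in> space M" "phase_jump_index k n \<omega>" "phase_jump_index k m \<omega>"
  shows "n = m"
proof (rule ccontr)
  assume "n \<noteq> m"
  moreover have "\<tau> n \<omega> = \<tau> m \<omega>" using jump_time_event(1)[OF assms(1)] assms(2,3) by metis
  ultimately show False
    using \<tau>_strict[OF assms(1), of n m] \<tau>_strict[OF assms(1), of m n] phase_jump_index_finite[OF assms(1)] assms(2,3)
    by (metis less_irrefl nat_neq_iff)
qed

lemma jump_time_measurable [measurable]: "\<Theta> k \<in> borel_measurable M"
proof -
  have eq: "\<Theta> k \<omega> = (INF n. if phase_jump_index k n \<omega> then \<tau> n \<omega> else \<infinity>)" if \<omega>: "\<omega> \<in> space M" for \<omega>
  proof (cases "\<Theta> k \<omega> < \<infinity>")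
    case True
    from jump_time_event(2)[OF \<omega> True] obtain n where n: "phase_jump_index k n \<omega>" ..
    show ?thesis
    proof (rule antisym)
      show "\<Theta> k \<omega> \<le> (INF n. if phase_jump_index k n \<omega> then \<tau> n \<omega> else \<infinity>)"
        by (rule INF_greatest) (simp add: jump_time_event(1)[OF \<omega>])
      show "(INF n. if phase_jump_index k n \<omega> then \<tau> n \<omega> else \<infinity>) \<le> \<Theta> k \<omega>"
        using n jump_time_event(1)[OF \<omega> n] by (intro INF_lower2[of n]) auto
    qed
  next
    case False
    have "\<not> phase_jump_index k n \<omega>" for n
    proof
      assume n: "phase_jump_index k n \<omega>"
      show False using False phase_jump_index_finite[OF \<omega> n] by (simp add: jump_time_event(1)[OF \<omega> n])
    qed
    then show ?thesis using False by (simp add: top_ereal_def)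
  qed
  have "(\<lambda>\<omega>. INF n. if phase_jump_index k n \<omega> then \<tau> n \<omega> else \<infinity>) \<in> borel_measurable M"
    using phase_jump_index_sets history_subset
    by (intro borel_measurable_INF measurable_If \<tau>_measurable measurable_const) auto
  then show ?thesis by (simp add: eq cong: measurable_cong)
qed

lemma phase_at_jump_time:
  assumes "\<omega> \<in> space M" "phase_jump_index k n \<omega>"
  shows "\<phi> (real_of_ereal (\<Theta> k \<omega>)) \<omega> = J n \<omega>"
  unfolding jump_time_event(1)[OF assms] J_def by (rule refl)

section \<open>Holding times\<close>

definition at_jump :: "nat \<Rightarrow> 's \<Rightarrow> 'w set" where
  "at_jump k j = {\<omega>\<in>space M. \<Theta> k \<omega> < \<infinity> \<and> \<phi> (real_of_ereal (\<Theta> k \<omega>)) \<omega> = j}"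

lemma at_jump_index: "\<omega> \<in> at_jump k j \<longleftrightarrow> \<omega> \<in> space M \<and> (\<exists>n. phase_jump_index k n \<omega> \<and> J n \<omega> = j)"
proof
  assume "\<omega> \<in> at_jump k j"
  then have sp: "\<omega> \<in> space M" and fin: "\<Theta> k \<omega> < \<infinity>" and ph: "\<phi> (real_of_ereal (\<Theta> k \<omega>)) \<omega> = j"
    by (auto simp: at_jump_def)
  from jump_time_event(2)[OF sp fin] obtain n where n: "phase_jump_index k n \<omega>" ..
  then have "J n \<omega> = j" using phase_at_jump_time[OF sp n] ph by simp
  then show "\<omega> \<in> space M \<and> (\<exists>n. phase_jump_index k n \<omega> \<and> J n \<omega> = j)" using sp n by blast
next
  assume "\<omega> \<in> space M \<and> (\<exists>n. phase_jump_index k n \<omega> \<and> J n \<omega> = j)"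
  then obtain n where sp: "\<omega> \<in> space M" and n: "phase_jump_index k n \<omega>" "J n \<omega> = j" by blast
  have "\<Theta> k \<omega> < \<infinity>"
    unfolding jump_time_event(1)[OF sp n(1)] by (rule phase_jump_index_finite[OF sp n(1)])
  then show "\<omega> \<in> at_jump k j"
    using sp phase_at_jump_time[OF sp n(1)] n(2) by (simp add: at_jump_def)
qed

lemma at_jump_sets [measurable]: "at_jump k j \<in> sets M"
proof -
  have "at_jump k j = (\<Union>n. {\<omega>\<in>space M. phase_jump_index k n \<omega>} \<inter> {\<omega>\<in>space M. J n \<omega> = j})"
    by (auto simp: at_jump_index)
  moreover have "{\<omega>\<in>space M. phase_jump_index k n \<omega>} \<inter> {\<omega>\<in>space M. J n \<omega> = j} \<in> sets M" for n
    using phase_jump_index_sets[of k n] J_sets[OF order_refl, of n j] history_subset[of n]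
    by (intro sets.Int) (erule (1) subsetD[rotated])+
  ultimately show ?thesis by (simp only:) (intro sets.countable_UN image_subsetI)
qed

text \<open>On the piece where the \<open>n\<close>-th event is the \<open>k\<close>-th jump of the phase, which belongs to the history, the next
  jump is the first change of phase after the \<open>n\<close>-th event.\<close>

lemma next_jump_law:
  assumes j': "j' \<noteq> j" and u: "0 \<le> u"
  shows "measure M {\<omega>\<in>at_jump k j. \<omega> \<in> at_jump (Suc k) j' \<and> \<Theta> (Suc k) \<omega> \<le> \<Theta> k \<omega> + ereal u}
    = jump_by j' u j * measure M (at_jump k j)"
proof -
  define G where "G n = {\<omega>\<in>space M. phase_jump_index k n \<omega>} \<inter> {\<omega>\<in>space M. J n \<omega> = j}" for n
  define F where "F n = {\<omega>\<in>G n. \<exists>l. (\<forall>x\<in>{n..n+l}. J x \<omega> = j) \<and> J (Suc (n + l)) \<omega> = j'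
            \<and> \<tau> (Suc (n + l)) \<omega> \<le> \<tau> n \<omega> + ereal u}" for n
  let ?E = "{\<omega>\<in>at_jump k j. \<omega> \<in> at_jump (Suc k) j' \<and> \<Theta> (Suc k) \<omega> \<le> \<Theta> k \<omega> + ereal u}"
  have G: "G n \<in> sets (history n)" for n
    unfolding G_def by (intro sets.Int phase_jump_index_sets J_sets order_refl)
  have GM: "G n \<in> sets M" for n using G history_subset by blast
  have G_disj: "disjoint_family G"
    unfolding disjoint_family_on_def G_def using phase_jump_index_unique by blast
  have UN_G: "(\<Union>n. G n) = at_jump k j"
    by (auto simp: G_def at_jump_index)
  have E: "?E \<in> sets M"
  proof -
    have "?E = at_jump k j \<inter> at_jump (Suc k) j' \<inter> {\<omega>\<in>space M. \<Theta> (Suc k) \<omega> \<le> \<Theta> k \<omega> + ereal u}"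
      by (auto simp: at_jump_def)
    also have "\<dots> \<in> sets M" by measurable
    finally show ?thesis .
  qed
  have EG: "?E \<inter> G n = F n" for n
  proof (intro set_eqI iffI)
    fix \<omega> assume \<omega>: "\<omega> \<in> ?E \<inter> G n"
    then have sp: "\<omega> \<in> space M" and n: "phase_jump_index k n \<omega>" "J n \<omega> = j" by (auto simp: G_def)
    obtain m where m: "phase_jump_index (Suc k) m \<omega>" "J m \<omega> = j'" using \<omega> unfolding at_jump_index by blast
    then obtain n' where n': "n' < m" "phase_jump_index k n' \<omega>" "\<forall>l\<in>{n'..<m}. J l \<omega> = J n' \<omega>"
      unfolding phase_jump_index.simps by blast
    have "n' = n" using phase_jump_index_unique[OF sp n'(2) n(1)] .
    define l where "l = m - Suc n"
    have ml: "m = Suc (n + l)" using n' \<open>n' = n\<close> by (simp add: l_def)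
    have "\<tau> m \<omega> \<le> \<tau> n \<omega> + ereal u"
      using \<omega> jump_time_event(1)[OF sp m(1)] jump_time_event(1)[OF sp n(1)] by simp
    moreover have "\<forall>x\<in>{n..n+l}. J x \<omega> = j"
    proof
      fix x assume "x \<in> {n..n+l}"
      then have "x \<in> {n'..<m}" using ml \<open>n' = n\<close> by simp
      then have "J x \<omega> = J n' \<omega>" using n'(3) by blast
      then show "J x \<omega> = j" using n(2) \<open>n' = n\<close> by (simp only:)
    qed
    moreover have "\<omega> \<in> G n" using \<omega> by blast
    ultimately show "\<omega> \<in> F n"
      using m(2) unfolding F_def ml by blast
  next
    fix \<omega> assume "\<omega> \<in> F n"
    then obtain l where l: "\<omega> \<in> G n" "\<forall>x\<in>{n..n+l}. J x \<omega> = j" "J (Suc (n + l)) \<omega> = j'" "\<tau> (Suc (n + l)) \<omega> \<le> \<tau> n \<omega> + ereal u"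
      by (auto simp: F_def)
    then have sp: "\<omega> \<in> space M" and n: "phase_jump_index k n \<omega>" "J n \<omega> = j" by (auto simp: G_def)
    have fin: "\<tau> n \<omega> < \<infinity>" by (rule phase_jump_index_finite[OF sp n(1)])
    then have fin': "\<tau> (Suc (n + l)) \<omega> < \<infinity>" using l(4) by (auto intro: order.strict_trans1)
    have idx: "phase_jump_index (Suc k) (Suc (n + l)) \<omega>"
    proof -
      have "\<forall>x\<in>{n..<Suc (n + l)}. J x \<omega> = J n \<omega>"
        using l(2) unfolding n(2) by (simp only: atLeastLessThanSuc_atLeastAtMost)
      moreover have "J (Suc (n + l)) \<omega> \<noteq> J n \<omega>" using j' l(3) n(2) by simp
      moreover have "n < Suc (n + l)" by simp
      ultimately show ?thesis unfolding phase_jump_index.simps using fin' n(1) by blast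
    qed
    have "\<omega> \<in> at_jump k j" "\<omega> \<in> at_jump (Suc k) j'"
      unfolding at_jump_index using sp n idx l(3) by blast+
    moreover have "\<Theta> (Suc k) \<omega> \<le> \<Theta> k \<omega> + ereal u"
      using jump_time_event(1)[OF sp idx] jump_time_event(1)[OF sp n(1)] l(4) by simp
    ultimately show "\<omega> \<in> ?E \<inter> G n" using l(1) by simp
  qed
  have "emeasure M (F n) = ennreal (jump_by j' u j) * emeasure M (G n)" for n
    unfolding F_def
  proof (rule first_phase_jump[OF G _ _ j' u])
    fix \<omega> assume "\<omega> \<in> G n"
    then have sp: "\<omega> \<in> space M" and n: "phase_jump_index k n \<omega>" "J n \<omega> = j" by (auto simp: G_def)
    show "\<tau> n \<omega> < \<infinity>" by (rule phase_jump_index_finite[OF sp n(1)])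
    show "J n \<omega> = j" by (rule n(2))
  qed
  then have FG: "emeasure M (?E \<inter> G n) = ennreal (jump_by j' u j) * emeasure M (G n)" for n
    by (simp only: EG)
  have "emeasure M ?E = emeasure M (\<Union>n. ?E \<inter> G n)"
    using UN_G by (intro arg_cong[where f="emeasure M"]) blast
  also have "\<dots> = (\<Sum>n. emeasure M (?E \<inter> G n))"
  proof (rule suminf_emeasure[symmetric])
    show "range (\<lambda>n. ?E \<inter> G n) \<subseteq> sets M" using E GM by blast
    show "disjoint_family (\<lambda>n. ?E \<inter> G n)" using G_disj unfolding disjoint_family_on_def by blast
  qed
  also have "\<dots> = ennreal (jump_by j' u j) * (\<Sum>n. emeasure M (G n))"
    by (simp only: FG ennreal_suminf_cmult)
  also have "(\<Sum>n. emeasure M (G n)) = emeasure M (at_jump k j)"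
    unfolding UN_G[symmetric] using GM G_disj by (intro suminf_emeasure) auto
  finally show ?thesis
    using backward_solutionD(1)[OF backward_solution_jump_by u, of j' j]
    by (simp add: emeasure_eq_measure flip: ennreal_mult)
qed

lemma jump_time_nonneg:
  assumes sp: "\<omega> \<in> space M"
  shows "0 \<le> \<Theta> k \<omega>"
proof (cases "\<Theta> k \<omega> < \<infinity>")
  case True
  from jump_time_event(2)[OF sp True] obtain n where "phase_jump_index k n \<omega>" ..
  then show ?thesis using \<tau>_nonneg[OF sp] by (simp add: jump_time_event(1)[OF sp])
qed simp

lemma phase_at_jump_measurable: "(\<lambda>\<omega>. \<phi> (real_of_ereal (\<Theta> k \<omega>)) \<omega>) \<in> M \<rightarrow>\<^sub>M count_space UNIV"
proof -
  have "(\<lambda>\<omega>. (real_of_ereal (\<Theta> k \<omega>), \<omega>)) \<in> M \<rightarrow>\<^sub>M restrict_space borel {0..} \<Otimes>\<^sub>M M"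
    by (intro measurable_Pair measurable_restrict_space2 borel_measurable_real_of_ereal jump_time_measurable)
      (auto simp: real_of_ereal_pos jump_time_nonneg)
  from measurable_compose[OF measurable_compose[OF this process_measurable] snd_snd_measurable]
  show ?thesis by simp
qed

lemma jump_by_sum:
  "(\<Sum>j'\<in>UNIV - {j}. jump_by j' u j) = (if T $ j $ j = 0 then 0 else 1 - exp (T $ j $ j * u))"
proof -
  have "(\<Sum>j'\<in>UNIV - {j}. jump_by j' u j) = (\<Sum>j'\<in>UNIV - {j}. T $ j $ j' * ((1 - exp (T $ j $ j * u)) / - T $ j $ j))"
    by (intro sum.cong) (auto simp: jump_by_def)
  also have "\<dots> = - T $ j $ j * ((1 - exp (T $ j $ j * u)) / - T $ j $ j)"
    by (simp only: sum_distrib_right[symmetric] T_diag)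
  finally show ?thesis by auto
qed

lemma next_jump_other_phase:
  assumes "\<omega> \<in> at_jump k j" "\<Theta> (Suc k) \<omega> < \<infinity>"
  obtains j' where "j' \<noteq> j" "\<omega> \<in> at_jump (Suc k) j'"
proof -
  from assms(1) have sp: "\<omega> \<in> space M" by (simp add: at_jump_def)
  from assms(1) obtain n where n: "phase_jump_index k n \<omega>" "J n \<omega> = j" unfolding at_jump_index by blast
  from jump_time_event(2)[OF sp assms(2)] obtain m where m: "phase_jump_index (Suc k) m \<omega>" ..
  then obtain n' where n': "phase_jump_index k n' \<omega>" "J m \<omega> \<noteq> J n' \<omega>" unfolding phase_jump_index.simps by blast
  have "n' = n" by (rule phase_jump_index_unique[OF sp n'(1) n(1)])
  show ?thesis
  proof (rule that)
    show "J m \<omega> \<noteq> j" using n'(2) n(2) \<open>n' = n\<close> by simp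
    show "\<omega> \<in> at_jump (Suc k) (J m \<omega>)" unfolding at_jump_index using sp m by blast
  qed
qed

text \<open>The joint law of holding time and next phase, summed over the next phase.\<close>

lemma holding_time_law:
  assumes u: "0 \<le> u"
  shows "measure M {\<omega>\<in>at_jump k j. \<Theta> (Suc k) \<omega> \<le> \<Theta> k \<omega> + ereal u}
    = (if T $ j $ j = 0 then 0 else 1 - exp (T $ j $ j * u)) * measure M (at_jump k j)"
proof -
  let ?F = "\<lambda>j'. {\<omega>\<in>at_jump k j. \<omega> \<in> at_jump (Suc k) j' \<and> \<Theta> (Suc k) \<omega> \<le> \<Theta> k \<omega> + ereal u}"
  have F: "?F j' \<in> sets M" for j'
  proof -
    have "?F j' = at_jump k j \<inter> at_jump (Suc k) j' \<inter> {\<omega>\<in>space M. \<Theta> (Suc k) \<omega> \<le> \<Theta> k \<omega> + ereal u}"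
      by (auto simp: at_jump_def)
    also have "\<dots> \<in> sets M" by measurable
    finally show ?thesis .
  qed
  have "{\<omega>\<in>at_jump k j. \<Theta> (Suc k) \<omega> \<le> \<Theta> k \<omega> + ereal u} = (\<Union>j'\<in>UNIV - {j}. ?F j')"
  proof (intro set_eqI iffI)
    fix \<omega> assume \<omega>: "\<omega> \<in> {\<omega>\<in>at_jump k j. \<Theta> (Suc k) \<omega> \<le> \<Theta> k \<omega> + ereal u}"
    have "\<Theta> k \<omega> + ereal u < \<infinity>" using \<omega> by (auto simp: at_jump_def)
    then have "\<Theta> (Suc k) \<omega> < \<infinity>" using \<omega> by (auto intro: order.strict_trans1)
    then obtain j' where "j' \<noteq> j" "\<omega> \<in> at_jump (Suc k) j'" using next_jump_other_phase[of \<omega> k j] \<omega> by blast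
    then show "\<omega> \<in> (\<Union>j'\<in>UNIV - {j}. ?F j')" using \<omega> by blast
  qed blast
  also have "measure M \<dots> = (\<Sum>j'\<in>UNIV - {j}. measure M (?F j'))"
    using F by (intro finite_measure_finite_Union) (auto simp: disjoint_family_on_def at_jump_def)
  also have "\<dots> = (\<Sum>j'\<in>UNIV - {j}. jump_by j' u j * measure M (at_jump k j))"
    using u by (intro sum.cong refl next_jump_law) auto
  also have "\<dots> = (if T $ j $ j = 0 then 0 else 1 - exp (T $ j $ j * u)) * measure M (at_jump k j)"
    by (simp only: sum_distrib_right[symmetric] jump_by_sum)
  finally show ?thesis .
qed

lemma incseq_jump_deadline: "X \<subseteq> at_jump k j \<Longrightarrow> incseq (\<lambda>u. {\<omega>\<in>X. \<Theta> (Suc k) \<omega> \<le> \<Theta> k \<omega> + ereal (real u)})"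
  unfolding incseq_def
proof (intro allI impI subsetI)
  fix u v :: nat and \<omega> assume "u \<le> v" "\<omega> \<in> {\<omega>\<in>X. \<Theta> (Suc k) \<omega> \<le> \<Theta> k \<omega> + ereal (real u)}"
  moreover have "\<Theta> k \<omega> + ereal (real u) \<le> \<Theta> k \<omega> + ereal (real v)"
    using \<open>u \<le> v\<close> by (intro add_left_mono) simp
  ultimately show "\<omega> \<in> {\<omega>\<in>X. \<Theta> (Suc k) \<omega> \<le> \<Theta> k \<omega> + ereal (real v)}"
    by (auto intro: order.trans)
qed

lemma UN_jump_deadline:
  assumes X: "X \<subseteq> at_jump k j"
  shows "(\<Union>u. {\<omega>\<in>X. \<Theta> (Suc k) \<omega> \<le> \<Theta> k \<omega> + ereal (real u)}) = {\<omega>\<in>X. \<Theta> (Suc k) \<omega> < \<infinity>}"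
proof (intro set_eqI iffI)
  fix \<omega> assume "\<omega> \<in> (\<Union>u. {\<omega>\<in>X. \<Theta> (Suc k) \<omega> \<le> \<Theta> k \<omega> + ereal (real u)})"
  then obtain u where u: "\<omega> \<in> X" "\<Theta> (Suc k) \<omega> \<le> \<Theta> k \<omega> + ereal (real u)" by blast
  have "\<Theta> k \<omega> + ereal (real u) < \<infinity>" using u X by (auto simp: at_jump_def)
  then show "\<omega> \<in> {\<omega>\<in>X. \<Theta> (Suc k) \<omega> < \<infinity>}" using u by (auto intro: order.strict_trans1)
next
  fix \<omega> assume \<omega>: "\<omega> \<in> {\<omega>\<in>X. \<Theta> (Suc k) \<omega> < \<infinity>}"
  then have sp: "\<omega> \<in> space M" and fin: "\<Theta> k \<omega> < \<infinity>" "\<Theta> (Suc k) \<omega> < \<infinity>"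
    using X by (auto simp: at_jump_def)
  note nonneg = jump_time_nonneg[OF sp]
  obtain x where x: "\<Theta> k \<omega> = ereal x" using fin(1) nonneg[of k] by (cases "\<Theta> k \<omega>") auto
  obtain y where y: "\<Theta> (Suc k) \<omega> = ereal y" using fin(2) nonneg[of "Suc k"] by (cases "\<Theta> (Suc k) \<omega>") auto
  obtain u where "y - x \<le> real u" using real_arch_simple by blast
  then have "\<Theta> (Suc k) \<omega> \<le> \<Theta> k \<omega> + ereal (real u)" by (simp add: x y)
  then show "\<omega> \<in> (\<Union>u. {\<omega>\<in>X. \<Theta> (Suc k) \<omega> \<le> \<Theta> k \<omega> + ereal (real u)})" using \<omega> by blast
qed

text \<open>Letting the deadline grow turns the laws up to a deadline into those of the next phase and of the
  existence of a next jump.\<close>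

lemma jump_deadline_limit:
  assumes X: "X \<subseteq> at_jump k j" "X \<in> sets M"
  shows "(\<lambda>u. measure M {\<omega>\<in>X. \<Theta> (Suc k) \<omega> \<le> \<Theta> k \<omega> + ereal (real u)}) \<longlonglongrightarrow> measure M {\<omega>\<in>X. \<Theta> (Suc k) \<omega> < \<infinity>}"
proof -
  have "{\<omega>\<in>X. \<Theta> (Suc k) \<omega> \<le> \<Theta> k \<omega> + ereal (real u)} \<in> sets M" for u
  proof -
    have "{\<omega>\<in>X. \<Theta> (Suc k) \<omega> \<le> \<Theta> k \<omega> + ereal (real u)} = X \<inter> {\<omega>\<in>space M. \<Theta> (Suc k) \<omega> \<le> \<Theta> k \<omega> + ereal (real u)}"
      using sets.sets_into_space[OF X(2)] by blast
    also have "\<dots> \<in> sets M" by (intro sets.Int X(2)) measurable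
    finally show ?thesis .
  qed
  then show ?thesis
    unfolding UN_jump_deadline[OF X(1), symmetric]
    by (intro finite_Lim_measure_incseq incseq_jump_deadline[OF X(1)]) auto
qed

lemma exp_rate_tendsto_0: "T $ j $ j \<noteq> 0 \<Longrightarrow> (\<lambda>u. exp (T $ j $ j * real u)) \<longlonglongrightarrow> 0"
proof -
  assume "T $ j $ j \<noteq> 0"
  then have "T $ j $ j < 0" using T_diag_nonpos[of j] by simp
  then show ?thesis by real_asymp
qed

lemma next_jump_almost_surely:
  "measure M {\<omega>\<in>at_jump k j. \<Theta> (Suc k) \<omega> < \<infinity>} = (if T $ j $ j = 0 then 0 else measure M (at_jump k j))"
proof (rule LIMSEQ_unique[OF jump_deadline_limit[OF subset_refl at_jump_sets]])
  have "(\<lambda>u. (if T $ j $ j = 0 then 0 else 1 - exp (T $ j $ j * real u)) * measure M (at_jump k j))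
      \<longlonglongrightarrow> (if T $ j $ j = 0 then 0 else 1 - 0) * measure M (at_jump k j)"
  proof (cases "T $ j $ j = 0")
    case False
    then have "(\<lambda>u. (1 - exp (T $ j $ j * real u)) * measure M (at_jump k j)) \<longlonglongrightarrow> (1 - 0) * measure M (at_jump k j)"
      by (intro tendsto_mult tendsto_diff tendsto_const exp_rate_tendsto_0)
    then show ?thesis using False by simp
  qed simp
  then show "(\<lambda>u. measure M {\<omega>\<in>at_jump k j. \<Theta> (Suc k) \<omega> \<le> \<Theta> k \<omega> + ereal (real u)})
      \<longlonglongrightarrow> (if T $ j $ j = 0 then 0 else measure M (at_jump k j))"
    by (cases "T $ j $ j = 0") (simp_all add: holding_time_law)
qed

lemma next_phase_law:
  assumes j': "j' \<noteq> j" and Tj: "T $ j $ j \<noteq> 0"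
  shows "measure M (at_jump k j \<inter> at_jump (Suc k) j') = T $ j $ j' / \<bar>T $ j $ j\<bar> * measure M (at_jump k j)"
proof -
  let ?X = "at_jump k j \<inter> at_jump (Suc k) j'"
  have "(\<lambda>u. measure M {\<omega>\<in>?X. \<Theta> (Suc k) \<omega> \<le> \<Theta> k \<omega> + ereal (real u)}) \<longlonglongrightarrow> measure M {\<omega>\<in>?X. \<Theta> (Suc k) \<omega> < \<infinity>}"
    by (intro jump_deadline_limit sets.Int at_jump_sets) blast
  moreover have "{\<omega>\<in>?X. \<Theta> (Suc k) \<omega> < \<infinity>} = ?X" by (auto simp: at_jump_def)
  moreover have "measure M {\<omega>\<in>?X. \<Theta> (Suc k) \<omega> \<le> \<Theta> k \<omega> + ereal (real u)}
      = T $ j $ j' / - T $ j $ j * (1 - exp (T $ j $ j * real u)) * measure M (at_jump k j)" for u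
    using next_jump_law[OF j', of "real u" k] j' by (simp add: jump_by_def Int_def conj_assoc)
  moreover have "(\<lambda>u. T $ j $ j' / - T $ j $ j * (1 - exp (T $ j $ j * real u)) * measure M (at_jump k j))
      \<longlonglongrightarrow> T $ j $ j' / - T $ j $ j * (1 - 0) * measure M (at_jump k j)"
    by (intro tendsto_intros exp_rate_tendsto_0 Tj)
  ultimately have "measure M ?X = T $ j $ j' / - T $ j $ j * (1 - 0) * measure M (at_jump k j)"
    using LIMSEQ_unique by (simp only:) blast
  then show ?thesis using T_diag_nonpos[of j] by simp
qed

lemma conditional_holding_law:
  assumes E: "measure M (at_jump k j) > 0"
  shows "T $ j $ j = 0 \<Longrightarrow> AE \<omega> in uniform_measure M (at_jump k j). \<Theta> (Suc k) \<omega> = \<infinity>"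
    and "T $ j $ j \<noteq> 0 \<Longrightarrow> AE \<omega> in uniform_measure M (at_jump k j). \<Theta> (Suc k) \<omega> < \<infinity>"
    and "T $ j $ j \<noteq> 0 \<Longrightarrow> distributed (uniform_measure M (at_jump k j)) lborel
           (\<lambda>\<omega>. real_of_ereal (\<Theta> (Suc k) \<omega> - \<Theta> k \<omega>)) (exponential_density \<bar>T $ j $ j\<bar>)"
    and "T $ j $ j \<noteq> 0 \<Longrightarrow> j' \<noteq> j \<Longrightarrow>
           \<P>(\<omega> in uniform_measure M (at_jump k j). \<phi> (real_of_ereal (\<Theta> (Suc k) \<omega>)) \<omega> = j') = T $ j $ j' / \<bar>T $ j $ j\<bar>"
proof -
  let ?E = "at_jump k j" and ?U = "uniform_measure M (at_jump k j)"
  have E0: "emeasure M ?E \<noteq> 0" using E by (simp add: emeasure_eq_measure)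
  interpret U: prob_space ?U
    by (intro prob_space_uniform_measure E0) (simp add: emeasure_eq_measure)
  have mU: "measure ?U X = measure M (?E \<inter> X) / measure M ?E" if "X \<in> sets M" for X
    using that E0 by (intro measure_uniform_measure) auto
  have fin_sets: "{\<omega>\<in>space M. \<Theta> (Suc k) \<omega> < \<infinity>} \<in> sets M" by measurable
  have fin: "measure ?U {\<omega>\<in>space M. \<Theta> (Suc k) \<omega> < \<infinity>} = (if T $ j $ j = 0 then 0 else 1)"
  proof -
    have "?E \<inter> {\<omega>\<in>space M. \<Theta> (Suc k) \<omega> < \<infinity>} = {\<omega>\<in>?E. \<Theta> (Suc k) \<omega> < \<infinity>}" by (auto simp: at_jump_def)
    then show ?thesis unfolding mU[OF fin_sets] using E next_jump_almost_surely[of k j] by simp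
  qed
  show "AE \<omega> in ?U. \<Theta> (Suc k) \<omega> = \<infinity>" if "T $ j $ j = 0"
  proof -
    have "AE \<omega> in ?U. \<not> \<Theta> (Suc k) \<omega> < \<infinity>"
      using fin fin_sets that by (subst U.prob_Collect_eq_0[symmetric]) simp_all
    then show ?thesis by simp
  qed
  show AE_fin: "AE \<omega> in ?U. \<Theta> (Suc k) \<omega> < \<infinity>" if "T $ j $ j \<noteq> 0"
    using fin fin_sets that by (subst U.prob_Collect_eq_1[symmetric]) simp_all
  have meas: "(\<lambda>\<omega>. real_of_ereal (\<Theta> (Suc k) \<omega> - \<Theta> k \<omega>)) \<in> borel_measurable M" by measurable
  show "distributed ?U lborel (\<lambda>\<omega>. real_of_ereal (\<Theta> (Suc k) \<omega> - \<Theta> k \<omega>)) (exponential_density \<bar>T $ j $ j\<bar>)"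
    if Tj: "T $ j $ j \<noteq> 0"
  proof (subst U.exponential_distributed_iff, goal_cases)
    case 1
    then show ?case using Tj by simp
  next
    case 2
    show ?case
    proof (intro conjI allI impI)
      show "(\<lambda>\<omega>. real_of_ereal (\<Theta> (Suc k) \<omega> - \<Theta> k \<omega>)) \<in> borel_measurable ?U" using meas by simp
      fix u :: real assume u: "0 \<le> u"
      let ?S = "{\<omega>\<in>space M. \<Theta> (Suc k) \<omega> \<le> \<Theta> k \<omega> + ereal u}"
      have S: "?S \<in> sets M" by measurable
      have in_E: "AE \<omega> in ?U. \<omega> \<in> ?E"
        using E0 by (intro AE_uniform_measureI) auto
      have "\<P>(\<omega> in ?U. real_of_ereal (\<Theta> (Suc k) \<omega> - \<Theta> k \<omega>) \<le> u) = measure ?U ?S"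
      proof (rule U.finite_measure_eq_AE)
        show "AE \<omega> in ?U. (\<omega> \<in> {\<omega>\<in>space ?U. real_of_ereal (\<Theta> (Suc k) \<omega> - \<Theta> k \<omega>) \<le> u}) = (\<omega> \<in> ?S)"
          using AE_fin[OF Tj] in_E
        proof eventually_elim
          case (elim \<omega>)
          from elim(2) have sp: "\<omega> \<in> space M" and fin: "\<Theta> k \<omega> < \<infinity>" by (auto simp: at_jump_def)
          note nonneg = jump_time_nonneg[OF sp]
          obtain x where x: "\<Theta> k \<omega> = ereal x" using fin nonneg[of k] by (cases "\<Theta> k \<omega>") auto
          obtain y where y: "\<Theta> (Suc k) \<omega> = ereal y" using elim(1) nonneg[of "Suc k"] by (cases "\<Theta> (Suc k) \<omega>") auto
          show ?case using sp by (auto simp: x y)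
        qed
      qed (use meas S in auto)
      also have "\<dots> = measure M {\<omega>\<in>?E. \<Theta> (Suc k) \<omega> \<le> \<Theta> k \<omega> + ereal u} / measure M ?E"
      proof -
        have "?E \<inter> ?S = {\<omega>\<in>?E. \<Theta> (Suc k) \<omega> \<le> \<Theta> k \<omega> + ereal u}" by (auto simp: at_jump_def)
        then show ?thesis unfolding mU[OF S] by simp
      qed
      also have "\<dots> = 1 - exp (- u * \<bar>T $ j $ j\<bar>)"
        using E Tj T_diag_nonpos[of j] by (simp add: holding_time_law[OF u] mult.commute)
      finally show "\<P>(\<omega> in ?U. real_of_ereal (\<Theta> (Suc k) \<omega> - \<Theta> k \<omega>) \<le> u) = 1 - exp (- u * \<bar>T $ j $ j\<bar>)" .
    qed
  qed
  show "\<P>(\<omega> in ?U. \<phi> (real_of_ereal (\<Theta> (Suc k) \<omega>)) \<omega> = j') = T $ j $ j' / \<bar>T $ j $ j\<bar>"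
    if Tj: "T $ j $ j \<noteq> 0" and j': "j' \<noteq> j"
  proof -
    have "\<P>(\<omega> in ?U. \<phi> (real_of_ereal (\<Theta> (Suc k) \<omega>)) \<omega> = j') = measure ?U (at_jump (Suc k) j')"
    proof (rule U.finite_measure_eq_AE)
      show "AE \<omega> in ?U. (\<omega> \<in> {\<omega>\<in>space ?U. \<phi> (real_of_ereal (\<Theta> (Suc k) \<omega>)) \<omega> = j'}) = (\<omega> \<in> at_jump (Suc k) j')"
        using AE_fin[OF Tj] AE_space by eventually_elim (simp add: at_jump_def)
      show "{\<omega>\<in>space ?U. \<phi> (real_of_ereal (\<Theta> (Suc k) \<omega>)) \<omega> = j'} \<in> sets ?U"
        using measurable_sets[OF phase_at_jump_measurable, of "{j'}" "Suc k"] by (simp add: vimage_def Int_def conj_commute)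
    qed simp
    also have "\<dots> = T $ j $ j' / \<bar>T $ j $ j\<bar>"
      unfolding mU[OF at_jump_sets] using E by (simp add: next_phase_law[OF j' Tj])
    finally show ?thesis .
  qed
qed

end

theorem theorem5p1:
  fixes T :: "real^'s^'s" and c :: "'s \<Rightarrow> real"
    and N :: "'z measure" and Z :: "'z \<Rightarrow> real" and \<Delta> \<epsilon> :: real
    and \<alpha> :: "real^('p::{finite,linorder})" and S :: "real^('p::{finite,linorder})^('p::{finite,linorder})"
    and t :: "'p::{finite,linorder} \<Rightarrow> real"
    and M :: "'w measure" and L :: "real \<Rightarrow> 'w \<Rightarrow> int" and A :: "real \<Rightarrow> 'w \<Rightarrow> real^('p::{finite,linorder})"
    and \<phi> :: "real \<Rightarrow> 'w \<Rightarrow> 's" and \<tau> :: "nat \<Rightarrow> 'w \<Rightarrow> ereal"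
    and M' :: "'v measure" and \<psi> :: "real \<Rightarrow> 'v \<Rightarrow> 's"
    and a :: "real^('p::{finite,linorder})" and i :: 's
  assumes rates: "\<And>i. c i \<noteq> 0"
    and phase_process: "ctmc M' \<psi> T" "AE \<omega> in M'. \<psi> 0 \<omega> = i"
    and me: "me_variable N Z \<Delta> \<epsilon> \<alpha> S t"
    and approximation: "qbd_rap c T \<alpha> S (\<Delta> - \<epsilon>) M L A \<phi> \<tau>"
    and initial_orbit: "a \<in> qbd_rap_data.valid_orbits c \<alpha> S (\<Delta> - \<epsilon>)" "AE \<omega> in M. A 0 \<omega> = a"
    and initial_phase: "AE \<omega> in M. \<phi> 0 \<omega> = i"
  shows "(let \<Theta> = process_jump_time \<phi> in \<forall>k\<ge>1. \<forall>j. let E = {\<omega> \<in> space M. \<Theta> (k - 1) \<omega> < \<infinity> \<and> \<phi> (real_of_ereal (\<Theta> (k - 1) \<omega>)) \<omega> = j} in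
            measure M E > 0 \<longrightarrow>
            (if T $ j $ j = 0 then AE \<omega> in uniform_measure M E. \<Theta> k \<omega> = \<infinity>
             else (AE \<omega> in uniform_measure M E. \<Theta> k \<omega> < \<infinity>) \<and>
               distributed (uniform_measure M E) lborel
                 (\<lambda>\<omega>. real_of_ereal (\<Theta> k \<omega> - \<Theta> (k - 1) \<omega>)) (exponential_density \<bar>T $ j $ j\<bar>) \<and>
               (\<forall>j'. j' \<noteq> j \<longrightarrow>
                  \<P>(\<omega> in uniform_measure M E. \<phi> (real_of_ereal (\<Theta> k \<omega>)) \<omega> = j') = T $ j $ j' / \<bar>T $ j $ j\<bar>)))
       \<and> process_law M \<phi> = process_law M' \<psi>"
proof -
  interpret me: me_variable N Z \<Delta> \<epsilon> \<alpha> S t by (rule me)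
  \<comment> \<open>The smallest of the points \<open>t n\<close> is \<open>0\<close> and lies below \<open>\<Delta> - \<epsilon>\<close>.\<close>
  have d: "0 \<le> \<Delta> - \<epsilon>" using me.t_upper[of "Min UNIV"] me.t_first by simp
  have "row_sum_preserving_qbd_rap_data c T \<alpha> S (\<Delta> - \<epsilon>)"
  proof
    show "generator_matrix T" using phase_process(1) by (rule ctmc.generator)
    fix b y
    show "(b v* qbd_rap_data.D \<alpha> S (\<Delta> - \<epsilon>)) \<bullet> 1 = b \<bullet> 1" by (rule me.D_row_sum[OF d])
    assume b: "b \<in> qbd_rap_data.valid_orbits c \<alpha> S (\<Delta> - \<epsilon>)"
    note valid = me.valid_orbit_residual[OF d b]
    show "b \<bullet> 1 = 1" using valid by simp
    assume y: "0 \<le> (y :: real)"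
    show "0 < (b v* mexp (y *\<^sub>R S)) \<bullet> 1"
      using valid y by (intro me.residual_orbit_inner_1_pos me.residual_orbit_mexp) auto
    show "0 \<le> (b v* mexp (y *\<^sub>R S)) \<bullet> exit_vec S"
      using valid y by (simp add: me.is_residual_orbit_def)
  qed
  then interpret Q: row_sum_preserving_qbd_rap
    where c = c and T = T and \<alpha> = \<alpha> and S = S and d = "\<Delta> - \<epsilon>" and M = M
      and L = L and A = A and \<phi> = \<phi> and \<tau> = \<tau>
      and post = "\<lambda>n \<omega>. (L (real_of_ereal (\<tau> n \<omega>)) \<omega>, A (real_of_ereal (\<tau> n \<omega>)) \<omega>, \<phi> (real_of_ereal (\<tau> n \<omega>)) \<omega>)"
      and history = "\<lambda>n. vimage_algebra (space M)
        (\<lambda>\<omega>. \<lambda>k\<in>{..n}. (\<tau> k \<omega>, (L (real_of_ereal (\<tau> k \<omega>)) \<omega>, A (real_of_ereal (\<tau> k \<omega>)) \<omega>, \<phi> (real_of_ereal (\<tau> k \<omega>)) \<omega>)))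
        (\<Pi>\<^sub>M k\<in>{..n}. borel \<Otimes>\<^sub>M qbd_rap_data.state_space)"
    using approximation by (intro row_sum_preserving_qbd_rap.intro) simp_all
  have E_eq: "{\<omega> \<in> space M. process_jump_time \<phi> k \<omega> < \<infinity> \<and> \<phi> (real_of_ereal (process_jump_time \<phi> k \<omega>)) \<omega> = j} = Q.at_jump k j" for k j
    by (simp add: Q.at_jump_def)
  show ?thesis
    unfolding Let_def
  proof (intro conjI allI impI, goal_cases)
    case (1 k j)
    then obtain m where k: "k = Suc m" by (cases k) auto
    have "0 < measure M (Q.at_jump m j)"
      using 1(2) by (simp only: k diff_Suc_1 E_eq)
    then show ?case
      unfolding k diff_Suc_1 E_eq using Q.conditional_holding_law[of m j] by simp
  next
    case 2
    show ?case
      by (rule ctmc_law_unique[OF Q.phase_ctmc initial_phase phase_process])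
  qed
qed

end
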